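(* Let $\{K_i/F\}_{i\in\omega}$ be a uniformly computable sequence of finite Galois extensions with uniformly computable Galois groups $G_i=\mathrm{Gal}(K_i/F)$, assume that the group actions $G_i\curvearrowright K_i$ are uniformly computable, and let $C\subseteq\omega$ be a cohesive set. Then $\prod_C G_i$ acts faithfully on $\prod_C K_i$ (by $[\sigma][\alpha]=[\,i\mapsto\sigma(i)(\alpha(i))\,]$), and is therefore isomorphic to a subgroup of $\mathrm{Aut}(\prod_C K_i/\prod_C F)$. Further, the map $\prod_C G_i\to\mathrm{Gal}(\mathrm{Alg}(\prod_C K_i)/\prod_C F)$, given by restricting the action of $[\sigma]\in\prod_C G_i$ to the algebraic part, $[\sigma]\mapsto[\sigma]\upharpoonright\mathrm{Alg}(\prod_C K_i)$, has dense image. Moreover, its kernel is exactly $$\Big\{[\sigma]\in\textstyle\prod_CG_i \;\Big|\; \forall n\ \Big\{i \;\Big|\; \sigma(i)\in\bigcap_{H\le G_i,\,[G_i:H]=n}H\Big\}\supseteq^*C\Big\}.$$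
   Context: For $A,B\subseteq\omega$, $A\subseteq^* B$ (equivalently $B\supseteq^*A$) means $A\setminus B$ is finite. A set $C\subseteq\omega$ is cohesive if it is infinite and for every c.e. set $W$ either $C\subseteq^*W$ or $C\subseteq^*\overline{W}$. A sequence of structures $\{\mathcal A_i\}$ is uniformly computable if their domains $\subseteq\omega$ and atomic diagrams are computable uniformly in $i$. The cohesive product $\prod_C\mathcal A_i$ has as domain the classes $[\varphi]$ of partial computable functions $\varphi$ with $\varphi(i)\in\mathcal A_i$ whenever $\varphi(i){\downarrow}$ and with $C\subseteq^*\mathrm{dom}(\varphi)$, where $[\varphi]=[\psi]$ iff $C\subseteq^*\{i:\varphi(i){\downarrow}=\psi(i){\downarrow}\}$; operations are pointwise. $\prod_CF$ is the product of the constant sequence. A field extension $K/F$ is presented as a triple $(K,F,\Psi)$ with $\Psi:F\to K$ a computable ring homomorphism; a sequence $\{K_i/F\}$ is uniformly computable if the fields and the maps $\Psi_i:F\to K_i$ are uniformly computable. $\prod_CF$ is regarded as a subfield of $\prod_CK_i$ via $[\alpha]\mapsto[i\mapsto\Psi_i(\alpha(i))]$. $\mathrm{Alg}(\prod_CK_i)$ is the field of elements of $\prod_CK_i$ algebraic over $\prod_CF$; it is a Galois extension of $\prod_CF$, and its Galois group has the profinite (Krull) topology. In the formula $n$ ranges over positive integers, and an intersection over an empty family of subgroups of $G_i$ is $G_i$. *)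

theory Defs
  imports "HOL-Algebra.Algebra" "HOL-Analysis.Abstract_Topology"
begin

section \<open>Partial recursive functions\<close>

text \<open>
  \<open>partrec n f\<close>: the function \<open>f\<close>, restricted to argument lists of length \<open>n\<close>, is an
  \<open>n\<close>-ary partial recursive function (\<open>None\<close> is divergence). The values of \<open>f\<close> on lists of
  other lengths are junk and are never consulted.
  In \<open>prec\<close> the recursion variable is the first argument; in \<open>mu\<close> the minimised variable is the
  first argument, and \<open>f\<close> has to converge to a nonzero value at all smaller arguments.
\<close>

inductive partrec :: "nat \<Rightarrow> (nat list \<Rightarrow> nat option) \<Rightarrow> bool" where
  zero: "partrec n (\<lambda>xs. Some 0)"
| succ: "partrec 1 (\<lambda>xs. Some (Suc (hd xs)))"
| proj: "i < n \<Longrightarrow> partrec n (\<lambda>xs. Some (xs ! i))"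
| comp: "\<lbrakk>partrec (length gs) f; \<forall>g\<in>set gs. partrec n g\<rbrakk>
    \<Longrightarrow> partrec n (\<lambda>xs. Option.bind (those (map (\<lambda>g. g xs) gs)) f)"
| prec: "\<lbrakk>partrec n f; partrec (Suc (Suc n)) g\<rbrakk>
    \<Longrightarrow> partrec (Suc n)
          (\<lambda>xs. rec_nat (f (tl xs)) (\<lambda>m r. Option.bind r (\<lambda>y. g (m # y # tl xs))) (hd xs))"
| mu: "partrec (Suc n) f
    \<Longrightarrow> partrec n
          (\<lambda>xs. if \<exists>z. f (z # xs) = Some 0 \<and> (\<forall>y<z. \<exists>v. f (y # xs) = Some (Suc v))
                then Some (LEAST z. f (z # xs) = Some 0) else None)"

definition partial_computable :: "(nat \<rightharpoonup> nat) \<Rightarrow> bool" where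
  "partial_computable \<phi> \<longleftrightarrow> (\<exists>f. partrec 1 f \<and> (\<forall>x. f [x] = \<phi> x))"

definition computable_set :: "nat \<Rightarrow> nat list set \<Rightarrow> bool" where
  "computable_set n S \<longleftrightarrow>
     (\<exists>f. partrec n f \<and> (\<forall>xs. length xs = n \<longrightarrow> f xs = Some (if xs \<in> S then 1 else 0)))"

definition ce_set :: "nat set \<Rightarrow> bool" where
  "ce_set W \<longleftrightarrow> (\<exists>\<phi>. partial_computable \<phi> \<and> W = dom \<phi>)"

definition almost_subset :: "nat set \<Rightarrow> nat set \<Rightarrow> bool" (infix \<open>\<subseteq>\<^sup>*\<close> 50) where
  "A \<subseteq>\<^sup>* B \<longleftrightarrow> finite (A - B)"

definition cohesive :: "nat set \<Rightarrow> bool" where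
  "cohesive C \<longleftrightarrow> infinite C \<and> (\<forall>W. ce_set W \<longrightarrow> C \<subseteq>\<^sup>* W \<or> C \<subseteq>\<^sup>* - W)"


section \<open>Uniformly computable sequences of structures\<close>

text \<open>
  The atomic diagram is given by the graphs of the operations and constants on the domain;
  equality of elements is equality of natural numbers and hence decidable.
\<close>

definition unif_computable_group :: "(nat \<Rightarrow> nat monoid) \<Rightarrow> bool" where
  "unif_computable_group G \<longleftrightarrow>
     computable_set 2 {[i, x] | i x. x \<in> carrier (G i)} \<and>
     computable_set 4 {[i, x, y, z] | i x y z. x \<in> carrier (G i) \<and> y \<in> carrier (G i) \<and>
       z \<in> carrier (G i) \<and> x \<otimes>\<^bsub>G i\<^esub> y = z} \<and>
     computable_set 2 {[i, x] | i x. x \<in> carrier (G i) \<and> x = \<one>\<^bsub>G i\<^esub>}"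

definition unif_computable_ring :: "(nat \<Rightarrow> nat ring) \<Rightarrow> bool" where
  "unif_computable_ring K \<longleftrightarrow>
     computable_set 2 {[i, x] | i x. x \<in> carrier (K i)} \<and>
     computable_set 4 {[i, x, y, z] | i x y z. x \<in> carrier (K i) \<and> y \<in> carrier (K i) \<and>
       z \<in> carrier (K i) \<and> x \<oplus>\<^bsub>K i\<^esub> y = z} \<and>
     computable_set 4 {[i, x, y, z] | i x y z. x \<in> carrier (K i) \<and> y \<in> carrier (K i) \<and>
       z \<in> carrier (K i) \<and> x \<otimes>\<^bsub>K i\<^esub> y = z} \<and>
     computable_set 2 {[i, x] | i x. x \<in> carrier (K i) \<and> x = \<zero>\<^bsub>K i\<^esub>} \<and>
     computable_set 2 {[i, x] | i x. x \<in> carrier (K i) \<and> x = \<one>\<^bsub>K i\<^esub>}"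

definition unif_computable_map :: "nat ring \<Rightarrow> (nat \<Rightarrow> nat \<Rightarrow> nat) \<Rightarrow> bool" where
  "unif_computable_map F \<Psi> \<longleftrightarrow>
     (\<exists>f. partrec 2 f \<and> (\<forall>i. \<forall>x\<in>carrier F. f [i, x] = Some (\<Psi> i x)))"

definition unif_computable_action ::
    "(nat \<Rightarrow> nat monoid) \<Rightarrow> (nat \<Rightarrow> nat ring) \<Rightarrow> (nat \<Rightarrow> nat \<Rightarrow> nat \<Rightarrow> nat) \<Rightarrow> bool" where
  "unif_computable_action G K act \<longleftrightarrow>
     (\<exists>f. partrec 3 f \<and>
       (\<forall>i. \<forall>s\<in>carrier (G i). \<forall>x\<in>carrier (K i). f [i, s, x] = Some (act i s x)))"


section \<open>Cohesive products\<close>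

definition cp_dom :: "nat set \<Rightarrow> (nat \<Rightarrow> nat set) \<Rightarrow> (nat \<rightharpoonup> nat) set" where
  "cp_dom C A = {\<phi>. partial_computable \<phi> \<and> (\<forall>i x. \<phi> i = Some x \<longrightarrow> x \<in> A i) \<and> C \<subseteq>\<^sup>* dom \<phi>}"

definition cp_class :: "nat set \<Rightarrow> (nat \<Rightarrow> nat set) \<Rightarrow> (nat \<rightharpoonup> nat) \<Rightarrow> (nat \<rightharpoonup> nat) set" where
  "cp_class C A \<phi> = {\<psi> \<in> cp_dom C A. C \<subseteq>\<^sup>* {i. \<exists>x. \<phi> i = Some x \<and> \<psi> i = Some x}}"

definition cp_carrier :: "nat set \<Rightarrow> (nat \<Rightarrow> nat set) \<Rightarrow> (nat \<rightharpoonup> nat) set set" where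
  "cp_carrier C A = cp_class C A ` cp_dom C A"

definition pointwise ::
    "(nat \<Rightarrow> nat \<Rightarrow> nat \<Rightarrow> nat) \<Rightarrow> (nat \<rightharpoonup> nat) \<Rightarrow> (nat \<rightharpoonup> nat) \<Rightarrow> (nat \<rightharpoonup> nat)" where
  "pointwise h \<phi> \<psi> = (\<lambda>i. Option.bind (\<phi> i) (\<lambda>x. Option.bind (\<psi> i) (\<lambda>y. Some (h i x y))))"

text \<open>
  Pointwise operations on classes. As for quotients elsewhere in the library, the union over all
  representatives is the common value when the operation is well defined on classes; \<open>A\<close> is the
  sequence of domains of the results.
\<close>

definition cp_op ::
    "nat set \<Rightarrow> (nat \<Rightarrow> nat set) \<Rightarrow> (nat \<Rightarrow> nat \<Rightarrow> nat \<Rightarrow> nat) \<Rightarrow>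
     (nat \<rightharpoonup> nat) set \<Rightarrow> (nat \<rightharpoonup> nat) set \<Rightarrow> (nat \<rightharpoonup> nat) set" where
  "cp_op C A h S T = (\<Union>\<phi>\<in>S. \<Union>\<psi>\<in>T. cp_class C A (pointwise h \<phi> \<psi>))"

definition cp_group :: "nat set \<Rightarrow> (nat \<Rightarrow> nat monoid) \<Rightarrow> (nat \<rightharpoonup> nat) set monoid" where
  "cp_group C G =
     (let A = (\<lambda>i. carrier (G i)) in
     \<lparr>carrier = cp_carrier C A,
      monoid.mult = cp_op C A (\<lambda>i x y. x \<otimes>\<^bsub>G i\<^esub> y),
      one = cp_class C A (\<lambda>i. Some \<one>\<^bsub>G i\<^esub>)\<rparr>)"

definition cp_ring :: "nat set \<Rightarrow> (nat \<Rightarrow> nat ring) \<Rightarrow> (nat \<rightharpoonup> nat) set ring" where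
  "cp_ring C K =
     (let A = (\<lambda>i. carrier (K i)) in
     \<lparr>carrier = cp_carrier C A,
      monoid.mult = cp_op C A (\<lambda>i x y. x \<otimes>\<^bsub>K i\<^esub> y),
      one = cp_class C A (\<lambda>i. Some \<one>\<^bsub>K i\<^esub>),
      ring.zero = cp_class C A (\<lambda>i. Some \<zero>\<^bsub>K i\<^esub>),
      ring.add = cp_op C A (\<lambda>i x y. x \<oplus>\<^bsub>K i\<^esub> y)\<rparr>)"

text \<open>The cohesive power of \<open>F\<close>, as a subset of the cohesive product of the \<open>K i\<close>.\<close>

definition cp_embed ::
    "nat set \<Rightarrow> (nat \<Rightarrow> nat ring) \<Rightarrow> (nat \<Rightarrow> nat \<Rightarrow> nat) \<Rightarrow>
     (nat \<rightharpoonup> nat) set \<Rightarrow> (nat \<rightharpoonup> nat) set" where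
  "cp_embed C K \<Psi> S =
     (\<Union>\<phi>\<in>S. cp_class C (\<lambda>i. carrier (K i)) (\<lambda>i. map_option (\<Psi> i) (\<phi> i)))"

definition cp_base ::
    "nat set \<Rightarrow> nat ring \<Rightarrow> (nat \<Rightarrow> nat ring) \<Rightarrow> (nat \<Rightarrow> nat \<Rightarrow> nat) \<Rightarrow> (nat \<rightharpoonup> nat) set set" where
  "cp_base C F K \<Psi> = cp_embed C K \<Psi> ` carrier (cp_ring C (\<lambda>_. F))"

definition cp_act ::
    "nat set \<Rightarrow> (nat \<Rightarrow> nat ring) \<Rightarrow> (nat \<Rightarrow> nat \<Rightarrow> nat \<Rightarrow> nat) \<Rightarrow>
     (nat \<rightharpoonup> nat) set \<Rightarrow> (nat \<rightharpoonup> nat) set \<Rightarrow> (nat \<rightharpoonup> nat) set" where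
  "cp_act C K act = cp_op C (\<lambda>i. carrier (K i)) act"


section \<open>Galois theory\<close>

text \<open>Field extensions are given by a field \<open>L\<close> together with a subset \<open>k\<close> that is a subfield.\<close>

definition alg_part :: "'a ring \<Rightarrow> 'a set \<Rightarrow> 'a ring" where
  "alg_part L k = L\<lparr>carrier := {x \<in> carrier L. ring.algebraic L k x}\<rparr>"

text \<open>
  Algebraic, normal and separable: an irreducible polynomial over \<open>k\<close> with a root in \<open>L\<close> splits
  into distinct linear factors over \<open>L\<close>.
\<close>

definition galois_extension :: "'a ring \<Rightarrow> 'a set \<Rightarrow> bool" where
  "galois_extension L k \<longleftrightarrow>
     field L \<and> subfield k L \<and> (\<forall>x\<in>carrier L. ring.algebraic L k x) \<and>
     (\<forall>p\<in>carrier (univ_poly L k). pirreducible\<^bsub>L\<^esub> k p \<and> (\<exists>x. ring.is_root L p x) \<longrightarrow>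
        ring.splitted L p \<and> (\<forall>x\<in>carrier L. ring.alg_mult L p x \<le> 1))"

text \<open>Automorphisms are extensional functions, as in \<^const>\<open>BijGroup\<close>.\<close>

definition field_auts :: "'a ring \<Rightarrow> 'a set \<Rightarrow> ('a \<Rightarrow> 'a) set" where
  "field_auts L k = {f \<in> ring_hom L L \<inter> Bij (carrier L). \<forall>x\<in>k. f x = x}"

definition AutGroup_over :: "'a ring \<Rightarrow> 'a set \<Rightarrow> ('a \<Rightarrow> 'a) monoid" where
  "AutGroup_over L k = BijGroup (carrier L)\<lparr>carrier := field_auts L k\<rparr>"

text \<open>
  Generated by the cosets of the subgroups fixing \<open>E\<close>, where \<open>E\<close> ranges over the intermediate
  fields that are finite Galois extensions of \<open>k\<close>.
\<close>

definition krull_topology :: "'a ring \<Rightarrow> 'a set \<Rightarrow> ('a \<Rightarrow> 'a) topology" where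
  "krull_topology L k = topology_generated_by
     {{\<tau> \<in> field_auts L k. \<forall>x\<in>E. \<tau> x = \<sigma> x} | \<sigma> E.
        \<sigma> \<in> field_auts L k \<and> subfield E L \<and> k \<subseteq> E \<and>
        ring.finite_dimension L k E \<and> galois_extension (L\<lparr>carrier := E\<rparr>) k}"

text \<open>
  The hypotheses on the sequence of extensions \<open>\<Psi> i : F \<rightarrow> K i\<close> and of Galois groups: \<open>G i\<close> is a
  group on a set of natural numbers which is identified, via its action \<open>act i\<close> on \<open>K i\<close>, with the
  Galois group of \<open>K i\<close> over the image of \<open>F\<close>.
\<close>

definition unif_computable_galois_sequence ::
    "nat ring \<Rightarrow> (nat \<Rightarrow> nat ring) \<Rightarrow> (nat \<Rightarrow> nat \<Rightarrow> nat) \<Rightarrow> (nat \<Rightarrow> nat monoid) \<Rightarrow>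
     (nat \<Rightarrow> nat \<Rightarrow> nat \<Rightarrow> nat) \<Rightarrow> bool" where
  "unif_computable_galois_sequence F K \<Psi> G act \<longleftrightarrow>
     field F \<and> (\<forall>i. field (K i)) \<and> (\<forall>i. \<Psi> i \<in> ring_hom F (K i)) \<and>
     unif_computable_ring (\<lambda>_. F) \<and> unif_computable_ring K \<and> unif_computable_map F \<Psi> \<and>
     (\<forall>i. ring.finite_dimension (K i) (\<Psi> i ` carrier F) (carrier (K i)) \<and>
          galois_extension (K i) (\<Psi> i ` carrier F)) \<and>
     (\<forall>i. group (G i)) \<and> unif_computable_group G \<and> unif_computable_action G K act \<and>
     (\<forall>i. (\<lambda>s. restrict (act i s) (carrier (K i)))
            \<in> iso (G i) (AutGroup_over (K i) (\<Psi> i ` carrier F)))"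

end

theory Submission
  imports Defs
begin

text \<open>
  For almost all \<open>i \<in> C\<close>, an element of a cohesive product has a value at \<open>i\<close>. Cohesiveness makes every
  c.e. condition on \<open>i\<close> hold almost everywhere on \<open>C\<close> or fail almost everywhere, and a decidable
  condition that is solvable almost everywhere is solved by an element of the product, namely by
  search. This yields inverses and faithfulness.

  Density: let \<open>\<tau>\<close> be an automorphism, \<open>a\<^sub>1, \<dots>, a\<^sub>m\<close> algebraic and \<open>b\<^sub>j = \<tau> a\<^sub>j\<close>. If the search for
  \<open>s \<in> G\<^sub>i\<close> with \<open>s a\<^sub>j(i) = b\<^sub>j(i)\<close> for all \<open>j\<close> fails almost everywhere, consider the product of the
  factors \<open>X\<^sub>j - c\<close>, where \<open>c \<noteq> b\<^sub>j(i)\<close> is a conjugate of \<open>a\<^sub>j(i)\<close>. Its degree is bounded independently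
  of \<open>i\<close>, it vanishes at all conjugates of the tuple \<open>a(i)\<close>, and it does not vanish at \<open>b(i)\<close>. Galois
  descent turns it into a polynomial over \<open>F\<close> of the same degree that separates \<open>a(i)\<close> from \<open>b(i)\<close>. Such
  polynomials are found by search and form a polynomial over the cohesive power of \<open>F\<close> that separates
  \<open>a\<close> from \<open>\<tau> a\<close>, which is absurd. Working with tuples avoids primitive elements, and hence a case
  distinction on whether \<open>F\<close> is finite.

  Kernel: a point of \<open>K\<^sub>i\<close> of degree at most \<open>n\<close> has a stabilizer of index at most \<open>n\<close>, and a subgroup
  of index \<open>n\<close> is the pointwise stabilizer of its fixed points, which have degree at most \<open>n\<close>.
\<close>

section \<open>Computable functions\<close>

text \<open>What is computable about the \<open>K i\<close> dictates the form of the statements.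
  Every condition passed between the product and its factors is therefore brought to one form: there
  are numbers, how many being independent of \<open>i\<close>, that satisfy a decidable condition.
  "At most n conjugates" becomes "root of a polynomial of degree n over \<open>F\<close>", whose
  coefficients are sought in \<open>F\<close> itself and then mapped by \<open>\<Psi> i\<close>. The
  translation takes place in a single \<open>K i\<close>: the fixed field of \<open>G i\<close> is
  the image of \<open>F\<close>, and the independence of automorphisms yields coefficients in that
  field while keeping one chosen quantity nonzero. That quantity is the value at \<open>b\<close> in
  the density proof and the leading coefficient in the kernel proof.\<close>

definition pr :: "nat \<Rightarrow> (nat list \<Rightarrow> nat option) \<Rightarrow> bool" where
  "pr n f \<longleftrightarrow> (\<exists>g. partrec n g \<and> (\<forall>xs. length xs = n \<longrightarrow> g xs = f xs))"

abbreviation total_rec :: "nat \<Rightarrow> (nat list \<Rightarrow> nat) \<Rightarrow> bool" where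
  "total_rec n g \<equiv> pr n (\<lambda>xs. Some (g xs))"

lemma pr_partrec: "partrec n f \<Longrightarrow> pr n f"
  by (auto simp: pr_def)

text \<open>\<open>partrec\<close> speaks of functions on all lists, so it also dictates the junk
  values off length \<open>n\<close>. \<open>pr\<close> forgets these, which permits a convenient
  formula for each function.\<close>

lemma pr_cong:
  assumes "pr n f" "\<And>xs. length xs = n \<Longrightarrow> f xs = g xs"
  shows "pr n g"
  using assms unfolding pr_def by metis

lemma length_those: "those ys = Some zs \<Longrightarrow> length zs = length ys"
  by (induction ys arbitrary: zs) (auto split: option.splits)

lemma pr_comp:
  assumes f: "pr (length gs) f" and gs: "\<And>g. g \<in> set gs \<Longrightarrow> pr n g"
  shows "pr n (\<lambda>xs. Option.bind (those (map (\<lambda>g. g xs) gs)) f)"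
proof -
  obtain f' where f': "partrec (length gs) f'" "\<And>xs. length xs = length gs \<Longrightarrow> f' xs = f xs"
    using f unfolding pr_def by blast
  have "\<forall>g\<in>set gs. \<exists>g'. partrec n g' \<and> (\<forall>xs. length xs = n \<longrightarrow> g' xs = g xs)"
    using gs unfolding pr_def by blast
  then obtain h where h: "\<And>g. g \<in> set gs \<Longrightarrow> partrec n (h g)"
    "\<And>g xs. g \<in> set gs \<Longrightarrow> length xs = n \<Longrightarrow> h g xs = g xs" by metis
  have "partrec n (\<lambda>xs. Option.bind (those (map (\<lambda>g. g xs) (map h gs))) f')"
    using f'(1) h(1) by (intro partrec.comp) auto
  then show ?thesis
  proof (rule pr_cong[OF pr_partrec])
    fix xs :: "nat list" assume xs: "length xs = n"
    then have M: "map (\<lambda>g. g xs) (map h gs) = map (\<lambda>g. g xs) gs" using h(2) by simp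
    then show "Option.bind (those (map (\<lambda>g. g xs) (map h gs))) f' = Option.bind (those (map (\<lambda>g. g xs) gs)) f"
      unfolding M using f'(2) length_those[of "map (\<lambda>g. g xs) gs"]
      by (cases "those (map (\<lambda>g. g xs) gs)") auto
  qed
qed

lemma pr_comp1:
  assumes "pr 1 f" "pr n a"
  shows "pr n (\<lambda>xs. Option.bind (a xs) (\<lambda>x. f [x]))"
  by (rule pr_cong[OF pr_comp[of "[a]" f n]]) (use assms in \<open>auto split: Option.bind_splits option.splits\<close>)

lemma pr_comp2:
  assumes "pr 2 f" "pr n a" "pr n b"
  shows "pr n (\<lambda>xs. Option.bind (a xs) (\<lambda>x. Option.bind (b xs) (\<lambda>y. f [x, y])))"
  by (rule pr_cong[OF pr_comp[of "[a, b]" f n]])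
    (use assms in \<open>auto simp: numeral_2_eq_2 split: Option.bind_splits option.splits\<close>)

lemma pr_comp3:
  assumes "pr 3 f" "pr n a" "pr n b" "pr n c"
  shows "pr n (\<lambda>xs. Option.bind (a xs) (\<lambda>x. Option.bind (b xs) (\<lambda>y. Option.bind (c xs) (\<lambda>z. f [x, y, z]))))"
  by (rule pr_cong[OF pr_comp[of "[a, b, c]" f n]])
    (use assms in \<open>auto simp: numeral_3_eq_3 split: Option.bind_splits option.splits\<close>)

lemma pr_mu:
  assumes "pr (Suc n) f"
  shows "pr n (\<lambda>xs. if \<exists>z. f (z # xs) = Some 0 \<and> (\<forall>y<z. \<exists>v. f (y # xs) = Some (Suc v))
                then Some (LEAST z. f (z # xs) = Some 0) else None)"
proof -
  obtain f' where f': "partrec (Suc n) f'" "\<And>xs. length xs = Suc n \<Longrightarrow> f' xs = f xs"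
    using assms unfolding pr_def by blast
  show ?thesis by (rule pr_cong[OF pr_partrec[OF partrec.mu[OF f'(1)]]]) (simp add: f'(2))
qed

text \<open>Totality of \<open>f\<close> is required at one \<open>xs\<close> at a time. A search
  may thus run on data that are defined only at almost all indices, and it is correct at
  those.\<close>

lemma pr_search:
  assumes "pr (Suc n) f"
  shows "\<exists>g. pr n g \<and> (\<forall>xs h. (\<forall>z. f (z # xs) = Some (h z)) \<longrightarrow>
    g xs = (if \<exists>z. h z = 0 then Some (LEAST z. h z = 0) else None))"
proof (intro exI conjI allI impI, rule pr_mu[OF assms])
  fix xs and h :: "nat \<Rightarrow> nat" assume f: "\<forall>z. f (z # xs) = Some (h z)"
  have "(\<exists>z. f (z # xs) = Some 0 \<and> (\<forall>y<z. \<exists>v. f (y # xs) = Some (Suc v))) \<longleftrightarrow> (\<exists>z. h z = 0)"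
  proof
    assume "\<exists>z. h z = 0"
    then have "h (LEAST z. h z = 0) = 0" by (rule LeastI_ex)
    moreover have "\<exists>v. h y = Suc v" if "y < (LEAST z. h z = 0)" for y
      using not_less_Least[OF that] not0_implies_Suc by blast
    ultimately show "\<exists>z. f (z # xs) = Some 0 \<and> (\<forall>y<z. \<exists>v. f (y # xs) = Some (Suc v))"
      using f by auto
  qed (auto simp: f)
  then show "(if \<exists>z. f (z # xs) = Some 0 \<and> (\<forall>y<z. \<exists>v. f (y # xs) = Some (Suc v))
      then Some (LEAST z. f (z # xs) = Some 0) else None)
     = (if \<exists>z. h z = 0 then Some (LEAST z. h z = 0) else None)"
    by (simp add: f)
qed

section \<open>Elementary arithmetic\<close>

lemma total_rec_proj: "i < n \<Longrightarrow> total_rec n (\<lambda>xs. xs ! i)"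
  by (rule pr_partrec[OF partrec.proj])

lemma total_rec_Suc:
  assumes "total_rec n a" shows "total_rec n (\<lambda>xs. Suc (a xs))"
  using pr_comp1[OF pr_partrec[OF partrec.succ] assms] by simp

lemma total_rec_const: "total_rec n (\<lambda>xs. c)"
proof (induction c)
  case 0
  show ?case by (rule pr_partrec[OF partrec.zero])
next
  case (Suc c)
  then show ?case by (rule total_rec_Suc)
qed

lemma total_rec_comp1:
  assumes "total_rec 1 (\<lambda>xs. f (xs ! 0))" "total_rec n a"
  shows "total_rec n (\<lambda>xs. f (a xs))"
  using pr_comp1[OF assms] by simp

lemma total_rec_comp2:
  assumes "total_rec 2 (\<lambda>xs. f (xs ! 0) (xs ! 1))" "total_rec n a" "total_rec n b"
  shows "total_rec n (\<lambda>xs. f (a xs) (b xs))"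
  using pr_comp2[OF assms] by simp

lemma total_rec_prec:
  assumes "total_rec n f" "total_rec (Suc (Suc n)) g"
  shows "total_rec (Suc n) (\<lambda>xs. rec_nat (f (tl xs)) (\<lambda>m r. g (m # r # tl xs)) (hd xs))"
proof -
  obtain f' where f': "partrec n f'" "\<And>xs. length xs = n \<Longrightarrow> f' xs = Some (f xs)"
    using assms(1) unfolding pr_def by blast
  obtain g' where g': "partrec (Suc (Suc n)) g'" "\<And>xs. length xs = Suc (Suc n) \<Longrightarrow> g' xs = Some (g xs)"
    using assms(2) unfolding pr_def by blast
  show ?thesis
  proof (rule pr_cong[OF pr_partrec[OF partrec.prec[OF f'(1) g'(1)]]])
    fix xs :: "nat list" assume xs: "length xs = Suc n"
    have "rec_nat (f' (tl xs)) (\<lambda>m r. Option.bind r (\<lambda>y. g' (m # y # tl xs))) k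
        = Some (rec_nat (f (tl xs)) (\<lambda>m r. g (m # r # tl xs)) k)" for k
      by (induction k) (use xs f'(2) g'(2) in auto)
    then show "rec_nat (f' (tl xs)) (\<lambda>m r. Option.bind r (\<lambda>y. g' (m # y # tl xs))) (hd xs)
        = Some (rec_nat (f (tl xs)) (\<lambda>m r. g (m # r # tl xs)) (hd xs))" .
  qed
qed

lemma length_2_nth: "length xs = 2 \<Longrightarrow> xs = [xs ! 0, xs ! 1]"
  by (auto simp: numeral_2_eq_2 length_Suc_conv)

lemma total_rec_prec1:
  assumes "total_rec 3 (\<lambda>xs. g (xs ! 0) (xs ! 1) (xs ! 2))" "total_rec 1 (\<lambda>xs. f (xs ! 0))"
  shows "total_rec 2 (\<lambda>xs. rec_nat (f (xs ! 1)) (\<lambda>m r. g m r (xs ! 1)) (xs ! 0))"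
proof -
  have "total_rec (Suc (Suc 1)) (\<lambda>xs. g (xs ! 0) (xs ! 1) (xs ! 2))"
    using assms(1) by (simp add: numeral_3_eq_3)
  from total_rec_prec[OF assms(2) this] show ?thesis
    unfolding Suc_1[symmetric] by (rule pr_cong) (auto simp: length_Suc_conv)
qed

lemma total_rec_add:
  assumes "total_rec n a" "total_rec n b" shows "total_rec n (\<lambda>xs. a xs + b xs)"
proof (rule total_rec_comp2[OF _ assms])
  have *: "rec_nat y (\<lambda>m r. Suc r) x = x + y" for x y by (induction x) auto
  have "total_rec 2 (\<lambda>xs. rec_nat (xs ! 1) (\<lambda>m r. Suc r) (xs ! 0))"
    by (rule total_rec_prec1[where g = "\<lambda>m r y. Suc r" and f = "\<lambda>y. y"])
      (auto intro!: total_rec_Suc total_rec_proj)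
  then show "total_rec 2 (\<lambda>xs. xs ! 0 + xs ! 1)" by (simp add: *)
qed

lemma total_rec_mult:
  assumes "total_rec n a" "total_rec n b" shows "total_rec n (\<lambda>xs. a xs * b xs)"
proof (rule total_rec_comp2[OF _ assms])
  have *: "rec_nat 0 (\<lambda>m r. r + y) x = x * y" for x y :: nat by (induction x) auto
  have "total_rec 2 (\<lambda>xs. rec_nat 0 (\<lambda>m r. r + xs ! 1) (xs ! 0))"
    by (rule total_rec_prec1[where g = "\<lambda>m r y. r + y" and f = "\<lambda>y. 0"])
      (auto intro!: total_rec_add total_rec_proj total_rec_const)
  then show "total_rec 2 (\<lambda>xs. xs ! 0 * xs ! 1)" by (simp add: *)
qed

lemma total_rec_pred:
  assumes "total_rec n a" shows "total_rec n (\<lambda>xs. a xs - 1)"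
proof -
  have *: "rec_nat 0 (\<lambda>m r. m) x = x - 1" for x :: nat by (induction x) auto
  have "total_rec 2 (\<lambda>xs. rec_nat 0 (\<lambda>m r. m) (xs ! 0))"
    by (rule total_rec_prec1[where g = "\<lambda>m r y. m" and f = "\<lambda>y. 0"])
      (auto intro!: total_rec_proj total_rec_const)
  from total_rec_comp2[of "\<lambda>x y. rec_nat 0 (\<lambda>m r. m) x", OF this assms assms]
  show ?thesis by (simp add: *)
qed

lemma total_rec_diff:
  assumes "total_rec n a" "total_rec n b" shows "total_rec n (\<lambda>xs. a xs - b xs)"
\<comment> \<open>The recursion runs over the first argument, which has to be the subtrahend; hence
  the swap.\<close>
proof (rule total_rec_comp2[OF _ assms(2,1), where f = "\<lambda>x y. y - x"])
  have *: "rec_nat y (\<lambda>m r. r - 1) x = y - x" for x y :: nat by (induction x) auto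
  have "total_rec 2 (\<lambda>xs. rec_nat (xs ! 1) (\<lambda>m r. r - 1) (xs ! 0))"
    by (rule total_rec_prec1[where g = "\<lambda>m r y. r - 1" and f = "\<lambda>y. y"])
      (rule total_rec_pred total_rec_proj | simp)+
  then show "total_rec 2 (\<lambda>xs. xs ! 1 - xs ! 0)" unfolding * .
qed

lemma total_rec_eq:
  assumes "total_rec n a" "total_rec n b" shows "total_rec n (\<lambda>xs. of_bool (a xs = b xs))"
proof -
  have "total_rec n (\<lambda>xs. 1 - ((a xs - b xs) + (b xs - a xs)))"
    using assms by (intro total_rec_diff total_rec_add total_rec_const)
  then show ?thesis by (rule pr_cong) auto
qed

lemma total_rec_Least:
  assumes "total_rec (Suc n) g" "\<And>xs. \<exists>z. g (z # xs) = 0"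
  shows "total_rec n (\<lambda>xs. LEAST z. g (z # xs) = 0)"
proof -
  obtain h where h: "pr n h" "\<forall>xs h'. (\<forall>z. Some (g (z # xs)) = Some (h' z)) \<longrightarrow>
    h xs = (if \<exists>z. h' z = 0 then Some (LEAST z. h' z = 0) else None)"
    using pr_search[OF assms(1)] by (elim exE conjE)
  show ?thesis
  proof (rule pr_cong[OF h(1)])
    show "h xs = Some (LEAST z. g (z # xs) = 0)" for xs
      using h(2)[rule_format, of xs "\<lambda>z. g (z # xs)"] assms(2)[of xs] by simp
  qed
qed

text \<open>Tuples are coded with the pairing \<open>(a, b) \<mapsto> (a + b)\<^sup>2 + a\<close>, whose inverse only needs the
  integer square root. Decoding is onto, which is all that a search over tuples requires.\<close>

definition isqrt :: "nat \<Rightarrow> nat" where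
  "isqrt z = (LEAST q. Suc z - Suc q * Suc q = 0)"

text \<open>For \<open>q = isqrt z\<close>, the components of the pair are \<open>z - q * q\<close>
  and \<open>q - (z - q * q)\<close>. Tuples are nested to the right without an end marker, so one
  number codes tuples of all lengths at once.\<close>

fun dec :: "nat \<Rightarrow> nat \<Rightarrow> nat" where
  "dec 0 z = z - isqrt z * isqrt z"
| "dec (Suc j) z = dec j (isqrt z - (z - isqrt z * isqrt z))"

lemma total_rec_isqrt:
  assumes "total_rec n a" shows "total_rec n (\<lambda>xs. isqrt (a xs))"
proof (rule total_rec_comp1[OF _ assms])
  define g where "g xs = Suc (xs ! 1) - Suc (xs ! 0) * Suc (xs ! 0)" for xs
  have g: "total_rec (Suc 1) g"
    unfolding g_def by (rule total_rec_diff total_rec_mult total_rec_Suc total_rec_proj | simp)+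
  have "g (z # xs) = Suc (xs ! 0) - Suc z * Suc z" for z xs
    unfolding g_def by (simp only: One_nat_def nth_Cons_Suc nth_Cons_0)
  note g_simp = this
  have "total_rec 1 (\<lambda>xs. LEAST z. g (z # xs) = 0)"
  proof (rule total_rec_Least[OF g])
    show "\<exists>z. g (z # xs) = 0" for xs
      unfolding g_simp by (rule exI[of _ "xs ! 0"]) (metis diff_is_0_eq le_add1 mult_Suc)
  qed
  then show "total_rec 1 (\<lambda>xs. isqrt (xs ! 0))" unfolding g_simp isqrt_def .
qed

lemma total_rec_dec:
  assumes "total_rec n a" shows "total_rec n (\<lambda>xs. dec j (a xs))"
  using assms
proof (induction j arbitrary: a)
  case 0
  have q: "total_rec n (\<lambda>xs. isqrt (a xs))" by (rule total_rec_isqrt[OF 0])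
  show ?case unfolding dec.simps by (rule total_rec_diff[OF 0 total_rec_mult[OF q q]])
next
  case (Suc j)
  have q: "total_rec n (\<lambda>xs. isqrt (a xs))" by (rule total_rec_isqrt[OF Suc.prems])
  show ?case
    unfolding dec.simps
    by (rule Suc.IH[OF total_rec_diff[OF q total_rec_diff[OF Suc.prems total_rec_mult[OF q q]]]])
qed

lemma isqrt_eqI:
  assumes "q * q \<le> z" "z < Suc q * Suc q"
  shows "isqrt z = q"
  unfolding isqrt_def
proof (rule Least_equality)
  show "Suc z - Suc q * Suc q = 0" using assms by simp
next
  fix r assume "Suc z - Suc r * Suc r = 0"
  then have "z < Suc r * Suc r" by simp
  show "q \<le> r"
  proof (rule ccontr)
    assume "\<not> q \<le> r"
    then have "Suc r * Suc r \<le> q * q" by (intro mult_le_mono) auto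
    then show False using \<open>z < Suc r * Suc r\<close> assms(1) by simp
  qed
qed

lemma isqrt_pair: "isqrt ((a + b) * (a + b) + a) = a + b"
proof (rule isqrt_eqI)
  have "Suc (a + b) * Suc (a + b) = Suc ((a + b) * (a + b) + a + (a + 2 * b))" by (simp only: mult_Suc mult_Suc_right)
  then show "(a + b) * (a + b) + a < Suc (a + b) * Suc (a + b)" by linarith
qed simp

lemma dec_surj: "\<exists>z. \<forall>j<M. dec j z = t j"
proof (induction M arbitrary: t)
  case (Suc M)
  obtain b where b: "\<forall>j<M. dec j b = t (Suc j)" using Suc.IH[of "\<lambda>j. t (Suc j)"] by blast
  let ?z = "(t 0 + b) * (t 0 + b) + t 0"
  have q: "isqrt ?z = t 0 + b" by (rule isqrt_pair)
  show ?case
  proof (intro exI[of _ ?z] allI impI)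
    fix j assume "j < Suc M"
    then show "dec j ?z = t j" by (cases j) (use b q in auto)
  qed
qed simp

lemma partial_computable_iff: "partial_computable \<phi> \<longleftrightarrow> pr 1 (\<lambda>xs. \<phi> (xs ! 0))"
proof -
  have "(\<forall>x. f [x] = \<phi> x) \<longleftrightarrow> (\<forall>xs. length xs = 1 \<longrightarrow> f xs = \<phi> (xs ! 0))" for f
    by (auto simp: length_Suc_conv)
  then show ?thesis by (simp add: partial_computable_def pr_def)
qed

lemma computable_set_iff: "computable_set n S \<longleftrightarrow> total_rec n (\<lambda>xs. of_bool (xs \<in> S))"
proof -
  have *: "(if b then 1 else 0) = (of_bool b :: nat)" for b by simp
  show ?thesis unfolding computable_set_def pr_def * ..
qed

section \<open>Elements of cohesive products\<close>

text \<open>The filter of sets that contain almost all of \<open>C\<close>. It turns inclusions up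
  to finite sets into eventual statements, finitely many of which can be combined.\<close>

definition cofin :: "nat set \<Rightarrow> nat filter" where
  "cofin C = inf cofinite (principal C)"

lemma eventually_cofin: "eventually P (cofin C) \<longleftrightarrow> finite {i \<in> C. \<not> P i}"
  unfolding cofin_def eventually_inf_principal eventually_cofinite
  by (simp add: conj_commute)

lemma almost_subset_iff: "C \<subseteq>\<^sup>* A \<longleftrightarrow> (\<forall>\<^sub>F i in cofin C. i \<in> A)"
  unfolding almost_subset_def eventually_cofin
  by (rule arg_cong[of _ _ finite]) auto

lemma cofin_neq_bot: "infinite C \<Longrightarrow> cofin C \<noteq> bot"
  unfolding trivial_limit_def eventually_cofin by simp

text \<open>\<open>ucomp C A a\<close>: for almost all \<open>i \<in> C\<close>, the function \<open>a i\<close> maps into \<open>A i\<close>, and it is computable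
  uniformly in these \<open>i\<close>. This absorbs the finitely many indices at which
  representatives of elements of a cohesive product are undefined or disagree.\<close>

definition ucomp :: "nat set \<Rightarrow> (nat \<Rightarrow> nat set) \<Rightarrow> (nat \<Rightarrow> nat \<Rightarrow> nat) \<Rightarrow> bool" where
  "ucomp C A a \<longleftrightarrow> (\<exists>f. pr 2 f \<and> (\<forall>\<^sub>F i in cofin C. \<forall>z. f [i, z] = Some (a i z) \<and> a i z \<in> A i))"

text \<open>The argument \<open>z\<close> is the variable of a later search over all numbers. At
  almost all \<open>i\<close> the condition has to be decided for every \<open>z\<close>, which is
  why guesses are forced into the domains before they are used.\<close>

abbreviation udec :: "nat set \<Rightarrow> (nat \<Rightarrow> nat \<Rightarrow> bool) \<Rightarrow> bool" where
  "udec C P \<equiv> ucomp C (\<lambda>_. UNIV) (\<lambda>i z. of_bool (P i z))"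

text \<open>Unlike \<open>ucomp\<close>, the notions for constants and operations hold at every
  index: the structures are uniformly computable without exceptions, and only elements of the
  product have exceptional indices.\<close>

definition uconst :: "(nat \<Rightarrow> nat set) \<Rightarrow> (nat \<Rightarrow> nat) \<Rightarrow> bool" where
  "uconst D c \<longleftrightarrow> total_rec 1 (\<lambda>xs. c (xs ! 0)) \<and> (\<forall>i. c i \<in> D i)"

definition uop1 :: "(nat \<Rightarrow> nat set) \<Rightarrow> (nat \<Rightarrow> nat set) \<Rightarrow> (nat \<Rightarrow> nat \<Rightarrow> nat) \<Rightarrow> bool" where
  "uop1 A D h \<longleftrightarrow> (\<exists>f. pr 2 f \<and> (\<forall>i. \<forall>x\<in>A i. f [i, x] = Some (h i x) \<and> h i x \<in> D i))"

definition uop2 ::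
  "(nat \<Rightarrow> nat set) \<Rightarrow> (nat \<Rightarrow> nat set) \<Rightarrow> (nat \<Rightarrow> nat set) \<Rightarrow> (nat \<Rightarrow> nat \<Rightarrow> nat \<Rightarrow> nat) \<Rightarrow> bool" where
  "uop2 A B D h \<longleftrightarrow> (\<exists>f. pr 3 f \<and>
     (\<forall>i. \<forall>x\<in>A i. \<forall>y\<in>B i. f [i, x, y] = Some (h i x y) \<and> h i x y \<in> D i))"

definition uset :: "(nat \<Rightarrow> nat set) \<Rightarrow> bool" where
  "uset A \<longleftrightarrow> total_rec 2 (\<lambda>xs. of_bool (xs ! 1 \<in> A (xs ! 0)))"

lemma uset_computable_set: "computable_set 2 {[i, x] | i x. x \<in> A i} \<longleftrightarrow> uset A"
proof -
  have "of_bool (xs \<in> {[i, x] | i x. x \<in> A i}) = (of_bool (xs ! 1 \<in> A (xs ! 0)) :: nat)" if "length xs = 2" for xs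
    using length_2_nth[OF that] by force
  then show ?thesis
    unfolding computable_set_iff uset_def using pr_cong by (smt (verit, best))
qed

lemma ucomp_mono:
  assumes "ucomp C A a" "\<forall>\<^sub>F i in cofin C. \<forall>z. a i z \<in> A i \<longrightarrow> b i z = a i z \<and> b i z \<in> B i"
  shows "ucomp C B b"
proof -
  obtain f where f: "pr 2 f" "\<forall>\<^sub>F i in cofin C. \<forall>z. f [i, z] = Some (a i z) \<and> a i z \<in> A i"
    using assms(1) unfolding ucomp_def by blast
  show ?thesis unfolding ucomp_def
    by (intro exI[of _ f] conjI f(1) eventually_mono[OF eventually_conj[OF f(2) assms(2)]]) metis
qed

lemma ucomp_UNIV: "ucomp C A a \<Longrightarrow> ucomp C (\<lambda>_. UNIV) a"
  by (erule ucomp_mono) simp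

lemma ucompD: "ucomp C A a \<Longrightarrow> \<forall>\<^sub>F i in cofin C. \<forall>z. a i z \<in> A i"
  unfolding ucomp_def by (auto elim: eventually_mono)

lemma ucomp_var: "ucomp C (\<lambda>_. UNIV) (\<lambda>i z. z)"
  unfolding ucomp_def by (rule exI[of _ "\<lambda>xs. Some (xs ! 1)"]) (auto intro: total_rec_proj)

lemma ucomp_const:
  assumes "uconst D c" shows "ucomp C D (\<lambda>i z. c i)"
  using assms total_rec_comp1[of c 2 "\<lambda>xs. xs ! 0"] total_rec_proj[of 0 2]
  unfolding ucomp_def uconst_def by (intro exI[of _ "\<lambda>xs. Some (c (xs ! 0))"]) auto

lemma ucomp_op1:
  assumes h: "uop1 A D h" and a: "ucomp C A a"
  shows "ucomp C D (\<lambda>i z. h i (a i z))"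
proof -
  obtain f where f: "pr 2 f" "\<And>i x. x \<in> A i \<Longrightarrow> f [i, x] = Some (h i x) \<and> h i x \<in> D i"
    using h unfolding uop1_def by blast
  obtain fa where fa: "pr 2 fa" "\<forall>\<^sub>F i in cofin C. \<forall>z. fa [i, z] = Some (a i z) \<and> a i z \<in> A i"
    using a unfolding ucomp_def by blast
  let ?f = "\<lambda>xs. Option.bind (Some (xs ! 0)) (\<lambda>i. Option.bind (fa xs) (\<lambda>x. f [i, x]))"
  have "pr 2 ?f" by (rule pr_comp2[OF f(1) total_rec_proj fa(1)]) simp
  then show ?thesis unfolding ucomp_def
    by (intro exI[of _ ?f] conjI eventually_mono[OF fa(2)]) (use f(2) in auto)
qed

lemma ucomp_op2:
  assumes h: "uop2 A B D h" and a: "ucomp C A a" and b: "ucomp C B b"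
  shows "ucomp C D (\<lambda>i z. h i (a i z) (b i z))"
proof -
  obtain f where f: "pr 3 f" "\<And>i x y. x \<in> A i \<Longrightarrow> y \<in> B i \<Longrightarrow> f [i, x, y] = Some (h i x y) \<and> h i x y \<in> D i"
    using h unfolding uop2_def by blast
  obtain fa where fa: "pr 2 fa" "\<forall>\<^sub>F i in cofin C. \<forall>z. fa [i, z] = Some (a i z) \<and> a i z \<in> A i"
    using a unfolding ucomp_def by blast
  obtain fb where fb: "pr 2 fb" "\<forall>\<^sub>F i in cofin C. \<forall>z. fb [i, z] = Some (b i z) \<and> b i z \<in> B i"
    using b unfolding ucomp_def by blast
  let ?f = "\<lambda>xs. Option.bind (Some (xs ! 0)) (\<lambda>i. Option.bind (fa xs) (\<lambda>x. Option.bind (fb xs) (\<lambda>y. f [i, x, y])))"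
  have "pr 2 ?f" by (rule pr_comp3[OF f(1) total_rec_proj fa(1) fb(1)]) simp
  then show ?thesis unfolding ucomp_def
    by (intro exI[of _ ?f] conjI eventually_mono[OF eventually_conj[OF fa(2) fb(2)]]) (use f(2) in auto)
qed

text \<open>After a search, the number that was found replaces the search variable in expressions
  built from it.\<close>

lemma ucomp_subst:
  assumes a: "ucomp C A a" and b: "ucomp C B b"
  shows "ucomp C A (\<lambda>i z. a i (b i z))"
proof -
  obtain fa where fa: "pr 2 fa" "\<forall>\<^sub>F i in cofin C. \<forall>z. fa [i, z] = Some (a i z) \<and> a i z \<in> A i"
    using a unfolding ucomp_def by blast
  obtain fb where fb: "pr 2 fb" "\<forall>\<^sub>F i in cofin C. \<forall>z. fb [i, z] = Some (b i z) \<and> b i z \<in> B i"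
    using b unfolding ucomp_def by blast
  let ?f = "\<lambda>xs. Option.bind (Some (xs ! 0)) (\<lambda>i. Option.bind (fb xs) (\<lambda>x. fa [i, x]))"
  have "pr 2 ?f" by (rule pr_comp2[OF fa(1) total_rec_proj fb(1)]) simp
  then show ?thesis unfolding ucomp_def
    by (intro exI[of _ ?f] conjI eventually_mono[OF eventually_conj[OF fa(2) fb(2)]]) auto
qed

lemma uop1_total:
  assumes "total_rec 2 (\<lambda>xs. h (xs ! 0) (xs ! 1))"
  shows "uop1 (\<lambda>_. UNIV) (\<lambda>_. UNIV) h"
  unfolding uop1_def by (rule exI, rule conjI[OF assms]) simp

lemma uop2_total:
  assumes "total_rec 3 (\<lambda>xs. h (xs ! 0) (xs ! 1) (xs ! 2))"
  shows "uop2 (\<lambda>_. UNIV) (\<lambda>_. UNIV) (\<lambda>_. UNIV) h"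
  unfolding uop2_def by (rule exI, rule conjI[OF assms]) simp

lemma ucomp_dec: "ucomp C (\<lambda>_. UNIV) (\<lambda>i z. dec j z)"
proof (rule ucomp_op1[where h = "\<lambda>i z. dec j z", OF uop1_total ucomp_var])
  show "total_rec 2 (\<lambda>xs. dec j (xs ! 1))" by (rule total_rec_dec[OF total_rec_proj]) simp
qed

lemma udec_eq:
  assumes "ucomp C A a" "ucomp C B b" shows "udec C (\<lambda>i z. a i z = b i z)"
proof (rule ucomp_op2[where h = "\<lambda>i x y. of_bool (x = y)", OF uop2_total ucomp_UNIV ucomp_UNIV, OF _ assms])
  show "total_rec 3 (\<lambda>xs. of_bool (xs ! 1 = xs ! 2))"
    by (intro total_rec_eq total_rec_proj) simp_all
qed

lemma udec_not:
  assumes "udec C P" shows "udec C (\<lambda>i z. \<not> P i z)"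
proof -
  have "uconst (\<lambda>_. UNIV) (\<lambda>_. 0)" unfolding uconst_def by (simp add: total_rec_const)
  from udec_eq[OF assms ucomp_const[OF this]] show ?thesis by simp
qed

lemma udec_conj:
  assumes "udec C P" "udec C Q" shows "udec C (\<lambda>i z. P i z \<and> Q i z)"
proof -
  have "ucomp C (\<lambda>_. UNIV) (\<lambda>i z. of_bool (P i z) * of_bool (Q i z))"
  proof (rule ucomp_op2[where h = "\<lambda>i x y. x * y", OF uop2_total assms])
    show "total_rec 3 (\<lambda>xs. xs ! 1 * xs ! 2)" by (intro total_rec_mult total_rec_proj) simp_all
  qed
  then show ?thesis by (simp add: of_bool_conj)
qed

lemma udec_all_less:
  fixes m :: nat
  assumes "\<And>j. j < m \<Longrightarrow> udec C (\<lambda>i z. P j i z)"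
  shows "udec C (\<lambda>i z. \<forall>j<m. P j i z)"
  using assms
proof (induction m)
  case 0
  have "uconst (\<lambda>_. UNIV) (\<lambda>_. 1)" unfolding uconst_def by (simp add: total_rec_const)
  from ucomp_const[OF this] show ?case by simp
next
  case (Suc m)
  have "udec C (\<lambda>i z. (\<forall>j<m. P j i z) \<and> P m i z)"
    by (rule udec_conj) (use Suc in auto)
  then show ?case by (simp add: All_less_Suc conj_commute)
qed

text \<open>Forces an arbitrary number into \<open>A i\<close>, so that searches need not test membership.\<close>

definition cast :: "(nat \<Rightarrow> nat set) \<Rightarrow> (nat \<Rightarrow> nat) \<Rightarrow> nat \<Rightarrow> nat \<Rightarrow> nat" where
  "cast A d i x = (if x \<in> A i then x else d i)"

lemma cast_in: "x \<in> A i \<Longrightarrow> cast A d i x = x"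
  by (simp add: cast_def)

lemma uop1_cast:
  assumes A: "uset A" and d: "uconst A d"
  shows "uop1 (\<lambda>_. UNIV) A (cast A d)"
proof -
  have *: "cast A d i x = of_bool (x \<in> A i) * x + (1 - of_bool (x \<in> A i)) * d i" for i x
    by (simp add: cast_def)
  have "total_rec 2 (\<lambda>xs. cast A d (xs ! 0) (xs ! 1))"
    unfolding * using A d total_rec_comp1[of d 2 "\<lambda>xs. xs ! 0"]
    by (intro total_rec_add total_rec_mult total_rec_diff total_rec_const total_rec_proj)
      (auto simp: uset_def uconst_def total_rec_proj)
  then show ?thesis
    unfolding uop1_def using d by (intro exI[of _ "\<lambda>xs. Some (cast A d (xs ! 0) (xs ! 1))"])
      (auto simp: cast_def uconst_def)
qed

lemma ucomp_cast:
  "uset A \<Longrightarrow> uconst A d \<Longrightarrow> ucomp C B a \<Longrightarrow> ucomp C A (\<lambda>i z. cast A d i (a i z))"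
  by (rule ucomp_op1[OF uop1_cast ucomp_UNIV])

text \<open>The atomic diagram only gives the graph. As the operation is total on the domain,
  running through all candidates for the result terminates.\<close>

lemma uop2_graph:
  assumes "computable_set 4 {[i, x, y, z] | i x y z. x \<in> A i \<and> y \<in> A i \<and> z \<in> A i \<and> h i x y = z}"
    and "\<And>i x y. x \<in> A i \<Longrightarrow> y \<in> A i \<Longrightarrow> h i x y \<in> A i"
  shows "uop2 A A A h"
proof -
  let ?S = "{[i, x, y, z] | i x y z. x \<in> A i \<and> y \<in> A i \<and> z \<in> A i \<and> h i x y = z}"
  obtain g where g: "pr 4 g" "\<And>xs. g xs = Some (of_bool (xs \<in> ?S))"
    using assms(1) unfolding computable_set_iff by blast
  \<comment> \<open>The search variable comes first in a minimisation, but the result comes last in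
    the graph; hence the permuted arguments.\<close>
  have "total_rec 4 (\<lambda>xs. 1 - of_bool ([xs ! 1, xs ! 2, xs ! 3, xs ! 0] \<in> ?S))"
  proof (intro total_rec_diff total_rec_const)
    have "pr 4 (\<lambda>xs. Option.bind (those (map (\<lambda>g. g xs)
        [\<lambda>xs. Some (xs ! 1), \<lambda>xs. Some (xs ! 2), \<lambda>xs. Some (xs ! 3), \<lambda>xs. Some (xs ! 0)])) g)"
      by (rule pr_comp) (use g(1) in \<open>auto simp: total_rec_proj eval_nat_numeral\<close>)
    then show "total_rec 4 (\<lambda>xs. of_bool ([xs ! 1, xs ! 2, xs ! 3, xs ! 0] \<in> ?S))"
      by (simp add: g(2))
  qed
  then have t: "pr (Suc 3) (\<lambda>xs. Some (1 - of_bool ([xs ! 1, xs ! 2, xs ! 3, xs ! 0] \<in> ?S)))" by simp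
  obtain f where f: "pr 3 f" "\<forall>xs (h' :: nat \<Rightarrow> nat).
     (\<forall>z. Some (1 - of_bool ([(z # xs) ! 1, (z # xs) ! 2, (z # xs) ! 3, (z # xs) ! 0] \<in> ?S)) = Some (h' z))
     \<longrightarrow> f xs = (if \<exists>z. h' z = 0 then Some (LEAST z. h' z = 0) else None)"
    using pr_search[OF t] by (elim exE conjE)
  show ?thesis unfolding uop2_def
  proof (intro exI[of _ f] conjI f(1) allI ballI)
    fix i x y assume xy: "x \<in> A i" "y \<in> A i"
    have "f [i, x, y] = (if \<exists>z. (1::nat) - of_bool (z = h i x y) = 0
        then Some (LEAST z. (1::nat) - of_bool (z = h i x y) = 0) else None)"
      by (rule f(2)[rule_format]) (use xy assms(2)[OF xy] in \<open>auto simp: numeral_2_eq_2 numeral_3_eq_3\<close>)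
    also have "\<dots> = Some (h i x y)" by (auto intro: Least_equality)
    finally show "f [i, x, y] = Some (h i x y)" .
    show "h i x y \<in> A i" by (rule assms(2)[OF xy])
  qed
qed

text \<open>The singletons of the constants are uniformly decidable, and a search finds their
  elements.\<close>

lemma uconst_graph:
  assumes "computable_set 2 {[i, x] | i x. x \<in> A i \<and> x = c i}" and "\<And>i. c i \<in> A i"
  shows "uconst A c"
proof -
  have "uset (\<lambda>i. {x. x \<in> A i \<and> x = c i})" using assms(1) by (simp add: uset_computable_set[symmetric])
  moreover have "{x. x \<in> A i \<and> x = c i} = {c i}" for i using assms(2) by auto
  ultimately have g: "total_rec 2 (\<lambda>xs. of_bool (xs ! 1 = c (xs ! 0)))" by (simp add: uset_def)
  have "total_rec 2 (\<lambda>xs. 1 - of_bool (xs ! 0 = c (xs ! 1)))"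
    using total_rec_comp2[of "\<lambda>x y. of_bool (y = c x)", OF g total_rec_proj[of 1] total_rec_proj[of 0]]
    by (intro total_rec_diff total_rec_const) auto
  then have "total_rec 1 (\<lambda>xs. LEAST z. (\<lambda>xs. 1 - of_bool (xs ! 0 = c (xs ! 1)) :: nat) (z # xs) = 0)"
    by (intro total_rec_Least) (auto simp: numeral_2_eq_2)
  moreover have "(LEAST z. (\<lambda>xs. 1 - of_bool (xs ! 0 = c (xs ! 1)) :: nat) (z # xs) = 0) = c (xs ! 0)" for xs
    by (rule Least_equality) (auto simp: of_bool_def split: if_splits)
  ultimately show ?thesis unfolding uconst_def using assms(2) by auto
qed

lemma search:
  assumes C: "cohesive C" and P: "udec C P"
  shows "(\<forall>\<^sub>F i in cofin C. \<exists>z. P i z) \<or> (\<forall>\<^sub>F i in cofin C. \<forall>z. \<not> P i z)"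
    and "\<forall>\<^sub>F i in cofin C. \<exists>z. P i z \<Longrightarrow>
      \<exists>w. ucomp C (\<lambda>_. UNIV) (\<lambda>i z. w i) \<and> (\<forall>\<^sub>F i in cofin C. P i (w i))"
proof -
  \<comment> \<open>Minimisation looks for a zero, so it is the negation of \<open>P\<close> whose
    truth value is searched.\<close>
  have nP: "udec C (\<lambda>i z. \<not> P i z)" by (rule udec_not[OF P])
  obtain f where f: "pr 2 f" "\<forall>\<^sub>F i in cofin C. \<forall>z. f [i, z] = Some (of_bool (\<not> P i z))"
    using nP unfolding ucomp_def by auto
  have "pr (Suc 1) (\<lambda>xs. Option.bind (Some (xs ! 1)) (\<lambda>i. Option.bind (Some (xs ! 0)) (\<lambda>z. f [i, z])))"
    using pr_comp2[OF f(1) total_rec_proj[of 1 2] total_rec_proj[of 0 2]] by (simp add: numeral_2_eq_2)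
  from pr_search[OF this] obtain g where g: "pr 1 g"
    "\<forall>xs h. (\<forall>z. Option.bind (Some ((z # xs) ! 1)) (\<lambda>i. Option.bind (Some ((z # xs) ! 0)) (\<lambda>z. f [i, z])) = Some (h z)) \<longrightarrow>
    g xs = (if \<exists>z. h z = 0 then Some (LEAST z. h z = 0) else None)"
    by (elim exE conjE)
  have gi: "\<forall>\<^sub>F i in cofin C. g [i] = (if \<exists>z. P i z then Some (LEAST z. P i z) else None)"
    using f(2)
  proof eventually_elim
    fix i assume fi: "\<forall>z. f [i, z] = Some (of_bool (\<not> P i z))"
    have "g [i] = (if \<exists>z. (of_bool (\<not> P i z) :: nat) = 0 then Some (LEAST z. (of_bool (\<not> P i z) :: nat) = 0) else None)"
      by (rule g(2)[rule_format]) (simp add: fi)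
    then show "g [i] = (if \<exists>z. P i z then Some (LEAST z. P i z) else None)" by simp
  qed
  \<comment> \<open>The domain of this function is c.e., and on \<open>C\<close> it is the set of
    solvable indices up to finitely many exceptions; cohesiveness is applied to it.\<close>
  define \<phi> where "\<phi> i = g [i]" for i
  have "partial_computable \<phi>" unfolding partial_computable_iff \<phi>_def
    by (rule pr_cong[OF g(1)]) (auto simp: length_Suc_conv)
  then have "C \<subseteq>\<^sup>* dom \<phi> \<or> C \<subseteq>\<^sup>* - dom \<phi>" using C unfolding cohesive_def ce_set_def by blast
  then have "(\<forall>\<^sub>F i in cofin C. g [i] \<noteq> None) \<or> (\<forall>\<^sub>F i in cofin C. g [i] = None)"
    unfolding almost_subset_iff by (simp add: \<phi>_def domIff)
  moreover have "\<forall>\<^sub>F i in cofin C. \<exists>z. P i z" if "\<forall>\<^sub>F i in cofin C. g [i] \<noteq> None"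
    using that gi by eventually_elim (auto split: if_splits)
  moreover have "\<forall>\<^sub>F i in cofin C. \<forall>z. \<not> P i z" if "\<forall>\<^sub>F i in cofin C. g [i] = None"
    using that gi by eventually_elim (auto split: if_splits)
  ultimately show "(\<forall>\<^sub>F i in cofin C. \<exists>z. P i z) \<or> (\<forall>\<^sub>F i in cofin C. \<forall>z. \<not> P i z)" by blast
  assume ex: "\<forall>\<^sub>F i in cofin C. \<exists>z. P i z"
  define w where "w i = (LEAST z. P i z)" for i
  have "pr 2 (\<lambda>xs. Option.bind (Some (xs ! 0)) (\<lambda>i. g [i]))"
    by (rule pr_comp1[OF g(1) total_rec_proj]) simp
  moreover have "\<forall>\<^sub>F i in cofin C. \<forall>z. Option.bind (Some ([i, z] ! 0)) (\<lambda>i. g [i]) = Some (w i) \<and> w i \<in> UNIV"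
    using ex gi by eventually_elim (auto simp: w_def)
  ultimately have "ucomp C (\<lambda>_. UNIV) (\<lambda>i z. w i)" unfolding ucomp_def by blast
  moreover have "\<forall>\<^sub>F i in cofin C. P i (w i)"
    using ex by eventually_elim (auto simp: w_def intro: LeastI_ex)
  ultimately show "\<exists>w. ucomp C (\<lambda>_. UNIV) (\<lambda>i z. w i) \<and> (\<forall>\<^sub>F i in cofin C. P i (w i))" by blast
qed

text \<open>A representative is chosen once and for all. Single values may be junk or depend on that
  choice, but two representatives of a class agree at almost all indices of \<open>C\<close>, and
  only eventual statements about \<open>val\<close> are made.\<close>

definition val :: "(nat \<rightharpoonup> nat) set \<Rightarrow> nat \<Rightarrow> nat" where
  "val S i = the ((SOME \<phi>. \<phi> \<in> S) i)"

lemma cp_class_cong: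
  assumes "\<forall>\<^sub>F i in cofin C. \<exists>x. \<phi> i = Some x \<and> \<psi> i = Some x"
  shows "cp_class C A \<phi> = cp_class C A \<psi>"
proof -
  have "(\<forall>\<^sub>F i in cofin C. \<exists>x. \<phi> i = Some x \<and> \<theta> i = Some x) \<longleftrightarrow>
        (\<forall>\<^sub>F i in cofin C. \<exists>x. \<psi> i = Some x \<and> \<theta> i = Some x)" for \<theta>
    by (rule eventually_cong[OF assms]) auto
  then show ?thesis by (simp add: cp_class_def almost_subset_iff)
qed

lemma cp_carrierE:
  assumes "S \<in> cp_carrier C A"
  obtains \<phi> where "\<phi> \<in> cp_dom C A" "S = cp_class C A \<phi>" "\<forall>\<^sub>F i in cofin C. \<phi> i = Some (val S i)" "\<phi> \<in> S"
proof -
  obtain \<psi> where \<psi>: "\<psi> \<in> cp_dom C A" "S = cp_class C A \<psi>" using assms by (auto simp: cp_carrier_def)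
  have "\<psi> \<in> S" unfolding \<psi>(2) cp_class_def using \<psi>(1)
    by (auto simp: almost_subset_iff cp_dom_def elim: eventually_mono)
  define \<phi> where "\<phi> = (SOME \<phi>. \<phi> \<in> S)"
  have \<phi>S: "\<phi> \<in> S" unfolding \<phi>_def using \<open>\<psi> \<in> S\<close> by (rule someI[of "\<lambda>\<phi>. \<phi> \<in> S"])
  then have \<phi>: "\<phi> \<in> cp_dom C A" "\<forall>\<^sub>F i in cofin C. \<exists>x. \<psi> i = Some x \<and> \<phi> i = Some x"
    unfolding \<psi>(2) by (simp_all add: cp_class_def almost_subset_iff)
  show ?thesis
  proof (rule that[OF \<phi>(1) _ _ \<phi>S])
    show "S = cp_class C A \<phi>" unfolding \<psi>(2) by (rule cp_class_cong[OF \<phi>(2)])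
    show "\<forall>\<^sub>F i in cofin C. \<phi> i = Some (val S i)"
      using \<phi>(2) by eventually_elim (auto simp: val_def \<phi>_def)
  qed
qed

lemma cp_class_in: "\<phi> \<in> cp_dom C A \<Longrightarrow> cp_class C A \<phi> \<in> cp_carrier C A"
  by (simp add: cp_carrier_def)

lemma val_cp_class:
  assumes "\<phi> \<in> cp_dom C A"
  shows "\<forall>\<^sub>F i in cofin C. \<phi> i = Some (val (cp_class C A \<phi>) i)"
proof -
  obtain \<psi> where \<psi>: "\<forall>\<^sub>F i in cofin C. \<psi> i = Some (val (cp_class C A \<phi>) i)" "\<psi> \<in> cp_class C A \<phi>"
    using cp_carrierE[OF cp_class_in[OF assms]] by metis
  have "\<forall>\<^sub>F i in cofin C. \<exists>x. \<phi> i = Some x \<and> \<psi> i = Some x"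
    using \<psi>(2) by (simp add: cp_class_def almost_subset_iff)
  with \<psi>(1) show ?thesis by eventually_elim auto
qed

text \<open>Extensionality. Together with the eventual formulas for \<open>val\<close> of constants
  and of results of operations, it reduces identities in a product to identities in the
  factors.\<close>

lemma cp_eq_iff:
  assumes S: "S \<in> cp_carrier C A" and T: "T \<in> cp_carrier C A"
  shows "S = T \<longleftrightarrow> (\<forall>\<^sub>F i in cofin C. val S i = val T i)"
proof
  assume eq: "\<forall>\<^sub>F i in cofin C. val S i = val T i"
  obtain \<phi> where \<phi>: "S = cp_class C A \<phi>" "\<forall>\<^sub>F i in cofin C. \<phi> i = Some (val S i)"
    using cp_carrierE[OF S] by metis
  obtain \<psi> where \<psi>: "T = cp_class C A \<psi>" "\<forall>\<^sub>F i in cofin C. \<psi> i = Some (val T i)"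
    using cp_carrierE[OF T] by metis
  show "S = T" unfolding \<phi>(1) \<psi>(1)
  proof (rule cp_class_cong)
    show "\<forall>\<^sub>F i in cofin C. \<exists>x. \<phi> i = Some x \<and> \<psi> i = Some x"
      using eq \<phi>(2) \<psi>(2) by eventually_elim auto
  qed
qed simp

lemma ucomp_val:
  assumes "S \<in> cp_carrier C A" shows "ucomp C A (\<lambda>i z. val S i)"
proof -
  obtain \<phi> where \<phi>: "\<phi> \<in> cp_dom C A" "\<forall>\<^sub>F i in cofin C. \<phi> i = Some (val S i)"
    using cp_carrierE[OF assms] by metis
  have "pr 1 (\<lambda>xs. \<phi> (xs ! 0))" using \<phi>(1) by (simp add: cp_dom_def partial_computable_iff)
  then have "pr 2 (\<lambda>xs. Option.bind (Some (xs ! 0)) (\<lambda>i. \<phi> ([i] ! 0)))"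
    by (rule pr_comp1) (rule total_rec_proj, simp)
  moreover have "\<forall>\<^sub>F i in cofin C. \<forall>z. Option.bind (Some ([i, z] ! 0)) (\<lambda>i. \<phi> ([i] ! 0)) = Some (val S i) \<and> val S i \<in> A i"
    using \<phi>(2) by eventually_elim (use \<phi>(1) in \<open>auto simp: cp_dom_def\<close>)
  ultimately show ?thesis unfolding ucomp_def by blast
qed

lemma val_in: "S \<in> cp_carrier C A \<Longrightarrow> \<forall>\<^sub>F i in cofin C. val S i \<in> A i"
  using ucompD[OF ucomp_val] by simp

text \<open>\<open>cp_dom\<close> demands that a representative has its values in \<open>A i\<close>
  wherever it is defined, not only at almost all indices. Composing with this partial identity makes
  a function diverge where it would violate the demand.\<close>

lemma pr_restrict:
  assumes A: "uset A"
  shows "\<exists>g. pr 2 g \<and> (\<forall>i x. g [i, x] = (if x \<in> A i then Some x else None))"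
proof -
  have "total_rec 3 (\<lambda>xs. of_bool (xs ! 2 \<in> A (xs ! 1)))"
    using total_rec_comp2[of "\<lambda>i x. of_bool (x \<in> A i)" 3 "\<lambda>xs. xs ! 1" "\<lambda>xs. xs ! 2"] A
    by (simp add: uset_def total_rec_proj)
  moreover have "total_rec 3 (\<lambda>xs. of_bool (xs ! 0 = xs ! 2))"
    by (intro total_rec_eq total_rec_proj) simp_all
  ultimately have "total_rec 3 (\<lambda>xs. 1 - of_bool (xs ! 2 \<in> A (xs ! 1)) * of_bool (xs ! 0 = xs ! 2))"
    by (intro total_rec_diff total_rec_const total_rec_mult)
  then have t: "total_rec (Suc 2) (\<lambda>xs. 1 - of_bool (xs ! 2 \<in> A (xs ! 1) \<and> xs ! 0 = xs ! 2))"
    by (simp add: of_bool_conj numeral_3_eq_3 numeral_2_eq_2)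
  obtain g where g: "pr 2 g" "\<forall>xs (h :: nat \<Rightarrow> nat).
      (\<forall>z. Some (1 - of_bool ((z # xs) ! 2 \<in> A ((z # xs) ! 1) \<and> (z # xs) ! 0 = (z # xs) ! 2)) = Some (h z)) \<longrightarrow>
      g xs = (if \<exists>z. h z = 0 then Some (LEAST z. h z = 0) else None)"
    using pr_search[OF t] by (elim exE conjE)
  have "g [i, x] = (if x \<in> A i then Some x else None)" for i x
  proof -
    have "g [i, x] = (if \<exists>z. (1::nat) - of_bool (x \<in> A i \<and> z = x) = 0
        then Some (LEAST z. (1::nat) - of_bool (x \<in> A i \<and> z = x) = 0) else None)"
      by (rule g(2)[rule_format]) simp
    then show ?thesis by (auto intro: Least_equality)
  qed
  with g(1) show ?thesis by blast
qed

text \<open>The converse of \<open>ucomp_val\<close>: up to finitely many indices, the elements of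
  the product are the uniformly computable choices.\<close>

lemma cp_element:
  assumes A: "uset A" and w: "ucomp C A (\<lambda>i z. w i)"
  obtains S where "S \<in> cp_carrier C A" "\<forall>\<^sub>F i in cofin C. val S i = w i"
proof -
  obtain f where f: "pr 2 f" "\<forall>\<^sub>F i in cofin C. \<forall>z. f [i, z] = Some (w i) \<and> w i \<in> A i"
    using w unfolding ucomp_def by blast
  obtain g where g: "pr 2 g" "\<forall>i x. g [i, x] = (if x \<in> A i then Some x else None)"
    using pr_restrict[OF A] by (elim exE conjE)
  \<comment> \<open>The number 0 is an arbitrary choice, as the value of \<open>f\<close> is the
    same for all \<open>z\<close> at almost all indices.\<close>
  define \<phi> where "\<phi> i = Option.bind (f [i, 0]) (\<lambda>x. g [i, x])" for i
  have f0: "pr 1 (\<lambda>xs. Option.bind (Some (xs ! 0)) (\<lambda>i. Option.bind (Some 0) (\<lambda>z. f [i, z])))"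
    by (rule pr_comp2[OF f(1) total_rec_proj total_rec_const]) simp
  have "pr 1 (\<lambda>xs. Option.bind (Some (xs ! 0)) (\<lambda>i.
      Option.bind (Option.bind (Some (xs ! 0)) (\<lambda>i. Option.bind (Some 0) (\<lambda>z. f [i, z]))) (\<lambda>x. g [i, x])))"
    by (rule pr_comp2[OF g(1) total_rec_proj f0]) simp
  then have pc: "partial_computable \<phi>" by (simp add: partial_computable_iff \<phi>_def)
  have \<phi>w: "\<forall>\<^sub>F i in cofin C. \<phi> i = Some (w i)"
    using f(2) by eventually_elim (simp add: \<phi>_def g(2))
  have "x \<in> A i" if "\<phi> i = Some x" for i x
    using that by (auto simp: \<phi>_def g(2) split: Option.bind_splits if_splits)
  then have dom: "\<phi> \<in> cp_dom C A"
    using pc \<phi>w by (auto simp: cp_dom_def almost_subset_iff elim: eventually_mono)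
  show ?thesis
  proof (rule that[OF cp_class_in[OF dom]])
    show "\<forall>\<^sub>F i in cofin C. val (cp_class C A \<phi>) i = w i"
      using \<phi>w val_cp_class[OF dom] by eventually_elim simp
  qed
qed

lemma cp_op_class:
  assumes "\<sigma> \<in> cp_dom C A" "\<alpha> \<in> cp_dom C B"
  shows "cp_op C D h (cp_class C A \<sigma>) (cp_class C B \<alpha>) = cp_class C D (pointwise h \<sigma> \<alpha>)"
proof -
  have "cp_class C D (pointwise h \<phi> \<psi>) = cp_class C D (pointwise h \<sigma> \<alpha>)"
    if "\<phi> \<in> cp_class C A \<sigma>" "\<psi> \<in> cp_class C B \<alpha>" for \<phi> \<psi>
  proof (rule cp_class_cong)
    have "\<forall>\<^sub>F i in cofin C. \<exists>x. \<sigma> i = Some x \<and> \<phi> i = Some x"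
      "\<forall>\<^sub>F i in cofin C. \<exists>x. \<alpha> i = Some x \<and> \<psi> i = Some x"
      using that by (auto simp: cp_class_def almost_subset_iff)
    then show "\<forall>\<^sub>F i in cofin C. \<exists>x. pointwise h \<phi> \<psi> i = Some x \<and> pointwise h \<sigma> \<alpha> i = Some x"
      by eventually_elim (auto simp: pointwise_def)
  qed
  moreover have "\<sigma> \<in> cp_class C A \<sigma>" "\<alpha> \<in> cp_class C B \<alpha>"
    using assms by (auto simp: cp_class_def almost_subset_iff cp_dom_def elim: eventually_mono)
  ultimately show ?thesis unfolding cp_op_def by blast
qed

lemma cp_op:
  assumes D: "uset D" and h: "uop2 A B D h" and S: "S \<in> cp_carrier C A" and T: "T \<in> cp_carrier C B"
  shows "cp_op C D h S T \<in> cp_carrier C D"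
    and "\<forall>\<^sub>F i in cofin C. val (cp_op C D h S T) i = h i (val S i) (val T i)"
proof -
  obtain \<phi> where \<phi>: "\<phi> \<in> cp_dom C A" "S = cp_class C A \<phi>" "\<forall>\<^sub>F i in cofin C. \<phi> i = Some (val S i)"
    using cp_carrierE[OF S] by metis
  obtain \<psi> where \<psi>: "\<psi> \<in> cp_dom C B" "T = cp_class C B \<psi>" "\<forall>\<^sub>F i in cofin C. \<psi> i = Some (val T i)"
    using cp_carrierE[OF T] by metis
  have eq: "cp_op C D h S T = cp_class C D (pointwise h \<phi> \<psi>)"
    unfolding \<phi>(2) \<psi>(2) by (rule cp_op_class[OF \<phi>(1) \<psi>(1)])
  \<comment> \<open>Instead of proving that the pointwise result lies in \<open>cp_dom\<close>, an
    element with the right values is built, and its class is identified with that of the pointwise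
    result.\<close>
  obtain U where U: "U \<in> cp_carrier C D" "\<forall>\<^sub>F i in cofin C. val U i = h i (val S i) (val T i)"
    using cp_element[OF D ucomp_op2[OF h ucomp_val[OF S] ucomp_val[OF T]]] by blast
  obtain \<theta> where \<theta>: "U = cp_class C D \<theta>" "\<forall>\<^sub>F i in cofin C. \<theta> i = Some (val U i)"
    using cp_carrierE[OF U(1)] by metis
  have "cp_class C D (pointwise h \<phi> \<psi>) = U" unfolding \<theta>(1)
  proof (rule cp_class_cong)
    show "\<forall>\<^sub>F i in cofin C. \<exists>x. pointwise h \<phi> \<psi> i = Some x \<and> \<theta> i = Some x"
      using \<phi>(3) \<psi>(3) \<theta>(2) U(2) by eventually_elim (simp add: pointwise_def)
  qed
  then show "cp_op C D h S T \<in> cp_carrier C D"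
    "\<forall>\<^sub>F i in cofin C. val (cp_op C D h S T) i = h i (val S i) (val T i)"
    using U eq by auto
qed

lemma cp_const:
  assumes D: "uset D" and c: "uconst D c"
  shows "cp_class C D (\<lambda>i. Some (c i)) \<in> cp_carrier C D"
    and "\<forall>\<^sub>F i in cofin C. val (cp_class C D (\<lambda>i. Some (c i))) i = c i"
proof -
  have dom: "(\<lambda>i. Some (c i)) \<in> cp_dom C D"
    using c by (auto simp: cp_dom_def partial_computable_iff uconst_def almost_subset_def dom_def)
  show "cp_class C D (\<lambda>i. Some (c i)) \<in> cp_carrier C D" by (rule cp_class_in[OF dom])
  show "\<forall>\<^sub>F i in cofin C. val (cp_class C D (\<lambda>i. Some (c i))) i = c i"
    using val_cp_class[OF dom] by eventually_elim simp
qed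

section \<open>Extending embeddings in normal extensions\<close>

text \<open>Applying \<open>h\<close> to the coefficients and evaluating at \<open>d\<close> kills
  the minimal polynomial of \<open>c\<close>, hence every polynomial that vanishes at
  \<open>c\<close>. It therefore factors through evaluation at \<open>c\<close>, whose image is the
  simple extension.\<close>

lemma (in field) simple_extension_hom:
  assumes E: "subfield E R" and h: "h \<in> ring_hom (R\<lparr>carrier := E\<rparr>) R"
    and c: "c \<in> carrier R" "(algebraic over E) c"
    and d: "d \<in> carrier R" "eval (map h (Irr E c)) d = \<zero>"
  obtains h' where "h' \<in> ring_hom (R\<lparr>carrier := simple_extension E c\<rparr>) R"
    "\<And>x. x \<in> E \<Longrightarrow> h' x = h x" "h' c = d"
proof -
  note subE = subfieldE(1)[OF E]
  have EC: "E \<subseteq> carrier R" using subfieldE(3)[OF E] .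
  interpret E: field "R\<lparr>carrier := E\<rparr>" using subfield_iff(2)[OF E] .
  interpret Hom: ring_hom_ring "R\<lparr>carrier := E\<rparr>" R h
    using ring_hom_ringI2[OF E.is_ring is_ring h] .
  define \<theta> where "\<theta> p = eval (map h p) d" for p
  have setE: "set p \<subseteq> E" if "p \<in> carrier (E[X])" for p
    using that polynomial_incl unfolding univ_poly_carrier[symmetric] by blast
  have hC: "set (map h p) \<subseteq> carrier R" if "p \<in> carrier (E[X])" for p
    using setE[OF that] Hom.hom_closed by auto
  have pm: "p \<otimes>\<^bsub>E[X]\<^esub> q = poly_mult p q" for p q by (simp add: univ_poly_mult)
  have pa: "p \<oplus>\<^bsub>E[X]\<^esub> q = poly_add p q" for p q by (simp add: univ_poly_add)
  interpret UP: domain "E[X]" using univ_poly_is_domain[OF subE] .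
  have th: "\<theta> \<in> ring_hom (E[X]) R"
  proof (rule ring_hom_memI)
    fix p q assume pq: "p \<in> carrier (E[X])" "q \<in> carrier (E[X])"
    show "\<theta> p \<in> carrier R" unfolding \<theta>_def using eval_in_carrier[OF hC[OF pq(1)] d(1)] .
    have "set (map h (poly_mult p q)) \<subseteq> carrier R" "set (map h (poly_add p q)) \<subseteq> carrier R"
      using hC[OF UP.m_closed[OF pq]] hC[OF UP.a_closed[OF pq]] unfolding pm pa by auto
    \<comment> \<open>The operations on coefficient lists commute with \<open>map h\<close> only up
      to \<open>normalize\<close>, and evaluation does not see normalization.\<close>
    note n = eval_normalize[OF this(1) d(1)] eval_normalize[OF this(2) d(1)]
    show "\<theta> (p \<otimes>\<^bsub>E[X]\<^esub> q) = \<theta> p \<otimes> \<theta> q"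
      unfolding \<theta>_def pm n(1)[symmetric]
      using Hom.poly_mult_hom'[of p q] poly_mult_consistent[OF subE] setE[OF pq(1)] setE[OF pq(2)]
        eval_poly_mult[OF hC[OF pq(1)] hC[OF pq(2)] d(1)] by simp
    show "\<theta> (p \<oplus>\<^bsub>E[X]\<^esub> q) = \<theta> p \<oplus> \<theta> q"
      unfolding \<theta>_def pa n(2)[symmetric]
      using Hom.poly_add_hom'[of p q] poly_add_consistent[OF subE] setE[OF pq(1)] setE[OF pq(2)]
        eval_poly_add[OF hC[OF pq(1)] hC[OF pq(2)] d(1)] by (simp del: poly_add.simps)
  next
    show "\<theta> \<one>\<^bsub>E[X]\<^esub> = \<one>" unfolding \<theta>_def univ_poly_one using Hom.hom_one d(1) by simp
  qed
  interpret T: ring_hom_ring "E[X]" R \<theta>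
    using ring_hom_ringI2[OF UP.ring_axioms is_ring th] .
  interpret V: ring_hom_ring "E[X]" R "\<lambda>p. eval p c"
    using eval_ring_hom[OF subE c(1)] .
  note Irr = IrrE[OF E c]
  have ker: "\<theta> p = \<zero>" if p: "p \<in> carrier (E[X])" "eval p c = \<zero>" for p
  proof -
    have "(Irr E c) divides\<^bsub>E[X]\<^esub> p"
      using Irr_minimal[OF E c p] pdivides_iff_shell[OF E Irr(1) p(1)] by simp
    then obtain r where r: "r \<in> carrier (E[X])" "p = Irr E c \<otimes>\<^bsub>E[X]\<^esub> r" by auto
    have "\<theta> (Irr E c) = \<zero>" using d(2) by (simp add: \<theta>_def)
    then show ?thesis using r Irr(1) T.hom_closed[OF r(1)] by (simp add: T.hom_mult)
  qed
  have wd: "\<theta> p = \<theta> q" if pq: "p \<in> carrier (E[X])" "q \<in> carrier (E[X])" "eval p c = eval q c" for p q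
  proof -
    have "eval (p \<ominus>\<^bsub>E[X]\<^esub> q) c = eval p c \<oplus> \<ominus> eval q c"
      using pq by (simp add: a_minus_def)
    also have "\<dots> = \<zero>" using pq V.hom_closed[OF pq(2)] by (simp add: r_neg)
    finally have "\<theta> (p \<ominus>\<^bsub>E[X]\<^esub> q) = \<zero>" using ker pq by (meson UP.minus_closed)
    then have "\<theta> p \<ominus> \<theta> q = \<zero>" using pq by (simp add: a_minus_def)
    then show ?thesis using T.hom_closed pq by (metis r_right_minus_eq)
  qed
  \<comment> \<open>An arbitrary polynomial expression for \<open>y\<close> is chosen; by
    \<open>wd\<close> the result does not depend on it.\<close>
  define h' where "h' y = \<theta> (SOME p. p \<in> carrier (E[X]) \<and> eval p c = y)" for y
  have h'_eval: "h' (eval p c) = \<theta> p" if "p \<in> carrier (E[X])" for p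
  proof -
    let ?q = "SOME q. q \<in> carrier (E[X]) \<and> eval q c = eval p c"
    have "?q \<in> carrier (E[X]) \<and> eval ?q c = eval p c" by (rule someI[of _ p]) (simp add: that)
    then show ?thesis unfolding h'_def using wd[of ?q p] that by blast
  qed
  have img: "simple_extension E c = (\<lambda>p. eval p c) ` carrier (E[X])"
    by (rule simple_extension_as_eval_img[OF EC c(1)])
  show ?thesis
  proof
    show "h' \<in> ring_hom (R\<lparr>carrier := simple_extension E c\<rparr>) R"
    proof (rule ring_hom_memI; simp add: img)
      fix x assume "x \<in> (\<lambda>p. eval p c) ` carrier (E[X])"
      then show "h' x \<in> carrier R" using h'_eval T.hom_closed by auto
    next
      fix x y assume "x \<in> (\<lambda>p. eval p c) ` carrier (E[X])" "y \<in> (\<lambda>p. eval p c) ` carrier (E[X])"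
      then obtain p q where p: "p \<in> carrier (E[X])" "x = eval p c"
        and q: "q \<in> carrier (E[X])" "y = eval q c" by auto
      have "x \<otimes> y = eval (p \<otimes>\<^bsub>E[X]\<^esub> q) c" "x \<oplus> y = eval (p \<oplus>\<^bsub>E[X]\<^esub> q) c"
        using p q by (simp_all del: eval.simps)
      then show "h' (x \<otimes> y) = h' x \<otimes> h' y" "h' (x \<oplus> y) = h' x \<oplus> h' y"
        using p q h'_eval[OF UP.m_closed[OF p(1) q(1)]] h'_eval[OF UP.a_closed[OF p(1) q(1)]]
        by (simp_all add: h'_eval)
    next
      have "\<one> = eval \<one>\<^bsub>E[X]\<^esub> c" using V.hom_one by simp
      then show "h' \<one> = \<one>" using h'_eval[of "\<one>\<^bsub>E[X]\<^esub>"] by simp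
    qed
    show "h' x = h x" if x: "x \<in> E" for x
    proof (cases "x = \<zero>")
      case True
      have "[] \<in> carrier (E[X])" by (simp add: univ_poly_zero_closed)
      from h'_eval[OF this] show ?thesis using True Hom.hom_zero by (simp add: \<theta>_def)
    next
      case False
      then have p: "[x] \<in> carrier (E[X])" using x by (simp add: univ_poly_carrier[symmetric] polynomial_def)
      have "x \<in> carrier R" "h x \<in> carrier R" using x EC Hom.hom_closed by auto
      with h'_eval[OF p] c(1) d(1) show ?thesis by (simp add: \<theta>_def)
    qed
    have v: "X \<in> carrier (E[X])" using var_closed(1)[OF subE] .
    have "map h X = X" using Hom.hom_one Hom.hom_zero by (simp add: var_def)
    then show "h' c = d" using h'_eval[OF v] eval_var[OF c(1)] eval_var[OF d(1)]
      by (simp add: \<theta>_def del: eval.simps)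
  qed
qed


text \<open>A divisor of a split polynomial splits, so it has as many roots as its degree.\<close>

lemma (in field) splitted_imp_factor_root:
  assumes "p \<in> carrier (poly_ring R)" "q \<in> carrier (poly_ring R)" "q \<noteq> []" "splitted q"
    and "p pdivides q" "degree p > 0"
  obtains x where "is_root p x"
proof -
  have "size (roots p) = degree p"
    using pdivides_imp_splitted[OF assms(1-5)] by (simp add: splitted_def)
  then have "roots p \<noteq> {#}" using assms(6) by auto
  then obtain x where "x \<in># roots p" by blast
  then show ?thesis using roots_mem_iff_is_root[OF assms(1)] that by simp
qed

lemma (in ring) Span_incl_subring:
  assumes "subring E R" "K \<subseteq> E" "set Us \<subseteq> E"
  shows "Span K Us \<subseteq> E"
  using assms(3)
proof (induction Us)
  case Nil
  then show ?case using subringE(2)[OF assms(1)] by simp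
next
  case (Cons u Us)
  show ?case
  proof
    fix x assume "x \<in> Span K (u # Us)"
    then obtain k v where kv: "k \<in> K" "v \<in> Span K Us" "x = k \<otimes> u \<oplus> v"
      using line_extension_mem_iff[of x K u "Span K Us"] by auto
    have "k \<in> E" "v \<in> E" "u \<in> E" using kv Cons assms(2) by auto
    then show "x \<in> E" using kv(3) subringE(6,7)[OF assms(1)] by simp
  qed
qed

lemma (in ring) finite_dimension_imp_Span:
  assumes "subfield K R" "finite_dimension K E"
  obtains Us where "set Us \<subseteq> carrier R" "Span K Us = E"
proof -
  obtain n where "dimension n K E" using assms(2) by auto
  then obtain Us where "set Us \<subseteq> carrier R" "Span K Us = E" using exists_base[OF assms(1)] by metis
  then show ?thesis using that by blast
qed

section \<open>Finite Galois extensions and their fixed field\<close>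

locale finite_galois_extension = field R for R :: "'a ring" (structure) +
  fixes k
  assumes gal: "galois_extension R k" and fd: "finite_dimension k (carrier R)"
begin

lemma k: "subfield k R"
  using gal by (simp add: galois_extension_def)

lemma alg: "x \<in> carrier R \<Longrightarrow> algebraic k x"
  using gal by (simp add: galois_extension_def)

text \<open>The elements of \<open>cs\<close> are adjoined one by one. The minimal polynomial of
  \<open>c\<close> over \<open>E\<close> divides the one over \<open>k\<close>, which splits and
  whose coefficients \<open>h\<close> fixes. So the image under \<open>h\<close> of the former
  divides a split polynomial as well, and one of its roots can be taken as the image of
  \<open>c\<close>.\<close>

lemma galois_hom_extend:
  assumes E: "subfield E R" "k \<subseteq> E" and h: "h \<in> ring_hom (R\<lparr>carrier := E\<rparr>) R" "\<And>x. x \<in> k \<Longrightarrow> h x = x"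
    and cs: "set cs \<subseteq> carrier R"
  shows "\<exists>E' h'. subfield E' R \<and> E \<subseteq> E' \<and> set cs \<subseteq> E' \<and>
    h' \<in> ring_hom (R\<lparr>carrier := E'\<rparr>) R \<and> (\<forall>x\<in>E. h' x = h x)"
  using E h cs
proof (induction cs arbitrary: E h)
  case Nil
  then show ?case by auto
next
  case (Cons c cs)
  note E = Cons.prems(1)
  have c: "c \<in> carrier R" using Cons.prems by simp
  note kE = \<open>k \<subseteq> E\<close>
  interpret E: field "R\<lparr>carrier := E\<rparr>" using subfield_iff(2)[OF E] .
  interpret Hom: ring_hom_ring "R\<lparr>carrier := E\<rparr>" R h
    using ring_hom_ringI2[OF E.is_ring is_ring Cons.prems(3)] .
  have algk: "(algebraic over k) c" using gal c unfolding galois_extension_def over_def by auto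
  have algE: "(algebraic over E) c" using algebraic_mono[OF kE algk] .
  note m = IrrE[OF k c algk] and r = IrrE[OF E c algE]
  have mE: "Irr k c \<in> carrier (E[X])"
    using m(1) kE unfolding univ_poly_carrier[symmetric] polynomial_def by auto
  have m0: "Irr k c \<noteq> []" using pirreducibleE(1)[OF subfieldE(1)[OF k] m(1,2)] .
  have "splitted (Irr k c)"
  proof -
    have "is_root (Irr k c) c" using c m m0 by (simp add: is_root_def)
    then show ?thesis using gal m(1,2) unfolding galois_extension_def by blast
  qed
  have mR: "Irr k c \<in> carrier (poly_ring R)"
    using m(1) carrier_polynomial_shell[OF subfieldE(1)[OF k]] by blast
  have rE': "Irr E c \<in> carrier (poly_ring (R\<lparr>carrier := E\<rparr>))"
    using r(1) univ_poly_consistent[OF subfieldE(1)[OF E]] by simp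
  have hr: "map h (Irr E c) \<in> carrier (poly_ring R)"
    using polynomial_hom[OF Cons.prems(3) E.field_axioms field_axioms rE'] .
  have "(Irr E c) divides\<^bsub>E[X]\<^esub> Irr k c"
    using Irr_minimal[OF E c algE mE m(4)] pdivides_iff_shell[OF E r(1) mE] by simp
  then obtain q where q: "q \<in> carrier (E[X])" "Irr k c = Irr E c \<otimes>\<^bsub>E[X]\<^esub> q" by auto
  have qE': "q \<in> carrier (poly_ring (R\<lparr>carrier := E\<rparr>))"
    using q(1) univ_poly_consistent[OF subfieldE(1)[OF E]] by simp
  have hq: "map h q \<in> carrier (poly_ring R)"
    using polynomial_hom[OF Cons.prems(3) E.field_axioms field_axioms qE'] .
  have hm: "map h (Irr k c) = Irr k c"
  proof (rule map_idI)
    fix x assume "x \<in> set (Irr k c)"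
    then have "x \<in> k" using m(1) polynomial_incl unfolding univ_poly_carrier[symmetric] by blast
    then show "h x = x" using Cons.prems(4) by simp
  qed
  have sE: "set (Irr E c) \<subseteq> E" "set q \<subseteq> E"
    using r(1) q(1) polynomial_incl unfolding univ_poly_carrier[symmetric] by blast+
  have "normalize (map h (poly_mult (Irr E c) q)) = poly_mult (map h (Irr E c)) (map h q)"
    using Hom.poly_mult_hom'[of "Irr E c" q] poly_mult_consistent[OF subfieldE(1)[OF E]] sE by simp
  moreover have "poly_mult (Irr E c) q = Irr k c" using q(2) by (simp add: univ_poly_mult)
  moreover have "normalize (Irr k c) = Irr k c"
    using normalize_polynomial[of k] m(1) unfolding univ_poly_carrier[symmetric] by blast
  ultimately have "Irr k c = map h (Irr E c) \<otimes>\<^bsub>poly_ring R\<^esub> map h q"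
    using hm by (simp add: univ_poly_mult)
  then have dv: "map h (Irr E c) pdivides Irr k c"
    unfolding pdivides_def using hq by auto
  have "degree (Irr E c) > 0"
    using pirreducible_degree[OF E r(1,2)] by simp
  then have "degree (map h (Irr E c)) > 0" by simp
  then obtain d where d: "is_root (map h (Irr E c)) d"
    using splitted_imp_factor_root[OF hr mR m0 \<open>splitted (Irr k c)\<close> dv] by blast
  then have "d \<in> carrier R" "eval (map h (Irr E c)) d = \<zero>" by (auto simp: is_root_def)
  from simple_extension_hom[OF E Cons.prems(3) c algE this]
  obtain h' where h': "h' \<in> ring_hom (R\<lparr>carrier := simple_extension E c\<rparr>) R"
    "\<And>x. x \<in> E \<Longrightarrow> h' x = h x" by metis
  have S: "subfield (simple_extension E c) R" "E \<subseteq> simple_extension E c" "c \<in> simple_extension E c"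
    using simple_extension_is_subfield[OF E c] algE simple_extension_incl[OF subfieldE(3)[OF E] c]
      simple_extension_mem[OF subfieldE(1)[OF E] c] by auto
  have "\<exists>E' h''. subfield E' R \<and> simple_extension E c \<subseteq> E' \<and> set cs \<subseteq> E' \<and>
    h'' \<in> ring_hom (R\<lparr>carrier := E'\<rparr>) R \<and> (\<forall>x\<in>simple_extension E c. h'' x = h' x)"
  proof (rule Cons.IH[OF S(1) _ h'(1)])
    show "k \<subseteq> simple_extension E c" using kE S(2) by blast
    show "h' x = x" if "x \<in> k" for x using that kE h'(2) Cons.prems(4) by auto
    show "set cs \<subseteq> carrier R" using Cons.prems by simp
  qed
  then obtain E' h'' where "subfield E' R" "simple_extension E c \<subseteq> E'" "set cs \<subseteq> E'"
    "h'' \<in> ring_hom (R\<lparr>carrier := E'\<rparr>) R" "\<forall>x\<in>simple_extension E c. h'' x = h' x" by blast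
  then show ?case using S(2,3) h'(2)
    by (intro exI[of _ E'] exI[of _ h'']) auto
qed

text \<open>Homomorphisms of fields are injective. Any \<open>x\<close> is a root of a polynomial
  over \<open>k\<close>; \<open>g\<close> maps the finite root set of that polynomial injectively
  into itself, hence onto, so \<open>x\<close> is attained.\<close>

lemma finite_hom_over_is_aut:
  assumes g: "g \<in> ring_hom R R" "\<And>x. x \<in> k \<Longrightarrow> g x = x"
  shows "restrict g (carrier R) \<in> field_auts R k"
proof -
  interpret g: ring_hom_ring R R g using ring_hom_ringI2[OF is_ring is_ring g(1)] .
  have inj: "inj_on g (carrier R)"
    using non_trivial_field_hom_is_inj[OF g(1) field_axioms field_axioms] .
  have "carrier R \<subseteq> g ` carrier R"
  proof
    fix x assume x: "x \<in> carrier R"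
    then obtain p where p: "p \<in> carrier (k[X])" "p \<noteq> []" "eval p x = \<zero>"
      using algebraicE[OF subfieldE(1)[OF k] x] alg[OF x] unfolding over_def by blast
    have pR: "p \<in> carrier (poly_ring R)"
      using p(1) carrier_polynomial_shell[OF subfieldE(1)[OF k]] by blast
    have gp: "map g p = p"
      using p(1) polynomial_incl g(2) unfolding univ_poly_carrier[symmetric] by (blast intro: map_idI)
    have sub: "g ` {y. is_root p y} \<subseteq> {y. is_root p y}"
      using g.eval_hom[OF carrier_is_subring _ pR, symmetric] g.hom_zero
      unfolding gp is_root_def by auto
    have fin: "finite {y. is_root p y}" using finite_number_of_roots[OF pR] .
    have "inj_on g {y. is_root p y}" using inj by (rule inj_on_subset) (auto simp: is_root_def)
    then have "g ` {y. is_root p y} = {y. is_root p y}"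
      using endo_inj_surj[OF fin sub] by simp
    moreover have "is_root p x" using x p by (simp add: is_root_def)
    ultimately have "x \<in> g ` {y. is_root p y}" by blast
    then show "x \<in> g ` carrier R" by (auto simp: is_root_def)
  qed
  then have "g ` carrier R = carrier R" using g.hom_closed by auto
  then have "bij_betw g (carrier R) (carrier R)" using inj by (simp add: bij_betw_def)
  then have "bij_betw (restrict g (carrier R)) (carrier R) (carrier R)"
    by (subst bij_betw_cong[of _ _ g]) simp_all
  then have "restrict g (carrier R) \<in> Bij (carrier R)" by (simp add: Bij_def)
  moreover have "restrict g (carrier R) \<in> ring_hom R R"
    by (rule ring_hom_memI) auto
  ultimately show ?thesis using subfieldE(3)[OF k] g(2) by (auto simp: field_auts_def)
qed

text \<open>If \<open>a\<close> is not in \<open>k\<close>, its minimal polynomial over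
  \<open>k\<close> has degree at least 2 and splits with simple roots, so it has a root
  \<open>b\<close> other than \<open>a\<close>. The embedding of the simple extension that sends
  \<open>a\<close> to \<open>b\<close> extends to an automorphism moving \<open>a\<close>.\<close>

lemma galois_fixed_field:
  assumes a: "a \<in> carrier R" "\<And>g. g \<in> field_auts R k \<Longrightarrow> g a = a"
  shows "a \<in> k"
proof (rule ccontr)
  assume ak: "a \<notin> k"
  have algk: "(algebraic over k) a" using alg a(1) by (simp add: over_def)
  note m = IrrE[OF k a(1) algk]
  have m0: "Irr k a \<noteq> []" using pirreducibleE(1)[OF subfieldE(1)[OF k] m(1,2)] .
  have mR: "Irr k a \<in> carrier (poly_ring R)"
    using m(1) carrier_polynomial_shell[OF subfieldE(1)[OF k]] by blast
  have "is_root (Irr k a) a" using a m m0 by (simp add: is_root_def)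
  then have spl: "splitted (Irr k a)" and mult: "\<And>x. x \<in> carrier R \<Longrightarrow> alg_mult (Irr k a) x \<le> 1"
    using gal m(1,2) unfolding galois_extension_def by blast+
  have "degree (Irr k a) \<noteq> 1"
  proof
    assume "degree (Irr k a) = 1"
    then have "length (Irr k a) = Suc (Suc 0)" using m0 by (cases "Irr k a") auto
    then obtain s t where st: "Irr k a = [s, t]" by (auto simp: length_Suc_conv)
    then have "s = \<one>" using m(3) by simp
    have "t \<in> k" using m(1) st unfolding univ_poly_carrier[symmetric] polynomial_def by auto
    have tR: "t \<in> carrier R" using \<open>t \<in> k\<close> subfieldE(3)[OF k] by auto
    have "a \<oplus> t = \<zero>" using m(4) st \<open>s = \<one>\<close> a(1) tR by simp
    then have "a = \<ominus> t" using a(1) tR by (metis minus_equality)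
    then show False using ak \<open>t \<in> k\<close> subringE(5)[OF subfieldE(1)[OF k]] by blast
  qed
  moreover have "degree (Irr k a) \<ge> 1" using pirreducible_degree[OF k m(1,2)] .
  ultimately have "size (roots (Irr k a)) \<ge> 2" using spl by (simp add: splitted_def)
  moreover have "count (roots (Irr k a)) a \<le> 1"
    using mult[OF a(1)] alg_mult_eq_count_roots[OF mR] by simp
  ultimately have "\<not> set_mset (roots (Irr k a)) \<subseteq> {a}"
    by (metis size_multiset_overloaded_eq set_mset_subset_singletonD size_replicate_mset count_replicate_mset
       Suc_1 not_less_eq_eq One_nat_def)
  then obtain b where "b \<noteq> a" "b \<in># roots (Irr k a)" by auto
  then have b: "b \<in> carrier R" "eval (Irr k a) b = \<zero>"
    using roots_mem_iff_is_root[OF mR] by (auto simp: is_root_def)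
  have idh: "id \<in> ring_hom (R\<lparr>carrier := k\<rparr>) R"
    using subfieldE(3)[OF k] by (auto intro!: ring_hom_memI)
  obtain h where h: "h \<in> ring_hom (R\<lparr>carrier := simple_extension k a\<rparr>) R"
    "\<And>x. x \<in> k \<Longrightarrow> h x = id x" "h a = b"
    using simple_extension_hom[OF k idh a(1) algk b(1)] b(2) by auto
  obtain Us where Us: "set Us \<subseteq> carrier R" "Span k Us = carrier R"
    using finite_dimension_imp_Span[OF k fd] .
  have S: "subfield (simple_extension k a) R" "k \<subseteq> simple_extension k a" "a \<in> simple_extension k a"
    using simple_extension_is_subfield[OF k a(1)] algk simple_extension_incl[OF subfieldE(3)[OF k] a(1)]
      simple_extension_mem[OF subfieldE(1)[OF k] a(1)] by auto
  obtain E g where g: "subfield E R" "simple_extension k a \<subseteq> E" "set Us \<subseteq> E"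
    "g \<in> ring_hom (R\<lparr>carrier := E\<rparr>) R" "\<forall>x\<in>simple_extension k a. g x = h x"
    using galois_hom_extend[OF S(1,2) h(1) _ Us(1)] h(2) by auto
  \<comment> \<open>The extended embedding lives on some subfield \<open>E\<close>, but
    \<open>E\<close> contains \<open>k\<close> and a spanning list of the whole field.\<close>
  have "carrier R \<subseteq> E" using Span_incl_subring[OF subfieldE(1)[OF g(1)] _ g(3)] g(2) S(2) Us(2) by blast
  then have "E = carrier R" using subfieldE(3)[OF g(1)] by blast
  then have gR: "g \<in> ring_hom R R" using g(4) by simp
  have "restrict g (carrier R) \<in> field_auts R k"
  proof (rule finite_hom_over_is_aut[OF gR])
    show "g x = x" if "x \<in> k" for x using that g(5) S(2) h(2) by auto
  qed
  from a(2)[OF this] have "g a = a" using a(1) by simp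
  then show False using \<open>b \<noteq> a\<close> h(3) g(5) S(3) by simp
qed

end

section \<open>Finite groups of automorphisms\<close>

lemma (in abelian_monoid) finsum_swap:
  assumes "finite A" "finite B" "\<And>x y. x \<in> A \<Longrightarrow> y \<in> B \<Longrightarrow> f x y \<in> carrier G"
  shows "(\<Oplus>x\<in>A. \<Oplus>y\<in>B. f x y) = (\<Oplus>y\<in>B. \<Oplus>x\<in>A. f x y)"
  using assms(1,3)
proof (induction A rule: finite_induct)
  case empty
  then show ?case by simp
next
  case (insert a A)
  have f: "f a y \<in> carrier G" "(\<Oplus>x\<in>A. f x y) \<in> carrier G" if "y \<in> B" for y
    using insert.prems that by auto
  have "(\<Oplus>x\<in>insert a A. \<Oplus>y\<in>B. f x y) = (\<Oplus>y\<in>B. f a y) \<oplus> (\<Oplus>x\<in>A. \<Oplus>y\<in>B. f x y)"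
    using insert by (intro finsum_insert) auto
  also have "\<dots> = (\<Oplus>y\<in>B. f a y) \<oplus> (\<Oplus>y\<in>B. \<Oplus>x\<in>A. f x y)"
    using insert by simp
  also have "\<dots> = (\<Oplus>y\<in>B. f a y \<oplus> (\<Oplus>x\<in>A. f x y))"
    using f by (intro finsum_addf[symmetric]) auto
  also have "\<dots> = (\<Oplus>y\<in>B. \<Oplus>x\<in>insert a A. f x y)"
    using insert f by (intro finsum_cong') auto
  finally show ?case .
qed

text \<open>The classical elimination: from the relation at \<open>x \<otimes> y\<close> subtract
  \<open>\<chi> t y\<close> times the relation at \<open>x\<close>. The term of \<open>t\<close>
  cancels, and a shorter relation with coefficients
  \<open>c s \<otimes> (\<chi> s y \<ominus> \<chi> t y)\<close> remains, where \<open>y\<close> is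
  chosen to tell \<open>s\<close> from \<open>t\<close>.\<close>

lemma (in field) dedekind_independence:
  assumes "finite S"
    and "\<And>s x. s \<in> S \<Longrightarrow> x \<in> carrier R \<Longrightarrow> \<chi> s x \<in> carrier R"
    and "\<And>s. s \<in> S \<Longrightarrow> \<chi> s \<one> = \<one>"
    and "\<And>s x y. s \<in> S \<Longrightarrow> x \<in> carrier R \<Longrightarrow> y \<in> carrier R \<Longrightarrow> \<chi> s (x \<otimes> y) = \<chi> s x \<otimes> \<chi> s y"
    and "\<And>s t. s \<in> S \<Longrightarrow> t \<in> S \<Longrightarrow> (\<forall>x\<in>carrier R. \<chi> s x = \<chi> t x) \<Longrightarrow> s = t"
    and "\<And>s. s \<in> S \<Longrightarrow> c s \<in> carrier R"
    and "\<And>x. x \<in> carrier R \<Longrightarrow> (\<Oplus>s\<in>S. c s \<otimes> \<chi> s x) = \<zero>"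
  shows "\<forall>s\<in>S. c s = \<zero>"
  using assms
proof (induction S arbitrary: c rule: finite_induct)
  case empty
  then show ?case by simp
next
  case (insert t S)
  note chi = insert.prems(1-3) and dist = insert.prems(4) and c = insert.prems(5) and zero = insert.prems(6)
  have shifted: "(\<Oplus>s\<in>S. (c s \<otimes> (\<chi> s y \<ominus> \<chi> t y)) \<otimes> \<chi> s x) = \<zero>"
    if x: "x \<in> carrier R" and y: "y \<in> carrier R" for x y
  proof -
    have *: "(c s \<otimes> (\<chi> s y \<ominus> \<chi> t y)) \<otimes> \<chi> s x = c s \<otimes> \<chi> s (x \<otimes> y) \<oplus> (\<ominus> \<chi> t y) \<otimes> (c s \<otimes> \<chi> s x)"
      if s: "s \<in> insert t S" for s
    proof -
      have "\<chi> s x \<in> carrier R" "\<chi> s y \<in> carrier R" "\<chi> t y \<in> carrier R" "c s \<in> carrier R"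
        using chi(1)[OF s] chi(1)[of t] c[OF s] x y by auto
      then show ?thesis unfolding chi(3)[OF s x y] by algebra
    qed
    have cl: "c s \<otimes> (\<chi> s y \<ominus> \<chi> t y) \<otimes> \<chi> s x \<in> carrier R"
       "c s \<otimes> \<chi> s (x \<otimes> y) \<in> carrier R" "c s \<otimes> \<chi> s x \<in> carrier R"
      if s: "s \<in> insert t S" for s
      using chi(1)[OF s] chi(1)[of t] c[OF s] x y by auto
    have ty: "\<chi> t y \<in> carrier R" using chi(1)[of t] y by auto
    have "(\<Oplus>s\<in>insert t S. (c s \<otimes> (\<chi> s y \<ominus> \<chi> t y)) \<otimes> \<chi> s x)
        = (\<Oplus>s\<in>insert t S. c s \<otimes> \<chi> s (x \<otimes> y) \<oplus> (\<ominus> \<chi> t y) \<otimes> (c s \<otimes> \<chi> s x))"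
      using * cl ty by (intro finsum_cong') auto
    also have "\<dots> = (\<Oplus>s\<in>insert t S. c s \<otimes> \<chi> s (x \<otimes> y))
        \<oplus> (\<Oplus>s\<in>insert t S. (\<ominus> \<chi> t y) \<otimes> (c s \<otimes> \<chi> s x))"
      using cl ty by (intro finsum_addf) blast+
    also have "(\<Oplus>s\<in>insert t S. (\<ominus> \<chi> t y) \<otimes> (c s \<otimes> \<chi> s x))
        = (\<ominus> \<chi> t y) \<otimes> (\<Oplus>s\<in>insert t S. c s \<otimes> \<chi> s x)"
      using cl ty insert.hyps by (intro finsum_rdistr[symmetric]) auto
    finally have "(\<Oplus>s\<in>insert t S. (c s \<otimes> (\<chi> s y \<ominus> \<chi> t y)) \<otimes> \<chi> s x) = \<zero>"
      using zero[OF x] zero[of "x \<otimes> y"] x y ty by simp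
    moreover have "(\<Oplus>s\<in>insert t S. (c s \<otimes> (\<chi> s y \<ominus> \<chi> t y)) \<otimes> \<chi> s x)
      = (c t \<otimes> (\<chi> t y \<ominus> \<chi> t y)) \<otimes> \<chi> t x \<oplus> (\<Oplus>s\<in>S. (c s \<otimes> (\<chi> s y \<ominus> \<chi> t y)) \<otimes> \<chi> s x)"
      using insert.hyps cl by (intro finsum_insert) auto
    moreover have "(c t \<otimes> (\<chi> t y \<ominus> \<chi> t y)) \<otimes> \<chi> t x = \<zero>"
      using ty c[of t] chi(1)[of t x] x by (simp add: a_minus_def r_neg)
    moreover have "(\<Oplus>s\<in>S. (c s \<otimes> (\<chi> s y \<ominus> \<chi> t y)) \<otimes> \<chi> s x) \<in> carrier R"
      using cl by auto
    ultimately show ?thesis by simp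
  qed
  have S0: "c s = \<zero>" if s: "s \<in> S" for s
  proof -
    have "s \<noteq> t" using s insert.hyps by blast
    then obtain y where y: "y \<in> carrier R" "\<chi> s y \<noteq> \<chi> t y" using dist[of s t] s by blast
    have "\<forall>s\<in>S. c s \<otimes> (\<chi> s y \<ominus> \<chi> t y) = \<zero>"
      by (rule insert.IH) (use chi dist c shifted y in auto)
    then have "c s \<otimes> (\<chi> s y \<ominus> \<chi> t y) = \<zero>" using s by blast
    moreover have "\<chi> s y \<ominus> \<chi> t y \<noteq> \<zero>" using y chi(1)[of s y] chi(1)[of t y] s by simp
    ultimately show ?thesis using c[of s] s chi(1)[of s y] chi(1)[of t y] y by (simp add: integral_iff)
  qed
  \<comment> \<open>All other coefficients vanish already, and evaluation at \<open>\<one>\<close>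
    isolates the last one.\<close>
  have "(\<Oplus>s\<in>insert t S. c s \<otimes> \<chi> s \<one>) = c t \<otimes> \<chi> t \<one> \<oplus> (\<Oplus>s\<in>S. c s \<otimes> \<chi> s \<one>)"
    using insert.hyps chi c by (intro finsum_insert) auto
  also have "(\<Oplus>s\<in>S. c s \<otimes> \<chi> s \<one>) = \<zero>"
    using S0 chi(2) by (intro add.finprod_one_eqI) simp
  finally have "c t = \<zero>" using zero[of \<one>] chi(2)[of t] c[of t] by simp
  then show ?case using S0 by blast
qed

text \<open>The group is abstract, because the elements of \<open>G i\<close> are numbers and not
  automorphisms. Normality and separability of the extension are condensed into
  \<open>act_fixed\<close>.\<close>

locale finite_galois_action = field R for R :: "'a ring" (structure) +
  fixes G :: "'g monoid" and act :: "'g \<Rightarrow> 'a \<Rightarrow> 'a" and k :: "'a set"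
  assumes G_group: "group G" and G_fin: "finite (carrier G)"
    and act_hom: "s \<in> carrier G \<Longrightarrow> act s \<in> ring_hom R R"
    and act_mult: "s \<in> carrier G \<Longrightarrow> t \<in> carrier G \<Longrightarrow> x \<in> carrier R \<Longrightarrow>
      act (s \<otimes>\<^bsub>G\<^esub> t) x = act s (act t x)"
    and act_faithful: "s \<in> carrier G \<Longrightarrow> t \<in> carrier G \<Longrightarrow> (\<And>x. x \<in> carrier R \<Longrightarrow> act s x = act t x)
      \<Longrightarrow> s = t"
    and k_subfield: "subfield k R"
    and act_k: "s \<in> carrier G \<Longrightarrow> x \<in> k \<Longrightarrow> act s x = x"
    and act_fixed: "x \<in> carrier R \<Longrightarrow> (\<And>s. s \<in> carrier G \<Longrightarrow> act s x = x) \<Longrightarrow> x \<in> k"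
begin

sublocale G: group G by (rule G_group)

lemma act_ring_hom_cring: "s \<in> carrier G \<Longrightarrow> ring_hom_cring R R (act s)"
  using act_hom ring_hom_ringI2[OF is_ring is_ring] cring_axioms
  by (intro ring_hom_cring.intro) (auto simp: ring_hom_cring_axioms_def)

lemma act_simps [simp]:
  assumes s: "s \<in> carrier G"
  shows "x \<in> carrier R \<Longrightarrow> act s x \<in> carrier R"
    and "x \<in> carrier R \<Longrightarrow> y \<in> carrier R \<Longrightarrow> act s (x \<otimes> y) = act s x \<otimes> act s y"
    and "x \<in> carrier R \<Longrightarrow> y \<in> carrier R \<Longrightarrow> act s (x \<oplus> y) = act s x \<oplus> act s y"
    and "act s \<one> = \<one>" and "act s \<zero> = \<zero>"
    and "x \<in> carrier R \<Longrightarrow> act s (\<ominus> x) = \<ominus> act s x"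
proof -
  interpret ring_hom_cring R R "act s" using act_ring_hom_cring[OF s] .
  show "x \<in> carrier R \<Longrightarrow> act s x \<in> carrier R"
    "x \<in> carrier R \<Longrightarrow> y \<in> carrier R \<Longrightarrow> act s (x \<otimes> y) = act s x \<otimes> act s y"
    "x \<in> carrier R \<Longrightarrow> y \<in> carrier R \<Longrightarrow> act s (x \<oplus> y) = act s x \<oplus> act s y"
    "act s \<one> = \<one>" "act s \<zero> = \<zero>" "x \<in> carrier R \<Longrightarrow> act s (\<ominus> x) = \<ominus> act s x"
    by simp_all
qed

lemma act_finsum:
  assumes s: "s \<in> carrier G" and f: "\<And>w. w \<in> W \<Longrightarrow> f w \<in> carrier R"
  shows "act s (\<Oplus>w\<in>W. f w) = (\<Oplus>w\<in>W. act s (f w))"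
proof -
  interpret ring_hom_cring R R "act s" using act_ring_hom_cring[OF s] .
  show ?thesis using hom_finsum[of f W] f by (auto simp: comp_def)
qed

lemma act_nat_pow:
  assumes s: "s \<in> carrier G" and x: "x \<in> carrier R"
  shows "act s (x [^] (e::nat)) = act s x [^] e"
  by (induction e) (use s x in auto)

text \<open>That the unit acts trivially is derived: it acts idempotently, and homomorphisms of
  fields are injective.\<close>

lemma act_one: assumes x: "x \<in> carrier R" shows "act \<one>\<^bsub>G\<^esub> x = x"
proof -
  have "act \<one>\<^bsub>G\<^esub> (act \<one>\<^bsub>G\<^esub> x) = act \<one>\<^bsub>G\<^esub> x"
    using act_mult[of "\<one>\<^bsub>G\<^esub>" "\<one>\<^bsub>G\<^esub>" x] x by simp
  moreover have "inj_on (act \<one>\<^bsub>G\<^esub>) (carrier R)"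
    using non_trivial_field_hom_is_inj[OF act_hom field_axioms field_axioms] by simp
  ultimately show ?thesis using x by (simp add: inj_on_def)
qed

lemma act_inv: "s \<in> carrier G \<Longrightarrow> x \<in> carrier R \<Longrightarrow> act (inv\<^bsub>G\<^esub> s) (act s x) = x"
  "s \<in> carrier G \<Longrightarrow> x \<in> carrier R \<Longrightarrow> act s (act (inv\<^bsub>G\<^esub> s) x) = x"
  using act_mult[of "inv\<^bsub>G\<^esub> s" s x] act_mult[of s "inv\<^bsub>G\<^esub> s" x] act_one by simp_all

lemma dedekind_act:
  assumes "S \<subseteq> carrier G" "\<And>s. s \<in> S \<Longrightarrow> c s \<in> carrier R"
    and "\<And>x. x \<in> carrier R \<Longrightarrow> (\<Oplus>s\<in>S. c s \<otimes> act s x) = \<zero>" and "s \<in> S"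
  shows "c s = \<zero>"
proof -
  have "\<forall>s\<in>S. c s = \<zero>"
    by (rule dedekind_independence[where \<chi> = act])
      (use assms finite_subset[OF assms(1) G_fin] act_faithful in \<open>auto simp: subset_iff\<close>)
  then show ?thesis using assms(4) by blast
qed

text \<open>Left multiplication by \<open>t\<close> permutes \<open>H\<close>.\<close>

lemma act_trace:
  assumes H: "subgroup H G" and t: "t \<in> H" and y: "y \<in> carrier R"
  shows "act t (\<Oplus>s\<in>H. act s y) = (\<Oplus>s\<in>H. act s y)"
proof -
  have HG: "H \<subseteq> carrier G" using subgroup.subset[OF H] .
  have tG: "t \<in> carrier G" using t HG by auto
  have inj: "inj_on (\<lambda>s. t \<otimes>\<^bsub>G\<^esub> s) H"
    using inj_on_subset[OF G.inj_on_cmult[OF tG] HG] .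
  have img: "(\<lambda>s. t \<otimes>\<^bsub>G\<^esub> s) ` H = H"
    by (rule endo_inj_surj[OF finite_subset[OF HG G_fin] _ inj]) (use subgroup.m_closed[OF H t] in auto)
  have "act t (\<Oplus>s\<in>H. act s y) = (\<Oplus>s\<in>H. act t (act s y))"
    using y HG by (intro act_finsum[OF tG]) auto
  also have "\<dots> = (\<Oplus>s\<in>H. act (t \<otimes>\<^bsub>G\<^esub> s) y)"
    using tG HG y by (intro finsum_cong') (auto simp: act_mult subset_iff)
  also have "\<dots> = (\<Oplus>s\<in>(\<lambda>s. t \<otimes>\<^bsub>G\<^esub> s) ` H. act s y)"
    using inj y HG tG by (intro finsum_reindex[symmetric]) (auto simp: subset_iff)
  finally show ?thesis by (simp add: img)
qed

text \<open>The trace of \<open>y\<close> over \<open>H\<close> is fixed by \<open>H\<close>; if \<open>s\<close> fixed all these traces, then the elements of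
  the disjoint sets \<open>H\<close> and \<open>s H\<close> would be linearly dependent.\<close>

lemma artin:
  assumes H: "subgroup H G" and s: "s \<in> carrier G" "s \<notin> H"
  obtains x where "x \<in> carrier R" "\<And>h. h \<in> H \<Longrightarrow> act h x = x" "act s x \<noteq> x"
proof (rule ccontr)
  note wit = that
  assume nex: "\<not> thesis"
  have HG: "H \<subseteq> carrier G" using subgroup.subset[OF H] .
  have fH: "finite H" using finite_subset[OF HG G_fin] .
  define sH where "sH = (\<lambda>h. s \<otimes>\<^bsub>G\<^esub> h) ` H"
  have inj: "inj_on (\<lambda>h. s \<otimes>\<^bsub>G\<^esub> h) H"
    using inj_on_subset[OF G.inj_on_cmult[OF s(1)] HG] .
  have sHG: "sH \<subseteq> carrier G" using s HG by (auto simp: sH_def)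
  have disj: "H \<inter> sH = {}"
  proof (rule ccontr)
    assume "H \<inter> sH \<noteq> {}"
    then obtain h where h: "h \<in> H" "s \<otimes>\<^bsub>G\<^esub> h \<in> H" by (auto simp: sH_def)
    then have "(s \<otimes>\<^bsub>G\<^esub> h) \<otimes>\<^bsub>G\<^esub> inv\<^bsub>G\<^esub> h \<in> H" by (meson H subgroup.m_closed subgroup.m_inv_closed)
    then show False using s h HG by (auto simp: G.m_assoc subset_iff)
  qed
  \<comment> \<open>The relation with these coefficients says that \<open>s\<close> fixes the trace
    of \<open>y\<close> over \<open>H\<close>.\<close>
  define c where "c g = (if g \<in> H then \<ominus> \<one> else \<one>)" for g
  have one: "\<one>\<^bsub>G\<^esub> \<in> H" using subgroup.one_closed[OF H] .
  have "c \<one>\<^bsub>G\<^esub> = \<zero>"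
  proof (rule dedekind_act[of "H \<union> sH" c "\<one>\<^bsub>G\<^esub>"])
    show "(\<Oplus>g\<in>H \<union> sH. c g \<otimes> act g y) = \<zero>" if y: "y \<in> carrier R" for y
    proof -
      let ?t = "\<Oplus>h\<in>H. act h y"
      have aH: "act h y \<in> carrier R" if "h \<in> H" for h using that HG y by auto
      have t: "?t \<in> carrier R" using aH by auto
      have "act s ?t = ?t"
        using nex wit[OF t] act_trace[OF H _ y] by blast
      moreover have "act s ?t = (\<Oplus>h\<in>H. act s (act h y))"
        using aH by (intro act_finsum[OF s(1)])
      moreover have "\<dots> = (\<Oplus>h\<in>H. act (s \<otimes>\<^bsub>G\<^esub> h) y)"
        using s HG y by (intro finsum_cong') (auto simp: act_mult subset_iff)
      moreover have "\<dots> = (\<Oplus>g\<in>sH. act g y)"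
        unfolding sH_def using inj y HG s by (intro finsum_reindex[symmetric]) (auto simp: subset_iff)
      moreover have "\<dots> = (\<Oplus>g\<in>sH. c g \<otimes> act g y)"
        using disj sHG y by (intro finsum_cong') (auto simp: c_def subset_iff)
      ultimately have 1: "(\<Oplus>g\<in>sH. c g \<otimes> act g y) = ?t" by simp
      have "(\<Oplus>g\<in>H. c g \<otimes> act g y) = (\<Oplus>g\<in>H. \<ominus> \<one> \<otimes> act g y)"
        using aH by (intro finsum_cong') (auto simp: c_def)
      also have "\<dots> = \<ominus> \<one> \<otimes> ?t"
        using aH fH by (intro finsum_rdistr[symmetric]) auto
      also have "\<dots> = \<ominus> ?t" using t by (simp add: l_minus)
      finally have 2: "(\<Oplus>g\<in>H. c g \<otimes> act g y) = \<ominus> ?t" .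
      have "(\<Oplus>g\<in>H \<union> sH. c g \<otimes> act g y) = (\<Oplus>g\<in>H. c g \<otimes> act g y) \<oplus> (\<Oplus>g\<in>sH. c g \<otimes> act g y)"
        using disj fH HG sHG y by (intro finsum_Un_disjoint) (auto simp: c_def sH_def subset_iff)
      then show ?thesis using 1 2 t by (simp add: l_neg)
    qed
  qed (use HG sHG one in \<open>auto simp: c_def\<close>)
  then show False using one by (simp add: c_def)
qed

text \<open>Galois descent for one linear condition: a relation that holds for all conjugates of \<open>v\<close>
  is multiplied by \<open>\<mu>\<close> and replaced by its trace.\<close>

lemma descent:
  assumes W: "finite W" and v: "\<And>w. w \<in> W \<Longrightarrow> v w \<in> carrier R"
    and u: "\<And>w. w \<in> W \<Longrightarrow> u w \<in> carrier R" and l: "\<And>w. w \<in> W \<Longrightarrow> \<nu> w \<in> carrier R"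
    and zero: "\<And>s. s \<in> carrier G \<Longrightarrow> (\<Oplus>w\<in>W. \<nu> w \<otimes> act s (v w)) = \<zero>"
    and nonzero: "(\<Oplus>w\<in>W. \<nu> w \<otimes> u w) \<noteq> \<zero>"
  obtains \<kappa> where "\<And>w. w \<in> W \<Longrightarrow> \<kappa> w \<in> k" "(\<Oplus>w\<in>W. \<kappa> w \<otimes> v w) = \<zero>" "(\<Oplus>w\<in>W. \<kappa> w \<otimes> u w) \<noteq> \<zero>"
proof -
  define c where "c s = (\<Oplus>w\<in>W. act s (\<nu> w) \<otimes> u w)" for s
  have cG: "c s \<in> carrier R" if "s \<in> carrier G" for s
    using that l u by (auto simp: c_def)
  have c1: "c \<one>\<^bsub>G\<^esub> = (\<Oplus>w\<in>W. \<nu> w \<otimes> u w)"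
    unfolding c_def using l u by (intro finsum_cong') (auto simp: act_one)
  \<comment> \<open>\<open>c s\<close> is the value at \<open>u\<close> of the relation conjugated
    by \<open>s\<close>. The coefficient at the unit is nonzero, so independence of the
    automorphisms gives a multiplier for which the traced relation does not vanish at
    \<open>u\<close>.\<close>
  obtain \<mu> where \<mu>: "\<mu> \<in> carrier R" "(\<Oplus>s\<in>carrier G. c s \<otimes> act s \<mu>) \<noteq> \<zero>"
    using dedekind_act[of "carrier G" c "\<one>\<^bsub>G\<^esub>"] cG nonzero c1 by auto
  define \<kappa> where "\<kappa> w = (\<Oplus>s\<in>carrier G. act s (\<mu> \<otimes> \<nu> w))" for w
  have kap: "\<kappa> w \<in> carrier R" if "w \<in> W" for w using that l \<mu> by (auto simp: \<kappa>_def)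
  have swap: "(\<Oplus>w\<in>W. \<kappa> w \<otimes> f w) = (\<Oplus>s\<in>carrier G. act s \<mu> \<otimes> (\<Oplus>w\<in>W. act s (\<nu> w) \<otimes> f w))"
    if f: "\<And>w. w \<in> W \<Longrightarrow> f w \<in> carrier R" for f
  proof -
    have "(\<Oplus>w\<in>W. \<kappa> w \<otimes> f w) = (\<Oplus>w\<in>W. \<Oplus>s\<in>carrier G. act s \<mu> \<otimes> (act s (\<nu> w) \<otimes> f w))"
    proof (rule finsum_cong')
      fix w assume w: "w \<in> W"
      have "\<kappa> w \<otimes> f w = (\<Oplus>s\<in>carrier G. act s (\<mu> \<otimes> \<nu> w) \<otimes> f w)"
        unfolding \<kappa>_def using w l \<mu> f G_fin by (intro finsum_ldistr) auto
      also have "\<dots> = (\<Oplus>s\<in>carrier G. act s \<mu> \<otimes> (act s (\<nu> w) \<otimes> f w))"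
        using w l \<mu> f by (intro finsum_cong') (auto simp: m_assoc)
      finally show "\<kappa> w \<otimes> f w = (\<Oplus>s\<in>carrier G. act s \<mu> \<otimes> (act s (\<nu> w) \<otimes> f w))" .
    qed (use l \<mu> f in auto)
    also have "\<dots> = (\<Oplus>s\<in>carrier G. \<Oplus>w\<in>W. act s \<mu> \<otimes> (act s (\<nu> w) \<otimes> f w))"
      using W G_fin l \<mu> f by (intro finsum_swap) auto
    also have "\<dots> = (\<Oplus>s\<in>carrier G. act s \<mu> \<otimes> (\<Oplus>w\<in>W. act s (\<nu> w) \<otimes> f w))"
      using W l \<mu> f by (intro finsum_cong' finsum_rdistr[symmetric]) auto
    finally show ?thesis .
  qed
  show ?thesis
  proof
    show "\<kappa> w \<in> k" if w: "w \<in> W" for w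
      using act_fixed[OF kap[OF w]] act_trace[OF G.subgroup_self, of _ "\<mu> \<otimes> \<nu> w"] w l \<mu>
      by (auto simp: \<kappa>_def)
    \<comment> \<open>The hypothesis for the conjugate of \<open>v\<close> by the inverse of
      \<open>s\<close> is moved by \<open>s\<close>: all conjugates of the relation vanish at
      \<open>v\<close>, and so does their weighted sum.\<close>
    have "(\<Oplus>w\<in>W. act s (\<nu> w) \<otimes> v w) = \<zero>" if s: "s \<in> carrier G" for s
    proof -
      have "(\<Oplus>w\<in>W. act s (\<nu> w) \<otimes> v w) = (\<Oplus>w\<in>W. act s (\<nu> w \<otimes> act (inv\<^bsub>G\<^esub> s) (v w)))"
        using s l v by (intro finsum_cong') (auto simp: act_inv)
      also have "\<dots> = act s (\<Oplus>w\<in>W. \<nu> w \<otimes> act (inv\<^bsub>G\<^esub> s) (v w))"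
        using s l v by (intro act_finsum[symmetric]) auto
      finally show ?thesis using zero[of "inv\<^bsub>G\<^esub> s"] s by simp
    qed
    then have "(\<Oplus>s\<in>carrier G. act s \<mu> \<otimes> (\<Oplus>w\<in>W. act s (\<nu> w) \<otimes> v w)) = \<zero>"
      using \<mu> by (intro add.finprod_one_eqI) simp
    then show "(\<Oplus>w\<in>W. \<kappa> w \<otimes> v w) = \<zero>" using swap[OF v] by simp
    have "(\<Oplus>w\<in>W. \<kappa> w \<otimes> u w) = (\<Oplus>s\<in>carrier G. act s \<mu> \<otimes> c s)"
      unfolding c_def by (rule swap[OF u])
    also have "\<dots> = (\<Oplus>s\<in>carrier G. c s \<otimes> act s \<mu>)"
      using cG \<mu> by (intro finsum_cong') (auto intro: m_comm)
    finally have "(\<Oplus>w\<in>W. \<kappa> w \<otimes> u w) = (\<Oplus>s\<in>carrier G. c s \<otimes> act s \<mu>)" .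
    then show "(\<Oplus>w\<in>W. \<kappa> w \<otimes> u w) \<noteq> \<zero>" using \<mu> by simp
  qed
qed

end

section \<open>Conjugates and polynomial relations\<close>

text \<open>Words in the variables \<open>0, \<dots>, m - 1\<close> play the role of monomials of bounded degree; that different
  words can denote the same monomial does no harm.\<close>

definition words :: "nat \<Rightarrow> nat \<Rightarrow> nat list set" where
  "words m N = {w. set w \<subseteq> {..<m} \<and> length w \<le> N}"

lemma finite_words [simp]: "finite (words m N)"
  unfolding words_def by (rule finite_lists_length_le) simp

definition (in ring) wval :: "(nat \<Rightarrow> 'a) \<Rightarrow> nat list \<Rightarrow> 'a" where
  "wval x w = foldr (\<lambda>j y. x j \<otimes> y) w \<one>"

lemma (in ring) wval_simps [simp]: "wval x [] = \<one>" "wval x (j # w) = x j \<otimes> wval x w"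
  by (simp_all add: wval_def)

lemma (in ring) wval_closed:
  assumes "\<And>j. j < m \<Longrightarrow> x j \<in> carrier R" "set w \<subseteq> {..<m}"
  shows "wval x w \<in> carrier R"
  using assms(2) by (induction w) (auto intro: assms(1))

definition (in ring) linprod :: "(nat \<times> 'a) list \<Rightarrow> (nat \<Rightarrow> 'a) \<Rightarrow> 'a" where
  "linprod L x = foldr (\<lambda>(j, c) y. (x j \<ominus> c) \<otimes> y) L \<one>"

lemma (in ring) linprod_simps [simp]:
  "linprod [] x = \<one>" "linprod ((j, c) # L) x = (x j \<ominus> c) \<otimes> linprod L x"
  by (simp_all add: linprod_def)

text \<open>Multiplying out one factor at a time. The coefficients are independent of
  \<open>x\<close>, so a single relation can be evaluated at all conjugates and at \<open>b\<close>.
  The coefficient of the word \<open>map fst L\<close> is recorded because it is the leading one in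
  the case of one variable.\<close>

lemma (in cring) linprod_expand:
  assumes "\<And>j c. (j, c) \<in> set L \<Longrightarrow> j < m \<and> c \<in> carrier R"
  shows "\<exists>l. (\<forall>w. l w \<in> carrier R) \<and> l (map fst L) = \<one> \<and>
    (\<forall>x. (\<forall>j<m. x j \<in> carrier R) \<longrightarrow>
      linprod L x \<in> carrier R \<and> (\<Oplus>w\<in>words m (length L). l w \<otimes> wval x w) = linprod L x)"
  using assms
proof (induction L)
  case Nil
  have "words m 0 = {[]}" by (auto simp: words_def)
  then show ?case by (intro exI[of _ "\<lambda>_. \<one>"]) (simp add: finsum_insert)
next
  case (Cons jc L)
  obtain j c where jc: "jc = (j, c)" by (cases jc)
  have j: "j < m" and c: "c \<in> carrier R" using Cons.prems[of j c] jc by auto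
  obtain l where l: "\<And>w. l w \<in> carrier R" "l (map fst L) = \<one>"
    and exp: "\<And>x. (\<And>j. j < m \<Longrightarrow> x j \<in> carrier R) \<Longrightarrow>
      linprod L x \<in> carrier R \<and> (\<Oplus>w\<in>words m (length L). l w \<otimes> wval x w) = linprod L x"
    using Cons.IH Cons.prems by force
  \<comment> \<open>\<open>A\<close> collects the products with the variable \<open>j\<close>, whose
    words begin with \<open>j\<close>; \<open>B\<close> is the old coefficient function, extended by
    zero to the words of the new maximal length.\<close>
  define A where "A w = (case w of [] \<Rightarrow> \<zero> | j' # w' \<Rightarrow> if j' = j \<and> length w' \<le> length L then l w' else \<zero>)" for w
  define B where "B w = (if length w \<le> length L then l w else \<zero>)" for w
  define l' where "l' w = A w \<oplus> (\<ominus> c) \<otimes> B w" for w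
  have A: "A w \<in> carrier R" and B: "B w \<in> carrier R" for w
    using l by (auto simp: A_def B_def split: list.split)
  let ?N = "length L" and ?W = "words m (Suc (length L))"
  show ?case
  proof (intro exI[of _ l'] conjI allI impI)
    show "l' w \<in> carrier R" for w using A B c by (simp add: l'_def)
    show "l' (map fst (jc # L)) = \<one>" using l c by (simp add: l'_def A_def B_def jc)
  next
    fix x assume x: "\<forall>j<m. x j \<in> carrier R"
    have P: "linprod L x \<in> carrier R" and e: "(\<Oplus>w\<in>words m ?N. l w \<otimes> wval x w) = linprod L x"
      using exp x by auto
    show "linprod (jc # L) x \<in> carrier R" using x j c P by (simp add: jc)
    have v: "wval x w \<in> carrier R" if "w \<in> words m n" for w n
      using that x by (intro wval_closed[of m]) (auto simp: words_def)
    have inj: "inj_on ((#) j) (words m ?N)" by simp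
    have "(\<Oplus>w\<in>?W. A w \<otimes> wval x w) = (\<Oplus>w\<in>(#) j ` words m ?N. A w \<otimes> wval x w)"
    proof (rule add.finprod_mono_neutral_cong_right)
      show "(#) j ` words m ?N \<subseteq> ?W" using j by (auto simp: words_def)
      show "A w \<otimes> wval x w = \<zero>" if "w \<in> ?W - (#) j ` words m ?N" for w
      proof -
        have "A w = \<zero>" using that by (auto simp: A_def words_def image_iff split: list.split)
        then show ?thesis using v[of w "Suc ?N"] that by simp
      qed
    qed (use A v in auto)
    also have "\<dots> = (\<Oplus>w\<in>words m ?N. A (j # w) \<otimes> wval x (j # w))"
      using A v x j inj by (intro finsum_reindex) (auto simp del: wval_simps simp: words_def intro!: v[of _ "Suc ?N"])
    also have "\<dots> = (\<Oplus>w\<in>words m ?N. x j \<otimes> (l w \<otimes> wval x w))"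
      using l v x j by (intro finsum_cong') (auto simp: A_def words_def intro!: m_lcomm)
    also have "\<dots> = x j \<otimes> linprod L x"
      unfolding e[symmetric] using l v x j by (intro finsum_rdistr[symmetric]) auto
    finally have 1: "(\<Oplus>w\<in>?W. A w \<otimes> wval x w) = x j \<otimes> linprod L x" .
    have "(\<Oplus>w\<in>?W. B w \<otimes> wval x w) = (\<Oplus>w\<in>words m ?N. l w \<otimes> wval x w)"
      using B v by (intro add.finprod_mono_neutral_cong_right)
        (auto simp: words_def B_def finite_words[unfolded words_def])
    then have 2: "(\<Oplus>w\<in>?W. (\<ominus> c) \<otimes> (B w \<otimes> wval x w)) = (\<ominus> c) \<otimes> linprod L x"
      using B v c e finsum_rdistr[of ?W "\<ominus> c" "\<lambda>w. B w \<otimes> wval x w"] by auto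
    have "(\<Oplus>w\<in>?W. l' w \<otimes> wval x w) = (\<Oplus>w\<in>?W. A w \<otimes> wval x w \<oplus> (\<ominus> c) \<otimes> (B w \<otimes> wval x w))"
      using A B c v by (intro finsum_cong') (auto simp: l'_def l_distr m_assoc)
    also have "\<dots> = x j \<otimes> linprod L x \<oplus> (\<ominus> c) \<otimes> linprod L x"
      using A B c v unfolding 1[symmetric] 2[symmetric] by (intro finsum_addf) auto
    also have "\<dots> = linprod (jc # L) x"
      using x j c P by (simp add: jc a_minus_def l_distr)
    finally show "(\<Oplus>w\<in>words m (length (jc # L)). l' w \<otimes> wval x w) = linprod (jc # L) x" by simp
  qed
qed

lemma (in domain) linprod_eq_zero_iff:
  assumes "\<And>j c. (j, c) \<in> set L \<Longrightarrow> x j \<in> carrier R \<and> c \<in> carrier R"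
  shows "linprod L x \<in> carrier R \<and> (linprod L x = \<zero> \<longleftrightarrow> (\<exists>(j, c)\<in>set L. x j = c))"
  using assms
proof (induction L)
  case (Cons jc L)
  obtain j c where jc: "jc = (j, c)" by (cases jc)
  have "x j \<in> carrier R" "c \<in> carrier R" using Cons.prems[of j c] jc by auto
  moreover have "linprod L x \<in> carrier R \<and> (linprod L x = \<zero> \<longleftrightarrow> (\<exists>(j, c)\<in>set L. x j = c))"
    using Cons.IH Cons.prems by auto
  ultimately show ?case by (auto simp: jc integral_iff)
qed simp

text \<open>Polynomials are lists with the leading coefficient in front; hence
  \<open>rev\<close>.\<close>

lemma (in ring) eval_eq_finsum:
  assumes "\<And>e. e < n \<Longrightarrow> l e \<in> carrier R" "x \<in> carrier R"
  shows "eval (map l (rev [0..<n])) x = (\<Oplus>e\<in>{..<n}. l e \<otimes> x [^] e)"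
  using assms(1)
proof (induction n)
  case (Suc n)
  have "eval (map l (rev [0..<Suc n])) x = l n \<otimes> x [^] n \<oplus> eval (map l (rev [0..<n])) x"
    by (simp del: length_rev add: length_rev)
  also have "\<dots> = (\<Oplus>e\<in>insert n {..<n}. l e \<otimes> x [^] e)"
    using Suc assms(2) by (subst finsum_insert) auto
  finally show ?case by (simp add: lessThan_Suc)
qed simp

text \<open>Explicit coefficients instead of polynomials: in this form algebraicity can be evaluated
  index by index and searched for. The case \<open>n = 0\<close> cannot occur on the right, since
  the sum is then the nonzero \<open>l 0\<close>.\<close>

lemma (in domain) algebraic_iff_finsum:
  assumes k: "subfield k R" and x: "x \<in> carrier R"
  shows "algebraic k x \<longleftrightarrow> (\<exists>(n::nat) l. (\<forall>e\<le>n. l e \<in> k) \<and> l n \<noteq> \<zero> \<and> (\<Oplus>e\<in>{..n}. l e \<otimes> x [^] e) = \<zero>)"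
    (is "_ \<longleftrightarrow> ?R")
proof
  have kR: "k \<subseteq> carrier R" using subfieldE(3)[OF k] .
  {
    assume "algebraic k x"
    then obtain p where p: "p \<in> carrier (k[X])" "p \<noteq> []" "eval p x = \<zero>"
      using algebraicE[OF subfieldE(1)[OF k] x] unfolding over_def by blast
    define n where "n = length p - 1"
    have len: "length p = Suc n" using p(2) by (simp add: n_def)
    have pk: "set p \<subseteq> k" "lead_coeff p \<noteq> \<zero>"
      using p(1,2) unfolding univ_poly_carrier[symmetric] polynomial_def by auto
    have l: "coeff p e \<in> k" if "e \<le> n" for e
      using that pk(1) coeff_nth[of e p] len by (auto simp: subset_iff)
    have "eval (map (coeff p) (rev [0..<Suc n])) x = (\<Oplus>e\<in>{..<Suc n}. coeff p e \<otimes> x [^] e)"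
      using l kR by (intro eval_eq_finsum x) auto
    moreover have "map (coeff p) (rev [0..<Suc n]) = p" unfolding len[symmetric] by (rule coeff_list)
    ultimately have "(\<Oplus>e\<in>{..n}. coeff p e \<otimes> x [^] e) = \<zero>"
      using p(3) by (simp only: lessThan_Suc_atMost)
    moreover have "coeff p n \<noteq> \<zero>" using lead_coeff_simp[OF p(2)] pk(2) by (simp add: n_def)
    ultimately have "(\<forall>e\<le>n. coeff p e \<in> k) \<and> coeff p n \<noteq> \<zero> \<and> (\<Oplus>e\<in>{..n}. coeff p e \<otimes> x [^] e) = \<zero>"
      using l by simp
    then have "\<exists>l. (\<forall>e\<le>n. l e \<in> k) \<and> l n \<noteq> \<zero> \<and> (\<Oplus>e\<in>{..n}. l e \<otimes> x [^] e) = \<zero>"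
      by (rule exI[of _ "coeff p"])
    then show ?R by (rule exI)
  next
    assume ?R
    then obtain n :: nat and l where l: "\<And>e. e \<le> n \<Longrightarrow> l e \<in> k" "l n \<noteq> \<zero>" "(\<Oplus>e\<in>{..n}. l e \<otimes> x [^] e) = \<zero>" by blast
    let ?p = "map l (rev [0..<Suc n])"
    have "?p \<in> carrier (k[X])" using l(1,2) by (auto simp: univ_poly_carrier[symmetric] polynomial_def)
    moreover have "eval ?p x = (\<Oplus>e\<in>{..<Suc n}. l e \<otimes> x [^] e)"
      using l(1) kR by (intro eval_eq_finsum x) auto
    ultimately have "(algebraic over k) x"
      using l(3) by (intro algebraicI[of ?p]) (auto simp: lessThan_Suc_atMost)
    then show "algebraic k x" by (simp add: over_def)
  }
qed

lemma (in field) card_roots_le: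
  fixes n :: nat
  assumes l: "\<And>e. e \<le> n \<Longrightarrow> l e \<in> carrier R" "l n \<noteq> \<zero>"
    and A: "\<And>x. x \<in> A \<Longrightarrow> x \<in> carrier R \<and> (\<Oplus>e\<in>{..n}. l e \<otimes> x [^] e) = \<zero>"
  shows "finite A \<and> card A \<le> n"
proof -
  let ?p = "map l (rev [0..<Suc n])"
  have p: "?p \<in> carrier (poly_ring R)"
    using l by (auto simp: univ_poly_carrier[symmetric] polynomial_def)
  have "is_root ?p x" if "x \<in> A" for x
  proof -
    have "eval ?p x = (\<Oplus>e\<in>{..<Suc n}. l e \<otimes> x [^] e)"
      using l(1) A[OF that] by (intro eval_eq_finsum) auto
    then show ?thesis using A[OF that] by (simp add: is_root_def lessThan_Suc_atMost)
  qed
  then have "A \<subseteq> set_mset (roots ?p)" using roots_mem_iff_is_root[OF p] by auto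
  moreover have "card (set_mset (roots ?p)) \<le> n"
  proof -
    obtain xs where xs: "mset xs = roots ?p" using ex_mset by blast
    have "card (set xs) \<le> length xs" by (rule card_length)
    also have "length xs = size (roots ?p)" using xs by (metis size_mset)
    finally show ?thesis using size_roots_le_degree[OF p] xs[symmetric] by simp
  qed
  ultimately show ?thesis
    by (meson card_mono finite_set_mset finite_subset le_trans)
qed

section \<open>Orbits, degrees and separating relations\<close>

context finite_galois_action
begin

definition orb :: "'a \<Rightarrow> 'a set" where
  "orb x = (\<lambda>s. act s x) ` carrier G"

lemma orb_finite [simp]: "finite (orb x)"
  using G_fin by (simp add: orb_def)

lemma orb_closed: "x \<in> carrier R \<Longrightarrow> c \<in> orb x \<Longrightarrow> c \<in> carrier R"
  by (auto simp: orb_def)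

text \<open>All conjugates of \<open>x\<close> are roots of the same polynomial, as its coefficients
  are fixed.\<close>

lemma card_orb_le:
  fixes n :: nat
  assumes l: "\<And>e. e \<le> n \<Longrightarrow> l e \<in> k" "l n \<noteq> \<zero>"
    and x: "x \<in> carrier R" "(\<Oplus>e\<in>{..n}. l e \<otimes> x [^] e) = \<zero>"
  shows "card (orb x) \<le> n"
proof -
  have kR: "k \<subseteq> carrier R" using subfieldE(3)[OF k_subfield] .
  have "finite (orb x) \<and> card (orb x) \<le> n"
  proof (rule card_roots_le[of n l])
    fix y assume "y \<in> orb x"
    then obtain s where s: "s \<in> carrier G" "y = act s x" by (auto simp: orb_def)
    have "(\<Oplus>e\<in>{..n}. l e \<otimes> y [^] e) = (\<Oplus>e\<in>{..n}. act s (l e \<otimes> x [^] e))"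
      using s x l(1) kR by (intro finsum_cong') (auto simp: act_nat_pow act_k subset_iff)
    also have "\<dots> = act s (\<Oplus>e\<in>{..n}. l e \<otimes> x [^] e)"
      using s x l(1) kR by (intro act_finsum[symmetric]) auto
    finally show "y \<in> carrier R \<and> (\<Oplus>e\<in>{..n}. l e \<otimes> y [^] e) = \<zero>" using s x by simp
  qed (use l kR in auto)
  then show ?thesis by simp
qed

text \<open>The polynomial whose roots are the conjugates of \<open>x\<close>, multiplied by a power
  of the variable to reach degree exactly \<open>n\<close>, vanishes at every conjugate.
  \<open>descent\<close> moves its coefficients into \<open>k\<close>.\<close>

lemma bounded_degree:
  assumes x: "x \<in> carrier R" and n: "card (orb x) \<le> n"
  obtains l where "\<And>e. e \<le> n \<Longrightarrow> l e \<in> k" "l n \<noteq> \<zero>" "(\<Oplus>e\<in>{..n}. l e \<otimes> x [^] e) = \<zero>"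
proof -
  obtain cs where cs: "set cs = orb x" "distinct cs"
    using finite_distinct_list[OF orb_finite] by blast
  then have "length cs \<le> n" using n distinct_card by fastforce
  \<comment> \<open>Zero is added as a root until the degree is exactly \<open>n\<close>, so that
    the degree depends on the bound only.\<close>
  define ds where "ds = cs @ replicate (n - length cs) \<zero>"
  define L where "L = map (Pair (0::nat)) ds"
  have len: "length L = n" using \<open>length cs \<le> n\<close> by (simp add: L_def ds_def)
  have L: "j < 1 \<and> c \<in> carrier R" if "(j, c) \<in> set L" for j c
    using that orb_closed[OF x] cs(1) by (auto simp: L_def ds_def split: if_splits)
  obtain \<nu> where H: "(\<forall>w. \<nu> w \<in> carrier R) \<and> \<nu> (map fst L) = \<one> \<and>
    (\<forall>y. (\<forall>j<1. y j \<in> carrier R) \<longrightarrow>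
      linprod L y \<in> carrier R \<and> (\<Oplus>w\<in>words 1 n. \<nu> w \<otimes> wval y w) = linprod L y)"
    using linprod_expand[of L 1, OF L] unfolding len by (rule exE)
  then have \<nu>: "\<And>w. \<nu> w \<in> carrier R" "\<nu> (map fst L) = \<one>" by simp_all
  have exp: "(\<Oplus>w\<in>words 1 n. \<nu> w \<otimes> wval y w) = linprod L y" if "\<And>j. j < 1 \<Longrightarrow> y j \<in> carrier R" for y
    using H that by simp
  have top: "map fst L = replicate n 0"
    using len by (simp add: L_def comp_def map_replicate_const)
  \<comment> \<open>With a single variable there is exactly one word for each exponent.\<close>
  have W: "words 1 n = (\<lambda>e. replicate e 0) ` {..n}"
  proof
    show "words 1 n \<subseteq> (\<lambda>e. replicate e 0) ` {..n}"
    proof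
      fix w assume w: "w \<in> words 1 n"
      then have "w = replicate (length w) 0" by (intro replicate_eqI) (auto simp: words_def)
      then show "w \<in> (\<lambda>e. replicate e 0) ` {..n}" using w by (auto simp: words_def)
    qed
  qed (auto simp: words_def)
  have inj: "inj_on (\<lambda>e. replicate e (0::nat)) {..n}" by (auto simp: inj_on_def)
  have wv: "wval (\<lambda>_. y) (replicate e j) = y [^] e" if "y \<in> carrier R" for y j and e :: nat
    using that by (induction e) (auto simp: m_comm)
  define \<nu>' where "\<nu>' e = \<nu> (replicate e 0)" for e
  have exp': "(\<Oplus>e\<in>{..n}. \<nu>' e \<otimes> y [^] e) = linprod L (\<lambda>_. y)" if y: "y \<in> carrier R" for y
  proof -
    have "(\<Oplus>w\<in>words 1 n. \<nu> w \<otimes> wval (\<lambda>_. y) w)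
        = (\<Oplus>e\<in>{..n}. \<nu> (replicate e 0) \<otimes> wval (\<lambda>_. y) (replicate e 0))"
      unfolding W using inj \<nu> wv y by (intro finsum_reindex) auto
    then show ?thesis using exp[of "\<lambda>_. y"] y wv by (simp add: \<nu>'_def)
  qed
  have \<nu>'_carr: "\<nu>' e \<in> carrier R" for e using \<nu> by (simp add: \<nu>'_def)
  obtain \<kappa> where \<kappa>: "\<And>w. w \<in> {..n} \<Longrightarrow> \<kappa> w \<in> k" "(\<Oplus>w\<in>{..n}. \<kappa> w \<otimes> x [^] w) = \<zero>"
    "(\<Oplus>w\<in>{..n}. \<kappa> w \<otimes> (if w = n then \<one> else \<zero>)) \<noteq> \<zero>"
  \<comment> \<open>The family \<open>u\<close> is the indicator of the exponent \<open>n\<close>,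
    so the condition kept nonzero by \<open>descent\<close> is that on the leading
    coefficient.\<close>
  proof (rule descent[of "{..n}" "\<lambda>e. x [^] e" "\<lambda>e. if e = n then \<one> else \<zero>" \<nu>'])
    show "(\<Oplus>w\<in>{..n}. \<nu>' w \<otimes> act s (x [^] w)) = \<zero>" if s: "s \<in> carrier G" for s
    proof -
      have "(0, act s x) \<in> set L" using s cs(1) by (auto simp: L_def ds_def orb_def)
      then have "linprod L (\<lambda>_. act s x) = \<zero>"
        using linprod_eq_zero_iff[of L "\<lambda>_. act s x"] L s x by force
      then show ?thesis using exp'[of "act s x"] s x by (simp add: act_nat_pow)
    qed
    have "(\<Oplus>w\<in>{..n}. \<nu>' w \<otimes> (if w = n then \<one> else \<zero>)) = (\<Oplus>w\<in>{..n}. if w = n then \<nu>' w else \<zero>)"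
      using \<nu>'_carr by (intro finsum_cong') auto
    also have "\<dots> = \<nu>' n"
      using \<nu>'_carr by (intro add.finprod_singleton_swap) auto
    finally show "(\<Oplus>w\<in>{..n}. \<nu>' w \<otimes> (if w = n then \<one> else \<zero>)) \<noteq> \<zero>"
      using \<nu>(2) top by (simp add: \<nu>'_def)
  qed (use x \<nu>'_carr in auto)
  have "\<kappa> n \<noteq> \<zero>"
  proof
    assume "\<kappa> n = \<zero>"
    have kR: "\<kappa> w \<in> carrier R" if "w \<le> n" for w using \<kappa>(1) that subfieldE(3)[OF k_subfield] by auto
    have "(\<Oplus>w\<in>{..n}. \<kappa> w \<otimes> (if w = n then \<one> else \<zero>)) = \<zero>"
      by (rule add.finprod_one_eqI) (use \<open>\<kappa> n = \<zero>\<close> kR in auto)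
    then show False using \<kappa>(3) by simp
  qed
  then show ?thesis using that[of \<kappa>] \<kappa>(1,2) by auto
qed

lemma separate_orbits:
  assumes a: "\<And>j. j < m \<Longrightarrow> a j \<in> carrier R" and b: "\<And>j. j < m \<Longrightarrow> b j \<in> carrier R"
    and N: "(\<Sum>j<m. card (orb (a j))) \<le> N"
    and no: "\<And>s. s \<in> carrier G \<Longrightarrow> \<exists>j<m. act s (a j) \<noteq> b j"
  obtains \<kappa> where "\<And>w. w \<in> words m N \<Longrightarrow> \<kappa> w \<in> k"
    "(\<Oplus>w\<in>words m N. \<kappa> w \<otimes> wval a w) = \<zero>" "(\<Oplus>w\<in>words m N. \<kappa> w \<otimes> wval b w) \<noteq> \<zero>"
proof -
  \<comment> \<open>Leaving out \<open>b j\<close> keeps the product nonzero at \<open>b\<close>. It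
    still vanishes at each conjugate of the tuple \<open>a\<close>, because by \<open>no\<close>
    such a conjugate differs from \<open>b\<close> in some coordinate and that coordinate is a root
    of one of the factors.\<close>
  define S where "S = (SIGMA j:{..<m}. orb (a j) - {b j})"
  have finS: "finite S" by (auto simp: S_def)
  obtain L where L: "set L = S" "distinct L" using finite_distinct_list[OF finS] by blast
  have "length L = (\<Sum>j<m. card (orb (a j) - {b j}))"
    using distinct_card[OF L(2)] unfolding L(1) S_def by (simp add: card_SigmaI)
  also have "\<dots> \<le> (\<Sum>j<m. card (orb (a j)))" by (intro sum_mono card_mono) auto
  finally have len: "length L \<le> N" using N by simp
  have Lc: "j < m \<and> c \<in> carrier R" if "(j, c) \<in> set L" for j c
    using that L(1) orb_closed[OF a] by (auto simp: S_def)
  obtain \<nu> where H: "(\<forall>w. \<nu> w \<in> carrier R) \<and> \<nu> (map fst L) = \<one> \<and>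
    (\<forall>y. (\<forall>j<m. y j \<in> carrier R) \<longrightarrow>
      linprod L y \<in> carrier R \<and> (\<Oplus>w\<in>words m (length L). \<nu> w \<otimes> wval y w) = linprod L y)"
    using linprod_expand[of L m, OF Lc] by (rule exE)
  then have \<nu>: "\<And>w. \<nu> w \<in> carrier R" by simp
  have exp: "(\<Oplus>w\<in>words m (length L). \<nu> w \<otimes> wval y w) = linprod L y"
    if "\<And>j. j < m \<Longrightarrow> y j \<in> carrier R" for y
    using H that by simp
  \<comment> \<open>Extension by zero to all words of length at most \<open>N\<close>: the index set
    of the relation then depends only on \<open>m\<close> and \<open>N\<close>, and not on the sizes
    of the orbits.\<close>
  define \<nu>' where "\<nu>' w = (if length w \<le> length L then \<nu> w else \<zero>)" for w
  have \<nu>': "\<nu>' w \<in> carrier R" for w using \<nu> by (simp add: \<nu>'_def)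
  have v: "wval y w \<in> carrier R" if "w \<in> words m N" "\<And>j. j < m \<Longrightarrow> y j \<in> carrier R" for y w
    using that by (intro wval_closed[of m]) (auto simp: words_def)
  have exp': "(\<Oplus>w\<in>words m N. \<nu>' w \<otimes> wval y w) = linprod L y"
    if y: "\<And>j. j < m \<Longrightarrow> y j \<in> carrier R" for y
  proof -
    have "(\<Oplus>w\<in>words m N. \<nu>' w \<otimes> wval y w) = (\<Oplus>w\<in>words m (length L). \<nu> w \<otimes> wval y w)"
      using len \<nu>' v y by (intro add.finprod_mono_neutral_cong_right)
        (auto simp: words_def \<nu>'_def finite_words[unfolded words_def])
    then show ?thesis using exp[OF y] by simp
  qed
  have act_wval: "act s (wval a w) = wval (\<lambda>j. act s (a j)) w" if "s \<in> carrier G" "set w \<subseteq> {..<m}" for s w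
    using that(2)
  proof (induction w)
    case (Cons j w)
    then show ?case using that(1) a wval_closed[of m a w] by simp
  qed (use that(1) in simp)
  note wit = that
  show ?thesis
  proof (rule descent[of "words m N" "wval a" "wval b" \<nu>'])
    show "(\<Oplus>w\<in>words m N. \<nu>' w \<otimes> act s (wval a w)) = \<zero>" if s: "s \<in> carrier G" for s
    proof -
      obtain j where j: "j < m" "act s (a j) \<noteq> b j" using no[OF s] by blast
      have "(j, act s (a j)) \<in> set L" using j s by (auto simp: L(1) S_def orb_def)
      then have "linprod L (\<lambda>j. act s (a j)) = \<zero>"
        using linprod_eq_zero_iff[of L "\<lambda>j. act s (a j)"] Lc s a by force
      moreover have "(\<Oplus>w\<in>words m N. \<nu>' w \<otimes> act s (wval a w))
          = (\<Oplus>w\<in>words m N. \<nu>' w \<otimes> wval (\<lambda>j. act s (a j)) w)"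
        using act_wval[OF s] \<nu>' v[of _ "\<lambda>j. act s (a j)"] s a
        by (intro finsum_cong') (auto simp: words_def)
      ultimately show ?thesis using exp'[of "\<lambda>j. act s (a j)"] s a by simp
    qed
    have "linprod L b \<noteq> \<zero>"
      using linprod_eq_zero_iff[of L b] Lc b L(1) by (force simp: S_def)
    then show "(\<Oplus>w\<in>words m N. \<nu>' w \<otimes> wval b w) \<noteq> \<zero>" using exp' b by simp
    fix \<kappa> assume "\<And>w. w \<in> words m N \<Longrightarrow> \<kappa> w \<in> k" "(\<Oplus>w\<in>words m N. \<kappa> w \<otimes> wval a w) = \<zero>"
      "(\<Oplus>w\<in>words m N. \<kappa> w \<otimes> wval b w) \<noteq> \<zero>"
    then show thesis by (rule wit)
  qed (use a b v \<nu>' in auto)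
qed

end

section \<open>Automorphism groups of finite Galois extensions\<close>

text \<open>The points at which two homomorphisms agree form a subring, and this one contains
  \<open>k\<close> and the generators.\<close>

lemma (in ring) hom_eq_on_Span:
  assumes S: "ring S" and f: "f \<in> ring_hom R S" and g: "g \<in> ring_hom R S"
    and k: "k \<subseteq> carrier R" "\<And>x. x \<in> k \<Longrightarrow> f x = g x"
    and Us: "set Us \<subseteq> carrier R" "\<And>x. x \<in> set Us \<Longrightarrow> f x = g x"
    and x: "x \<in> Span k Us"
  shows "f x = g x"
proof -
  interpret f: ring_hom_ring R S f using ring_hom_ringI2[OF ring_axioms S f] .
  interpret g: ring_hom_ring R S g using ring_hom_ringI2[OF ring_axioms S g] .
  have "subring {x \<in> carrier R. f x = g x} R"
    by (rule subringI) (auto simp: f.hom_mult g.hom_mult f.hom_add g.hom_add)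
  then have "Span k Us \<subseteq> {x \<in> carrier R. f x = g x}"
    by (rule Span_incl_subring) (use k Us in auto)
  with x show ?thesis by blast
qed

context finite_galois_extension
begin

lemma field_auts_hom:
  assumes "g \<in> field_auts R k"
  shows "g \<in> ring_hom R R" "g \<in> extensional (carrier R)" "\<And>x. x \<in> k \<Longrightarrow> g x = x"
  using assms by (auto simp: field_auts_def Bij_def)

lemma finite_conjugates:
  assumes x: "x \<in> carrier R"
  shows "finite ((\<lambda>g. g x) ` field_auts R k)"
proof -
  obtain p where p: "p \<in> carrier (k[X])" "p \<noteq> []" "eval p x = \<zero>"
    using algebraicE[OF subfieldE(1)[OF k] x] alg[OF x] unfolding over_def by blast
  have pR: "p \<in> carrier (poly_ring R)"
    using p(1) carrier_polynomial_shell[OF subfieldE(1)[OF k]] by blast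
  have "is_root p (g x)" if g: "g \<in> field_auts R k" for g
  proof -
    interpret g: ring_hom_ring R R g using ring_hom_ringI2[OF is_ring is_ring field_auts_hom(1)[OF g]] .
    have "map g p = p"
      using p(1) polynomial_incl field_auts_hom(3)[OF g] unfolding univ_poly_carrier[symmetric]
      by (blast intro: map_idI)
    then have "eval p (g x) = g (eval p x)" using g.eval_hom[OF carrier_is_subring x pR] by simp
    then show ?thesis using p x by (simp add: is_root_def)
  qed
  then have "(\<lambda>g. g x) ` field_auts R k \<subseteq> {y. is_root p y}" by blast
  then show ?thesis using finite_number_of_roots[OF pR] by (rule finite_subset)
qed

text \<open>An automorphism over \<open>k\<close> is determined by the images of a finite spanning
  list, and each of these has only finitely many conjugates.\<close>

lemma finite_field_auts: "finite (field_auts R k)"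
proof -
  obtain Us where Us: "set Us \<subseteq> carrier R" "Span k Us = carrier R"
    using finite_dimension_imp_Span[OF k fd] .
  let ?A = "field_auts R k"
  have "inj_on (\<lambda>g. map g Us) ?A"
  proof (rule inj_onI)
    fix f g assume f: "f \<in> ?A" and g: "g \<in> ?A" and eq: "map f Us = map g Us"
    have "f x = g x" if "x \<in> carrier R" for x
    proof (rule hom_eq_on_Span[OF is_ring field_auts_hom(1)[OF f] field_auts_hom(1)[OF g]])
      show "f x = g x" if "x \<in> k" for x
        using field_auts_hom(3)[OF f that] field_auts_hom(3)[OF g that] by simp
      show "f x = g x" if "x \<in> set Us" for x using eq that by simp
    qed (use Us that subfieldE(3)[OF k] in auto)
    then show "f = g" using field_auts_hom(2) f g by (intro extensionalityI) auto
  qed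
  moreover have "(\<lambda>g. map g Us) ` ?A \<subseteq> {xs. set xs \<subseteq> (\<Union>u\<in>set Us. (\<lambda>g. g u) ` ?A) \<and> length xs = length Us}"
    by fastforce
  moreover have "finite {xs. set xs \<subseteq> (\<Union>u\<in>set Us. (\<lambda>g. g u) ` ?A) \<and> length xs = length Us}"
    by (rule finite_lists_length_eq) (use finite_conjugates Us(1) in auto)
  ultimately show ?thesis by (meson finite_imageD finite_subset)
qed

text \<open>The isomorphism only knows the restrictions of the \<open>act s\<close> to the carrier;
  accordingly, no clause of \<open>finite_galois_action\<close> looks outside of it.\<close>

lemma finite_galois_actionI:
  assumes G: "group G" and iso: "(\<lambda>s. restrict (act s) (carrier R)) \<in> iso G (AutGroup_over R k)"
  shows "finite_galois_action R G act k"
proof -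
  have carr: "carrier (AutGroup_over R k) = field_auts R k" by (simp add: AutGroup_over_def)
  let ?r = "\<lambda>s. restrict (act s) (carrier R)"
  have bij: "bij_betw ?r (carrier G) (field_auts R k)"
    and hom: "?r \<in> hom G (AutGroup_over R k)"
    using iso carr by (auto simp: iso_def)
  have r: "?r s \<in> field_auts R k" if "s \<in> carrier G" for s using bij that by (auto simp: bij_betw_def)
  have rB: "?r s \<in> Bij (carrier R)" if "s \<in> carrier G" for s using r[OF that] by (simp add: field_auts_def)
  show ?thesis
  proof (intro finite_galois_action.intro finite_galois_action_axioms.intro field_axioms)
    show "group G" by (rule G)
    show "finite (carrier G)" using bij finite_field_auts bij_betw_finite by blast
    show "act s \<in> ring_hom R R" if s: "s \<in> carrier G" for s
    proof (rule ring_hom_memI)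
      note h = field_auts_hom(1)[OF r[OF s]]
      fix x y assume x: "x \<in> carrier R" and y: "y \<in> carrier R"
      show "act s x \<in> carrier R" using ring_hom_closed[OF h x] x by simp
      show "act s (x \<otimes> y) = act s x \<otimes> act s y" "act s (x \<oplus> y) = act s x \<oplus> act s y"
        using ring_hom_mult[OF h x y] ring_hom_add[OF h x y] x y by simp_all
    next
      show "act s \<one> = \<one>" using ring_hom_one[OF field_auts_hom(1)[OF r[OF s]]] by simp
    qed
    show "act (s \<otimes>\<^bsub>G\<^esub> t) x = act s (act t x)"
      if s: "s \<in> carrier G" and t: "t \<in> carrier G" and x: "x \<in> carrier R" for s t x
    proof -
      have "?r (s \<otimes>\<^bsub>G\<^esub> t) = ?r s \<otimes>\<^bsub>AutGroup_over R k\<^esub> ?r t" using hom s t by (simp add: hom_def)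
      also have "\<dots> = compose (carrier R) (?r s) (?r t)"
        using rB s t by (simp add: AutGroup_over_def BijGroup_def)
      finally have "?r (s \<otimes>\<^bsub>G\<^esub> t) x = compose (carrier R) (?r s) (?r t) x" by simp
      moreover have "act t x \<in> carrier R" using funcset_mem[OF Bij_imp_funcset[OF rB[OF t]] x] x by simp
      ultimately show ?thesis using x by (simp add: compose_def)
    qed
    show "s = t" if "s \<in> carrier G" "t \<in> carrier G" "\<And>x. x \<in> carrier R \<Longrightarrow> act s x = act t x" for s t
    proof -
      have "?r s = ?r t" using that(3) by (intro restrict_ext) auto
      then show ?thesis using bij that(1,2) by (auto simp: bij_betw_def inj_on_def)
    qed
    show "subfield k R" by (rule k)
    show "act s x = x" if "s \<in> carrier G" "x \<in> k" for s x
      using field_auts_hom(3)[OF r[OF that(1)] that(2)] that(2) subfieldE(3)[OF k] by (auto split: if_splits)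
    show "x \<in> k" if x: "x \<in> carrier R" and fx: "\<And>s. s \<in> carrier G \<Longrightarrow> act s x = x" for x
    proof (rule galois_fixed_field[OF x])
      fix g assume "g \<in> field_auts R k"
      then obtain s where "s \<in> carrier G" "g = ?r s" using bij by (auto simp: bij_betw_def)
      then show "g x = x" using fx x by simp
    qed
  qed
qed

end

text \<open>Because of this trivial extension the Krull topology covers the whole automorphism group.\<close>

lemma galois_extension_refl:
  fixes L :: "'a ring"
  assumes L: "field L" and k: "subfield k L"
  shows "galois_extension (L\<lparr>carrier := k\<rparr>) k"
proof -
  interpret L: field L by (rule L)
  let ?k = "L\<lparr>carrier := k\<rparr>"
  interpret k: field ?k using L.subfield_iff(2)[OF k] .
  have sub: "subfield k ?k" using k.carrier_is_subfield by simp
  have alg: "k.algebraic k x" if "x \<in> k" for x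
    using k.algebraic_self[OF subfieldE(1)[OF sub]] that by (simp add: over_def)
  have "k.splitted p \<and> (\<forall>x\<in>carrier ?k. k.alg_mult p x \<le> 1)"
    if p: "p \<in> carrier (univ_poly ?k k)" "pirreducible\<^bsub>?k\<^esub> k p" "k.is_root p x" for p x
  proof -
    have pk: "p \<in> carrier (poly_ring ?k)" using p(1) by simp
    have "k.roots p \<noteq> {#}" using k.roots_mem_iff_is_root[OF pk] p(3) by auto
    \<comment> \<open>An irreducible polynomial with a root in its own coefficient field is
      linear.\<close>
    then have deg: "degree p = 1" using k.pirreducible_roots[OF pk] p(2) by auto
    have "k.alg_mult p x \<le> 1" for x
    proof -
      have "k.alg_mult p x = count (k.roots p) x" using k.alg_mult_eq_count_roots[OF pk] by simp
      also have "\<dots> \<le> size (k.roots p)" by (rule count_le_size)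
      also have "\<dots> \<le> 1" using k.size_roots_le_degree[OF pk] deg by simp
      finally show ?thesis .
    qed
    then show ?thesis using k.degree_one_imp_splitted[OF pk deg] by blast
  qed
  then show ?thesis
    using k.field_axioms sub alg unfolding galois_extension_def by auto
qed

lemma group_AutGroup_over:
  fixes L :: "'a ring"
  assumes L: "ring L" and k: "k \<subseteq> carrier L"
  shows "group (AutGroup_over L k)"
proof -
  interpret L: ring L by (rule L)
  have "subgroup (field_auts L k) (BijGroup (carrier L))"
  proof (rule group.subgroupI[OF group_BijGroup])
    show "field_auts L k \<subseteq> carrier (BijGroup (carrier L))" by (auto simp: field_auts_def BijGroup_def)
    have "(\<lambda>x\<in>carrier L. x) \<in> field_auts L k"
      using k id_Bij by (auto simp: field_auts_def intro!: ring_hom_memI)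
    then show "field_auts L k \<noteq> {}" by blast
  next
    fix f assume f: "f \<in> field_auts L k"
    have fB: "f \<in> Bij (carrier L)" and fh: "f \<in> ring_hom L L" and fk: "\<And>x. x \<in> k \<Longrightarrow> f x = x"
      using f by (auto simp: field_auts_def)
    let ?g = "\<lambda>x\<in>carrier L. inv_into (carrier L) f x"
    have inj: "inj_on f (carrier L)" and img: "f ` carrier L = carrier L"
      using fB by (auto simp: Bij_def bij_betw_def)
    have gc: "?g x \<in> carrier L" and fg: "f (?g x) = x" if x: "x \<in> carrier L" for x
    proof -
      have xi: "x \<in> f ` carrier L" using x unfolding img .
      show "?g x \<in> carrier L" "f (?g x) = x"
        using inv_into_into[OF xi] f_inv_into_f[OF xi] x by (simp_all only: restrict_apply' simp_thms)
    qed
    have uniq: "?g y = x" if x: "x \<in> carrier L" "f x = y" for x y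
    proof -
      have "y \<in> carrier L" using ring_hom_closed[OF fh x(1)] x(2) by simp
      then show ?thesis using inv_into_f_f[OF inj x(1)] x(2) by simp
    qed
    have "?g \<in> ring_hom L L"
    proof (rule ring_hom_memI)
      fix x y assume x: "x \<in> carrier L" and y: "y \<in> carrier L"
      show "?g x \<in> carrier L" by (rule gc[OF x])
      show "?g (x \<otimes>\<^bsub>L\<^esub> y) = ?g x \<otimes>\<^bsub>L\<^esub> ?g y"
        by (rule uniq[OF L.m_closed[OF gc[OF x] gc[OF y]]])
          (simp only: ring_hom_mult[OF fh gc[OF x] gc[OF y]] fg[OF x] fg[OF y])
      show "?g (x \<oplus>\<^bsub>L\<^esub> y) = ?g x \<oplus>\<^bsub>L\<^esub> ?g y"
        by (rule uniq[OF L.a_closed[OF gc[OF x] gc[OF y]]])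
          (simp only: ring_hom_add[OF fh gc[OF x] gc[OF y]] fg[OF x] fg[OF y])
    next
      show "?g \<one>\<^bsub>L\<^esub> = \<one>\<^bsub>L\<^esub>" by (rule uniq[OF L.one_closed ring_hom_one[OF fh]])
    qed
    moreover have "?g x = x" if "x \<in> k" for x by (rule uniq[OF subsetD[OF k that] fk[OF that]])
    ultimately have "?g \<in> field_auts L k"
      using restrict_inv_into_Bij[OF fB] unfolding field_auts_def by blast
    then show "inv\<^bsub>BijGroup (carrier L)\<^esub> f \<in> field_auts L k" by (simp only: inv_BijGroup[OF fB])
  next
    fix f g assume f: "f \<in> field_auts L k" and g: "g \<in> field_auts L k"
    have B: "f \<in> Bij (carrier L)" "g \<in> Bij (carrier L)" and h: "f \<in> ring_hom L L" "g \<in> ring_hom L L"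
      and fx: "\<And>x. x \<in> k \<Longrightarrow> f x = x" "\<And>x. x \<in> k \<Longrightarrow> g x = x"
      using f g by (auto simp: field_auts_def)
    have "compose (carrier L) f g \<in> ring_hom L L"
      by (rule ring_hom_memI)
        (auto simp: compose_def ring_hom_closed[OF h(1)] ring_hom_closed[OF h(2)] ring_hom_mult[OF h(1)]
          ring_hom_mult[OF h(2)] ring_hom_add[OF h(1)] ring_hom_add[OF h(2)] ring_hom_one[OF h(1)] ring_hom_one[OF h(2)])
    moreover have "compose (carrier L) f g x = x" if "x \<in> k" for x
      using that k fx by (auto simp: compose_def)
    ultimately show "f \<otimes>\<^bsub>BijGroup (carrier L)\<^esub> g \<in> field_auts L k"
      using B compose_Bij[OF B] by (simp add: BijGroup_def field_auts_def)
  qed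
  from group.subgroup_imp_group[OF group_BijGroup this] show ?thesis by (simp add: AutGroup_over_def)
qed

section \<open>Cohesive products of groups and fields\<close>

text \<open>Choice inside the product. The element obtained is the cast of the number found by the
  search, so it lies in \<open>A i\<close> although \<open>Q\<close> does not test
  membership.\<close>

lemma cp_search:
  assumes C: "cohesive C" and A: "uset A" and d: "uconst A d"
    and Q: "udec C (\<lambda>i z. Q i (cast A d i z))" and ex: "\<forall>\<^sub>F i in cofin C. \<exists>x\<in>A i. Q i x"
  obtains S where "S \<in> cp_carrier C A" "\<forall>\<^sub>F i in cofin C. Q i (val S i)"
proof -
  have "\<forall>\<^sub>F i in cofin C. \<exists>z. Q i (cast A d i z)"
    using ex by eventually_elim (metis cast_in)
  then obtain w where w: "ucomp C (\<lambda>_. UNIV) (\<lambda>i z. w i)" "\<forall>\<^sub>F i in cofin C. Q i (cast A d i (w i))"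
    using search(2)[OF C Q] by blast
  obtain S where S: "S \<in> cp_carrier C A" "\<forall>\<^sub>F i in cofin C. val S i = cast A d i (w i)"
    using cp_element[OF A ucomp_cast[OF A d w(1)]] by blast
  have "\<forall>\<^sub>F i in cofin C. Q i (val S i)" using S(2) w(2) by eventually_elim simp
  with S(1) show ?thesis by (rule that)
qed

lemma cp_map:
  assumes D: "uset D" and h: "uop1 A D h" and S: "S \<in> cp_carrier C A"
  shows "(\<Union>\<phi>\<in>S. cp_class C D (\<lambda>i. map_option (h i) (\<phi> i))) \<in> cp_carrier C D"
    and "\<forall>\<^sub>F i in cofin C. val (\<Union>\<phi>\<in>S. cp_class C D (\<lambda>i. map_option (h i) (\<phi> i))) i = h i (val S i)"
proof -
  obtain \<phi> where \<phi>: "S = cp_class C A \<phi>" "\<forall>\<^sub>F i in cofin C. \<phi> i = Some (val S i)" "\<phi> \<in> S"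
    using cp_carrierE[OF S] by metis
  obtain U where U: "U \<in> cp_carrier C D" "\<forall>\<^sub>F i in cofin C. val U i = h i (val S i)"
    using cp_element[OF D ucomp_op1[OF h ucomp_val[OF S]]] by blast
  obtain \<theta> where \<theta>: "U = cp_class C D \<theta>" "\<forall>\<^sub>F i in cofin C. \<theta> i = Some (val U i)"
    using cp_carrierE[OF U(1)] by metis
  have "cp_class C D (\<lambda>i. map_option (h i) (\<psi> i)) = U" if "\<psi> \<in> S" for \<psi>
    unfolding \<theta>(1)
  proof (rule cp_class_cong)
    have "\<forall>\<^sub>F i in cofin C. \<exists>x. \<phi> i = Some x \<and> \<psi> i = Some x"
      using that unfolding \<phi>(1) by (simp add: cp_class_def almost_subset_iff)
    then show "\<forall>\<^sub>F i in cofin C. \<exists>x. map_option (h i) (\<psi> i) = Some x \<and> \<theta> i = Some x"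
      using \<phi>(2) \<theta>(2) U(2) by eventually_elim auto
  qed
  then have "(\<Union>\<phi>\<in>S. cp_class C D (\<lambda>i. map_option (h i) (\<phi> i))) = U" using \<phi>(3) by blast
  then show "(\<Union>\<phi>\<in>S. cp_class C D (\<lambda>i. map_option (h i) (\<phi> i))) \<in> cp_carrier C D"
    "\<forall>\<^sub>F i in cofin C. val (\<Union>\<phi>\<in>S. cp_class C D (\<lambda>i. map_option (h i) (\<phi> i))) i = h i (val S i)"
    using U by auto
qed

lemma cp_op_assoc:
  assumes A: "uset A" and h: "uop2 A A A h"
    and x: "x \<in> cp_carrier C A" and y: "y \<in> cp_carrier C A" and z: "z \<in> cp_carrier C A"
    and assoc: "\<And>i a b c. a \<in> A i \<Longrightarrow> b \<in> A i \<Longrightarrow> c \<in> A i \<Longrightarrow> h i (h i a b) c = h i a (h i b c)"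
  shows "cp_op C A h (cp_op C A h x y) z = cp_op C A h x (cp_op C A h y z)"
proof -
  note xy = cp_op[OF A h x y] and yz = cp_op[OF A h y z]
  note l = cp_op[OF A h xy(1) z] and r = cp_op[OF A h x yz(1)]
  show ?thesis unfolding cp_eq_iff[OF l(1) r(1)]
    using xy(2) yz(2) l(2) r(2) val_in[OF x] val_in[OF y] val_in[OF z]
    by eventually_elim (simp add: assoc)
qed

lemma cp_op_comm:
  assumes A: "uset A" and h: "uop2 A A A h" and x: "x \<in> cp_carrier C A" and y: "y \<in> cp_carrier C A"
    and comm: "\<And>i a b. a \<in> A i \<Longrightarrow> b \<in> A i \<Longrightarrow> h i a b = h i b a"
  shows "cp_op C A h x y = cp_op C A h y x"
  unfolding cp_eq_iff[OF cp_op(1)[OF A h x y] cp_op(1)[OF A h y x]]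
  using cp_op(2)[OF A h x y] cp_op(2)[OF A h y x] val_in[OF x] val_in[OF y]
  by eventually_elim (simp add: comm)

lemma cp_op_unit:
  assumes A: "uset A" and h: "uop2 A A A h" and e: "uconst A e" and x: "x \<in> cp_carrier C A"
    and unit: "\<And>i a. a \<in> A i \<Longrightarrow> h i (e i) a = a"
  shows "cp_op C A h (cp_class C A (\<lambda>i. Some (e i))) x = x"
proof -
  note l = cp_op[OF A h cp_const(1)[OF A e] x]
  show ?thesis unfolding cp_eq_iff[OF l(1) x]
    using l(2) cp_const(2)[OF A e] val_in[OF x] by eventually_elim (simp add: unit)
qed

text \<open>Serves inverses in groups, negatives and reciprocals alike. A nonzero element may take
  the value zero at finitely many indices of \<open>C\<close>, so invertibility is required only at
  almost all of them.\<close>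

lemma cp_op_inverse:
  assumes C: "cohesive C" and A: "uset A" and h: "uop2 A A A h" and e: "uconst A e" and x: "x \<in> cp_carrier C A"
    and inv: "\<forall>\<^sub>F i in cofin C. \<exists>y\<in>A i. h i y (val x i) = e i"
  shows "\<exists>y\<in>cp_carrier C A. cp_op C A h y x = cp_class C A (\<lambda>i. Some (e i))"
proof -
  have "udec C (\<lambda>i z. h i (cast A e i z) (val x i) = e i)"
    by (intro udec_eq[OF ucomp_op2[OF h] ucomp_const[OF e]] ucomp_cast[OF A e ucomp_var] ucomp_val[OF x])
  from cp_search[OF C A e this inv] obtain y where
    y: "y \<in> cp_carrier C A" "\<forall>\<^sub>F i in cofin C. h i (val y i) (val x i) = e i" .
  note yx = cp_op[OF A h y(1) x] and ce = cp_const[OF A e]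
  have "cp_op C A h y x = cp_class C A (\<lambda>i. Some (e i))"
    unfolding cp_eq_iff[OF yx(1) ce(1)] using yx(2) y(2) ce(2) by eventually_elim simp
  with y(1) show ?thesis by blast
qed

section \<open>Cohesive products of groups\<close>

locale cp_groups =
  fixes C :: "nat set" and G :: "nat \<Rightarrow> nat monoid"
  assumes cohesive: "cohesive C" and groups: "\<And>i. group (G i)" and computable: "unif_computable_group G"
begin

lemma G_uset: "uset (\<lambda>i. carrier (G i))"
  using computable by (simp add: unif_computable_group_def uset_computable_set[symmetric])

lemma G_mult_uop2:
  "uop2 (\<lambda>i. carrier (G i)) (\<lambda>i. carrier (G i)) (\<lambda>i. carrier (G i)) (\<lambda>i x y. x \<otimes>\<^bsub>G i\<^esub> y)"
  using computable groups
  by (intro uop2_graph) (auto simp: unif_computable_group_def intro: monoid.m_closed group.is_monoid)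

lemma G_one_uconst: "uconst (\<lambda>i. carrier (G i)) (\<lambda>i. \<one>\<^bsub>G i\<^esub>)"
  using computable groups
  by (intro uconst_graph) (auto simp: unif_computable_group_def intro: monoid.one_closed group.is_monoid)

lemma cp_group_simps:
  "carrier (cp_group C G) = cp_carrier C (\<lambda>i. carrier (G i))"
  "x \<otimes>\<^bsub>cp_group C G\<^esub> y = cp_op C (\<lambda>i. carrier (G i)) (\<lambda>i x y. x \<otimes>\<^bsub>G i\<^esub> y) x y"
  "\<one>\<^bsub>cp_group C G\<^esub> = cp_class C (\<lambda>i. carrier (G i)) (\<lambda>i. Some \<one>\<^bsub>G i\<^esub>)"
  by (simp_all add: cp_group_def Let_def)

lemmas carrier_cp_group = cp_group_simps(1)

lemma cp_group_mult:
  assumes "S \<in> carrier (cp_group C G)" "T \<in> carrier (cp_group C G)"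
  shows "S \<otimes>\<^bsub>cp_group C G\<^esub> T \<in> carrier (cp_group C G)"
    and "\<forall>\<^sub>F i in cofin C. val (S \<otimes>\<^bsub>cp_group C G\<^esub> T) i = val S i \<otimes>\<^bsub>G i\<^esub> val T i"
  using cp_op[OF G_uset G_mult_uop2] assms by (simp_all add: cp_group_simps)

lemma cp_group_one:
  shows "\<one>\<^bsub>cp_group C G\<^esub> \<in> carrier (cp_group C G)"
    and "\<forall>\<^sub>F i in cofin C. val \<one>\<^bsub>cp_group C G\<^esub> i = \<one>\<^bsub>G i\<^esub>"
  using cp_const[OF G_uset G_one_uconst] by (simp_all add: cp_group_simps)

lemma cp_group_eqI:
  assumes "S \<in> carrier (cp_group C G)" "T \<in> carrier (cp_group C G)"
    and "\<forall>\<^sub>F i in cofin C. val S i = val T i"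
  shows "S = T"
  using cp_eq_iff assms unfolding carrier_cp_group by blast

lemma cp_group_val_in: "S \<in> carrier (cp_group C G) \<Longrightarrow> \<forall>\<^sub>F i in cofin C. val S i \<in> carrier (G i)"
  unfolding carrier_cp_group by (rule val_in)

lemma cp_group_group: "group (cp_group C G)"
proof (rule groupI; unfold cp_group_simps)
  note A = G_uset and h = G_mult_uop2 and e = G_one_uconst
  let ?P = "cp_carrier C (\<lambda>i. carrier (G i))"
  fix x y z assume x: "x \<in> ?P" and y: "y \<in> ?P" and z: "z \<in> ?P"
  let ?op = "cp_op C (\<lambda>i. carrier (G i)) (\<lambda>i. (\<otimes>\<^bsub>G i\<^esub>))"
  show "?op (?op x y) z = ?op x (?op y z)"
    by (rule cp_op_assoc[OF A h x y z]) (rule monoid.m_assoc[OF group.is_monoid[OF groups]])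
next
  note A = G_uset and h = G_mult_uop2 and e = G_one_uconst
  let ?P = "cp_carrier C (\<lambda>i. carrier (G i))" and ?e = "cp_class C (\<lambda>i. carrier (G i)) (\<lambda>i. Some \<one>\<^bsub>G i\<^esub>)"
  let ?op = "cp_op C (\<lambda>i. carrier (G i)) (\<lambda>i. (\<otimes>\<^bsub>G i\<^esub>))"
  fix x assume x: "x \<in> ?P"
  show "?op ?e x = x"
    by (rule cp_op_unit[OF A h e x]) (rule monoid.l_one[OF group.is_monoid[OF groups]])
  show "\<exists>y\<in>?P. ?op y x = ?e"
  proof (rule cp_op_inverse[OF cohesive A h e x])
    show "\<forall>\<^sub>F i in cofin C. \<exists>y\<in>carrier (G i). y \<otimes>\<^bsub>G i\<^esub> val x i = \<one>\<^bsub>G i\<^esub>"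
      using val_in[OF x] by eventually_elim (metis group.inv_closed group.l_inv groups)
  qed
qed (simp_all add: cp_op(1)[OF G_uset G_mult_uop2] cp_const(1)[OF G_uset G_one_uconst])

end

section \<open>Cohesive products of fields\<close>

locale cp_fields =
  fixes C :: "nat set" and K :: "nat \<Rightarrow> nat ring"
  assumes cohesive: "cohesive C" and fields: "\<And>i. field (K i)" and computable: "unif_computable_ring K"
begin

abbreviation "P \<equiv> cp_ring C K"

lemma K_cring: "cring (K i)"
  using fields by (simp add: field_def domain_def)

lemma K_ring: "ring (K i)"
  using K_cring by (rule cring.axioms)

lemma K_uset: "uset (\<lambda>i. carrier (K i))"
  using computable by (simp add: unif_computable_ring_def uset_computable_set[symmetric])

lemma K_mult_uop2:
  "uop2 (\<lambda>i. carrier (K i)) (\<lambda>i. carrier (K i)) (\<lambda>i. carrier (K i)) (\<lambda>i x y. x \<otimes>\<^bsub>K i\<^esub> y)"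
  using computable
  by (intro uop2_graph) (auto simp: unif_computable_ring_def ring.ring_simprules(5)[OF K_ring])

lemma K_add_uop2:
  "uop2 (\<lambda>i. carrier (K i)) (\<lambda>i. carrier (K i)) (\<lambda>i. carrier (K i)) (\<lambda>i x y. x \<oplus>\<^bsub>K i\<^esub> y)"
  using computable
  by (intro uop2_graph) (auto simp: unif_computable_ring_def ring.ring_simprules(1)[OF K_ring])

lemma K_one_uconst: "uconst (\<lambda>i. carrier (K i)) (\<lambda>i. \<one>\<^bsub>K i\<^esub>)"
  using computable
  by (intro uconst_graph) (auto simp: unif_computable_ring_def ring.ring_simprules(6)[OF K_ring])

lemma K_zero_uconst: "uconst (\<lambda>i. carrier (K i)) (\<lambda>i. \<zero>\<^bsub>K i\<^esub>)"
  using computable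
  by (intro uconst_graph) (auto simp: unif_computable_ring_def ring.ring_simprules(2)[OF K_ring])

lemma P_simps:
  "carrier P = cp_carrier C (\<lambda>i. carrier (K i))"
  "x \<otimes>\<^bsub>P\<^esub> y = cp_op C (\<lambda>i. carrier (K i)) (\<lambda>i x y. x \<otimes>\<^bsub>K i\<^esub> y) x y"
  "x \<oplus>\<^bsub>P\<^esub> y = cp_op C (\<lambda>i. carrier (K i)) (\<lambda>i x y. x \<oplus>\<^bsub>K i\<^esub> y) x y"
  "\<one>\<^bsub>P\<^esub> = cp_class C (\<lambda>i. carrier (K i)) (\<lambda>i. Some \<one>\<^bsub>K i\<^esub>)"
  "\<zero>\<^bsub>P\<^esub> = cp_class C (\<lambda>i. carrier (K i)) (\<lambda>i. Some \<zero>\<^bsub>K i\<^esub>)"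
  by (simp_all add: cp_ring_def Let_def)

lemmas carrier_P = P_simps(1)

lemma P_mult:
  assumes "S \<in> carrier P" "T \<in> carrier P"
  shows "S \<otimes>\<^bsub>P\<^esub> T \<in> carrier P"
    and "\<forall>\<^sub>F i in cofin C. val (S \<otimes>\<^bsub>P\<^esub> T) i = val S i \<otimes>\<^bsub>K i\<^esub> val T i"
  using cp_op[OF K_uset K_mult_uop2] assms by (simp_all add: P_simps)

lemma P_add:
  assumes "S \<in> carrier P" "T \<in> carrier P"
  shows "S \<oplus>\<^bsub>P\<^esub> T \<in> carrier P"
    and "\<forall>\<^sub>F i in cofin C. val (S \<oplus>\<^bsub>P\<^esub> T) i = val S i \<oplus>\<^bsub>K i\<^esub> val T i"
  using cp_op[OF K_uset K_add_uop2] assms by (simp_all add: P_simps)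

lemma P_one:
  shows "\<one>\<^bsub>P\<^esub> \<in> carrier P" and "\<forall>\<^sub>F i in cofin C. val \<one>\<^bsub>P\<^esub> i = \<one>\<^bsub>K i\<^esub>"
  using cp_const[OF K_uset K_one_uconst] by (simp_all add: P_simps)

lemma P_zero:
  shows "\<zero>\<^bsub>P\<^esub> \<in> carrier P" and "\<forall>\<^sub>F i in cofin C. val \<zero>\<^bsub>P\<^esub> i = \<zero>\<^bsub>K i\<^esub>"
  using cp_const[OF K_uset K_zero_uconst] by (simp_all add: P_simps)

lemma P_eqI:
  assumes "S \<in> carrier P" "T \<in> carrier P" "\<forall>\<^sub>F i in cofin C. val S i = val T i"
  shows "S = T"
  using cp_eq_iff assms unfolding carrier_P by blast

lemma P_val_in: "S \<in> carrier P \<Longrightarrow> \<forall>\<^sub>F i in cofin C. val S i \<in> carrier (K i)"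
  unfolding carrier_P by (rule val_in)

lemma P_ucomp: "S \<in> carrier P \<Longrightarrow> ucomp C (\<lambda>i. carrier (K i)) (\<lambda>i z. val S i)"
  unfolding carrier_P by (rule ucomp_val)

lemma P_eq_zero_iff: "S \<in> carrier P \<Longrightarrow> S = \<zero>\<^bsub>P\<^esub> \<longleftrightarrow> (\<forall>\<^sub>F i in cofin C. val S i = \<zero>\<^bsub>K i\<^esub>)"
proof
  assume S: "S \<in> carrier P" and zero: "\<forall>\<^sub>F i in cofin C. val S i = \<zero>\<^bsub>K i\<^esub>"
  have "\<forall>\<^sub>F i in cofin C. val S i = val \<zero>\<^bsub>P\<^esub> i" using zero P_zero(2) by eventually_elim simp
  then show "S = \<zero>\<^bsub>P\<^esub>" by (rule P_eqI[OF S P_zero(1)])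
qed (use P_zero in simp)

text \<open>Being zero is decidable, so by cohesiveness an element that is not zero almost
  everywhere is nonzero almost everywhere. This is what makes the product a field rather than a ring
  with zero divisors.\<close>

lemma P_nonzero:
  assumes S: "S \<in> carrier P" "S \<noteq> \<zero>\<^bsub>P\<^esub>"
  shows "\<forall>\<^sub>F i in cofin C. val S i \<noteq> \<zero>\<^bsub>K i\<^esub>"
proof -
  have "udec C (\<lambda>i z. val S i = \<zero>\<^bsub>K i\<^esub>)"
    by (rule udec_eq[OF P_ucomp[OF S(1)] ucomp_const[OF K_zero_uconst]])
  from search(1)[OF cohesive this] show ?thesis using P_eq_zero_iff S by simp
qed

lemma P_cring: "cring P"
proof (rule cringI)
  note A = K_uset
  note h = K_add_uop2 and e = K_zero_uconst and h' = K_mult_uop2 and e' = K_one_uconst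
  show "abelian_group P"
  proof (rule abelian_groupI)
    fix x y z assume "x \<in> carrier P" "y \<in> carrier P" "z \<in> carrier P"
    then show "x \<oplus>\<^bsub>P\<^esub> y \<oplus>\<^bsub>P\<^esub> z = x \<oplus>\<^bsub>P\<^esub> (y \<oplus>\<^bsub>P\<^esub> z)"
      unfolding P_simps by (rule cp_op_assoc[OF A h]) (rule ring.ring_simprules(7)[OF K_ring])
  next
    fix x y assume "x \<in> carrier P" "y \<in> carrier P"
    then show "x \<oplus>\<^bsub>P\<^esub> y = y \<oplus>\<^bsub>P\<^esub> x"
      unfolding P_simps by (rule cp_op_comm[OF A h]) (rule ring.ring_simprules(10)[OF K_ring])
  next
    fix x assume x: "x \<in> carrier P"
    then show "\<zero>\<^bsub>P\<^esub> \<oplus>\<^bsub>P\<^esub> x = x"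
      unfolding P_simps by (rule cp_op_unit[OF A h e]) (rule ring.ring_simprules(8)[OF K_ring])
    have "\<forall>\<^sub>F i in cofin C. \<exists>y\<in>carrier (K i). y \<oplus>\<^bsub>K i\<^esub> val x i = \<zero>\<^bsub>K i\<^esub>"
      using P_val_in[OF x] by eventually_elim (metis ring.ring_simprules(3,9)[OF K_ring])
    with x show "\<exists>y\<in>carrier P. y \<oplus>\<^bsub>P\<^esub> x = \<zero>\<^bsub>P\<^esub>"
      unfolding P_simps by (rule cp_op_inverse[OF cohesive A h e])
  qed (use P_add(1) P_zero(1) in auto)
  show "comm_monoid P"
  proof (rule comm_monoidI)
    fix x y z assume "x \<in> carrier P" "y \<in> carrier P" "z \<in> carrier P"
    then show "x \<otimes>\<^bsub>P\<^esub> y \<otimes>\<^bsub>P\<^esub> z = x \<otimes>\<^bsub>P\<^esub> (y \<otimes>\<^bsub>P\<^esub> z)"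
      unfolding P_simps by (rule cp_op_assoc[OF A h']) (rule ring.ring_simprules(11)[OF K_ring])
  next
    fix x y assume "x \<in> carrier P" "y \<in> carrier P"
    then show "x \<otimes>\<^bsub>P\<^esub> y = y \<otimes>\<^bsub>P\<^esub> x"
      unfolding P_simps by (rule cp_op_comm[OF A h']) (rule cring.cring_simprules(14)[OF K_cring])
  next
    fix x assume "x \<in> carrier P"
    then show "\<one>\<^bsub>P\<^esub> \<otimes>\<^bsub>P\<^esub> x = x"
      unfolding P_simps by (rule cp_op_unit[OF A h' e']) (rule cring.cring_simprules(12)[OF K_cring])
  qed (use P_mult(1) P_one(1) in auto)
  fix x y z assume x: "x \<in> carrier P" and y: "y \<in> carrier P" and z: "z \<in> carrier P"
  note xy = P_add[OF x y] and xz = P_mult[OF x z] and yz = P_mult[OF y z]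
  note l = P_mult[OF xy(1) z] and r = P_add[OF xz(1) yz(1)]
  show "(x \<oplus>\<^bsub>P\<^esub> y) \<otimes>\<^bsub>P\<^esub> z = x \<otimes>\<^bsub>P\<^esub> z \<oplus>\<^bsub>P\<^esub> y \<otimes>\<^bsub>P\<^esub> z"
  proof (rule P_eqI[OF l(1) r(1)])
    show "\<forall>\<^sub>F i in cofin C. val ((x \<oplus>\<^bsub>P\<^esub> y) \<otimes>\<^bsub>P\<^esub> z) i = val (x \<otimes>\<^bsub>P\<^esub> z \<oplus>\<^bsub>P\<^esub> y \<otimes>\<^bsub>P\<^esub> z) i"
      using xy(2) xz(2) yz(2) l(2) r(2) P_val_in[OF x] P_val_in[OF y] P_val_in[OF z]
      by eventually_elim (simp add: cring.cring_simprules(13)[OF K_cring])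
  qed
qed

lemma P_field: "field P"
proof (rule cring.cring_fieldI2[OF P_cring])
  interpret P: cring P by (rule P_cring)
  show "\<zero>\<^bsub>P\<^esub> \<noteq> \<one>\<^bsub>P\<^esub>"
  proof
    assume eq: "\<zero>\<^bsub>P\<^esub> = \<one>\<^bsub>P\<^esub>"
    have "\<forall>\<^sub>F i in cofin C. \<one>\<^bsub>K i\<^esub> = \<zero>\<^bsub>K i\<^esub>" using P_zero(2) P_one(2) unfolding eq by eventually_elim simp
    then have "\<forall>\<^sub>F i in cofin C. False" by eventually_elim (simp add: one_not_zero[OF fields])
    then show False using cofin_neq_bot cohesive unfolding cohesive_def trivial_limit_def by blast
  qed
  fix x assume x: "x \<in> carrier P" "x \<noteq> \<zero>\<^bsub>P\<^esub>"
  have "\<forall>\<^sub>F i in cofin C. \<exists>y\<in>carrier (K i). y \<otimes>\<^bsub>K i\<^esub> val x i = \<one>\<^bsub>K i\<^esub>"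
    using P_val_in[OF x(1)] P_nonzero[OF x]
  proof eventually_elim
    fix i assume x: "val x i \<in> carrier (K i)" "val x i \<noteq> \<zero>\<^bsub>K i\<^esub>"
    interpret field "K i" by (rule fields)
    show "\<exists>y\<in>carrier (K i). y \<otimes>\<^bsub>K i\<^esub> val x i = \<one>\<^bsub>K i\<^esub>"
      using x field_Units by (auto simp: Units_def)
  qed
  with x(1) have "\<exists>y\<in>carrier P. y \<otimes>\<^bsub>P\<^esub> x = \<one>\<^bsub>P\<^esub>"
    unfolding P_simps by (rule cp_op_inverse[OF cohesive K_uset K_mult_uop2 K_one_uconst])
  then show "\<exists>y\<in>carrier P. x \<otimes>\<^bsub>P\<^esub> y = \<one>\<^bsub>P\<^esub>" using P.m_comm x(1) by metis
qed

lemma P_finsum: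
  assumes "finite W" "\<And>w. w \<in> W \<Longrightarrow> f w \<in> carrier P"
  shows "\<forall>\<^sub>F i in cofin C. val (finsum P f W) i = finsum (K i) (\<lambda>w. val (f w) i) W"
  using assms
proof (induction W rule: finite_induct)
  case empty
  interpret P: field P by (rule P_field)
  show ?case
    using P_zero(2) by eventually_elim
      (simp add: abelian_monoid.finsum_empty[OF abelian_group.axioms(1)[OF ring.is_abelian_group[OF K_ring]]])
next
  case (insert w W)
  interpret P: field P by (rule P_field)
  have fw: "f w \<in> carrier P" "finsum P f W \<in> carrier P" using insert.prems by auto
  have eq: "finsum P f (insert w W) = f w \<oplus>\<^bsub>P\<^esub> finsum P f W"
    using insert by (intro P.finsum_insert) auto
  have "\<forall>\<^sub>F i in cofin C. val (finsum P f W) i = finsum (K i) (\<lambda>w. val (f w) i) W"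
    using insert by blast
  moreover have "\<forall>\<^sub>F i in cofin C. \<forall>v\<in>W. val (f v) i \<in> carrier (K i)"
    by (rule eventually_ball_finite[OF insert.hyps(1)]) (use insert.prems P_val_in in auto)
  ultimately show ?case
    unfolding eq using P_add(2)[OF fw] P_val_in[OF fw(1)]
  proof eventually_elim
    fix i assume h: "val (finsum P f W) i = finsum (K i) (\<lambda>w. val (f w) i) W"
      "\<forall>v\<in>W. val (f v) i \<in> carrier (K i)" "val (f w \<oplus>\<^bsub>P\<^esub> finsum P f W) i = val (f w) i \<oplus>\<^bsub>K i\<^esub> val (finsum P f W) i"
      "val (f w) i \<in> carrier (K i)"
    interpret K: field "K i" by (rule fields)
    show "val (f w \<oplus>\<^bsub>P\<^esub> finsum P f W) i = finsum (K i) (\<lambda>w. val (f w) i) (insert w W)"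
      using h insert.hyps by (subst K.finsum_insert) auto
  qed
qed

lemma P_nat_pow:
  assumes S: "S \<in> carrier P"
  shows "\<forall>\<^sub>F i in cofin C. val (S [^]\<^bsub>P\<^esub> (n::nat)) i = val S i [^]\<^bsub>K i\<^esub> n"
proof (induction n)
  case 0
  show ?case using P_one(2) by eventually_elim simp
next
  case (Suc n)
  interpret P: field P by (rule P_field)
  have "S [^]\<^bsub>P\<^esub> n \<in> carrier P" using S by simp
  from Suc P_mult(2)[OF this S] show ?case
    by eventually_elim (simp add: nat_pow_def)
qed

lemma P_wval:
  assumes x: "\<And>j. j < m \<Longrightarrow> x j \<in> carrier P" and w: "set w \<subseteq> {..<m}"
  shows "\<forall>\<^sub>F i in cofin C. val (ring.wval P x w) i = ring.wval (K i) (\<lambda>j. val (x j) i) w"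
  using w
proof (induction w)
  case Nil
  interpret P: field P by (rule P_field)
  show ?case using P_one(2) by eventually_elim (simp add: ring.wval_simps[OF K_ring])
next
  case (Cons j w)
  interpret P: field P by (rule P_field)
  have c: "x j \<in> carrier P" "P.wval x w \<in> carrier P"
    using x Cons.prems P.wval_closed[of m x w] by auto
  have "\<forall>\<^sub>F i in cofin C. val (P.wval x w) i = ring.wval (K i) (\<lambda>j. val (x j) i) w"
    using Cons by simp
  then show ?case
    unfolding P.wval_simps using P_mult(2)[OF c]
    by eventually_elim (simp add: ring.wval_simps[OF K_ring])
qed

lemma K_finsum_ucomp:
  assumes "finite W" "\<And>w. w \<in> W \<Longrightarrow> ucomp C (\<lambda>i. carrier (K i)) (\<lambda>i z. a w i z)"
  shows "ucomp C (\<lambda>i. carrier (K i)) (\<lambda>i z. finsum (K i) (\<lambda>w. a w i z) W)"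
  using assms
proof (induction W rule: finite_induct)
  case empty
  have "finsum (K i) (\<lambda>w. a w i z) {} = \<zero>\<^bsub>K i\<^esub>" for i z
    by (simp add: abelian_monoid.finsum_empty[OF abelian_group.axioms(1)[OF ring.is_abelian_group[OF K_ring]]])
  then show ?case using ucomp_const[OF K_zero_uconst] by simp
next
  case (insert w W)
  have "ucomp C (\<lambda>i. carrier (K i)) (\<lambda>i z. a w i z \<oplus>\<^bsub>K i\<^esub> finsum (K i) (\<lambda>w. a w i z) W)"
    using insert by (intro ucomp_op2[OF K_add_uop2]) auto
  \<comment> \<open>A sum over an inserted element unfolds only if all summands lie in the carrier,
    which is known at almost all indices only.\<close>
  moreover have "\<forall>\<^sub>F i in cofin C. \<forall>v\<in>insert w W. \<forall>z. a v i z \<in> carrier (K i)"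
    by (rule eventually_ball_finite) (use insert ucompD in auto)
  then have "\<forall>\<^sub>F i in cofin C. \<forall>z. a w i z \<oplus>\<^bsub>K i\<^esub> finsum (K i) (\<lambda>w. a w i z) W \<in> carrier (K i) \<longrightarrow>
    finsum (K i) (\<lambda>w. a w i z) (insert w W) = a w i z \<oplus>\<^bsub>K i\<^esub> finsum (K i) (\<lambda>w. a w i z) W \<and>
    finsum (K i) (\<lambda>w. a w i z) (insert w W) \<in> carrier (K i)"
  proof eventually_elim
    fix i assume h: "\<forall>v\<in>insert w W. \<forall>z. a v i z \<in> carrier (K i)"
    interpret K: field "K i" by (rule fields)
    show "\<forall>z. a w i z \<oplus>\<^bsub>K i\<^esub> finsum (K i) (\<lambda>w. a w i z) W \<in> carrier (K i) \<longrightarrow>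
      finsum (K i) (\<lambda>w. a w i z) (insert w W) = a w i z \<oplus>\<^bsub>K i\<^esub> finsum (K i) (\<lambda>w. a w i z) W \<and>
      finsum (K i) (\<lambda>w. a w i z) (insert w W) \<in> carrier (K i)"
    proof
      fix z
      have "finsum (K i) (\<lambda>w. a w i z) (insert w W) = a w i z \<oplus>\<^bsub>K i\<^esub> finsum (K i) (\<lambda>w. a w i z) W"
        using h insert.hyps by (intro K.finsum_insert) auto
      then show "a w i z \<oplus>\<^bsub>K i\<^esub> finsum (K i) (\<lambda>w. a w i z) W \<in> carrier (K i) \<longrightarrow>
        finsum (K i) (\<lambda>w. a w i z) (insert w W) = a w i z \<oplus>\<^bsub>K i\<^esub> finsum (K i) (\<lambda>w. a w i z) W \<and>
        finsum (K i) (\<lambda>w. a w i z) (insert w W) \<in> carrier (K i)" by simp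
    qed
  qed
  ultimately show ?case by (rule ucomp_mono)
qed

lemma K_nat_pow_ucomp:
  assumes "ucomp C (\<lambda>i. carrier (K i)) a"
  shows "ucomp C (\<lambda>i. carrier (K i)) (\<lambda>i z. a i z [^]\<^bsub>K i\<^esub> (n::nat))"
proof (induction n)
  case 0
  show ?case using ucomp_const[OF K_one_uconst] by simp
next
  case (Suc n)
  from ucomp_op2[OF K_mult_uop2 Suc assms] show ?case by (simp add: nat_pow_def)
qed

lemma K_wval_ucomp:
  assumes "\<And>j. j < m \<Longrightarrow> ucomp C (\<lambda>i. carrier (K i)) (\<lambda>i z. x j i z)" "set w \<subseteq> {..<m}"
  shows "ucomp C (\<lambda>i. carrier (K i)) (\<lambda>i z. ring.wval (K i) (\<lambda>j. x j i z) w)"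
  using assms(2)
proof (induction w)
  case Nil
  show ?case using ucomp_const[OF K_one_uconst] by (simp add: ring.wval_simps[OF K_ring])
next
  case (Cons j w)
  then have "ucomp C (\<lambda>i. carrier (K i)) (\<lambda>i z. x j i z \<otimes>\<^bsub>K i\<^esub> ring.wval (K i) (\<lambda>j. x j i z) w)"
    by (intro ucomp_op2[OF K_mult_uop2] assms(1)) auto
  then show ?case by (simp add: ring.wval_simps[OF K_ring])
qed

end

text \<open>Used both for the action of an element of the group product and for the embedding of the
  power of \<open>F\<close>. In the first case \<open>\<eta> i\<close> is a homomorphism only where
  \<open>val S i\<close> lies in \<open>G i\<close>, that is, at almost all indices.\<close>

lemma cp_ring_hom:
  assumes R: "cp_fields C R" and K: "cp_fields C K"
    and h: "\<And>x. x \<in> carrier (cp_ring C R) \<Longrightarrow> h x \<in> carrier (cp_ring C K)"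
      "\<And>x. x \<in> carrier (cp_ring C R) \<Longrightarrow> \<forall>\<^sub>F i in cofin C. val (h x) i = \<eta> i (val x i)"
    and \<eta>: "\<forall>\<^sub>F i in cofin C. \<eta> i \<in> ring_hom (R i) (K i)"
  shows "h \<in> ring_hom (cp_ring C R) (cp_ring C K)"
proof -
  interpret R: cp_fields C R by (rule R)
  interpret K: cp_fields C K by (rule K)
  show ?thesis
  proof (rule ring_hom_memI)
    fix x y assume x: "x \<in> carrier R.P" and y: "y \<in> carrier R.P"
    show "h x \<in> carrier K.P" by (rule h(1)[OF x])
    note xy = h(2)[OF x] h(2)[OF y] R.P_val_in[OF x] R.P_val_in[OF y]
    note m = R.P_mult[OF x y] and m' = K.P_mult[OF h(1)[OF x] h(1)[OF y]]
    show "h (x \<otimes>\<^bsub>R.P\<^esub> y) = h x \<otimes>\<^bsub>K.P\<^esub> h y"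
    proof (rule K.P_eqI[OF h(1)[OF m(1)] m'(1)])
      show "\<forall>\<^sub>F i in cofin C. val (h (x \<otimes>\<^bsub>R.P\<^esub> y)) i = val (h x \<otimes>\<^bsub>K.P\<^esub> h y) i"
        using \<eta> xy m(2) m'(2) h(2)[OF m(1)] by eventually_elim (simp add: ring_hom_mult)
    qed
    note a = R.P_add[OF x y] and a' = K.P_add[OF h(1)[OF x] h(1)[OF y]]
    show "h (x \<oplus>\<^bsub>R.P\<^esub> y) = h x \<oplus>\<^bsub>K.P\<^esub> h y"
    proof (rule K.P_eqI[OF h(1)[OF a(1)] a'(1)])
      show "\<forall>\<^sub>F i in cofin C. val (h (x \<oplus>\<^bsub>R.P\<^esub> y)) i = val (h x \<oplus>\<^bsub>K.P\<^esub> h y) i"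
        using \<eta> xy a(2) a'(2) h(2)[OF a(1)] by eventually_elim (simp add: ring_hom_add)
    qed
  next
    show "h \<one>\<^bsub>R.P\<^esub> = \<one>\<^bsub>K.P\<^esub>"
    proof (rule K.P_eqI[OF h(1)[OF R.P_one(1)] K.P_one(1)])
      show "\<forall>\<^sub>F i in cofin C. val (h \<one>\<^bsub>R.P\<^esub>) i = val \<one>\<^bsub>K.P\<^esub> i"
        using \<eta> h(2)[OF R.P_one(1)] R.P_one(2) K.P_one(2) by eventually_elim (simp add: ring_hom_one)
    qed
  qed
qed

section \<open>The action of the cohesive product of the Galois groups\<close>

context finite_galois_action
begin

definition stab :: "'a \<Rightarrow> 'g set" where
  "stab x = {s \<in> carrier G. act s x = x}"

lemma action_Bij:
  assumes s: "s \<in> carrier G"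
  shows "restrict (act s) (carrier R) \<in> Bij (carrier R)"
proof -
  have "bij_betw (act s) (carrier R) (carrier R)"
    by (rule bij_betw_byWitness[where f' = "act (inv\<^bsub>G\<^esub> s)"]) (use s act_inv in auto)
  then have "bij_betw (restrict (act s) (carrier R)) (carrier R) (carrier R)"
    by (subst bij_betw_cong[of _ _ "act s"]) simp_all
  then show ?thesis by (simp add: Bij_def)
qed

lemma group_action_act: "group_action G (carrier R) (\<lambda>s. restrict (act s) (carrier R))"
proof (intro group_action.intro group_hom.intro group_hom_axioms.intro G_group group_BijGroup homI)
  fix s assume s: "s \<in> carrier G"
  show "restrict (act s) (carrier R) \<in> carrier (BijGroup (carrier R))"
    using action_Bij[OF s] by (simp add: BijGroup_def)
  fix t assume t: "t \<in> carrier G"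
  have "restrict (act (s \<otimes>\<^bsub>G\<^esub> t)) (carrier R)
      = compose (carrier R) (restrict (act s) (carrier R)) (restrict (act t) (carrier R))"
    using act_mult[OF s t] t by (auto simp: compose_def fun_eq_iff)
  then show "restrict (act (s \<otimes>\<^bsub>G\<^esub> t)) (carrier R)
      = restrict (act s) (carrier R) \<otimes>\<^bsub>BijGroup (carrier R)\<^esub> restrict (act t) (carrier R)"
    using action_Bij[OF s] action_Bij[OF t] by (simp add: BijGroup_def)
qed

lemma stab_orb:
  assumes x: "x \<in> carrier R"
  shows "subgroup (stab x) G" and "card (orb x) * card (stab x) = order G"
proof -
  interpret A: group_action G "carrier R" "\<lambda>s. restrict (act s) (carrier R)" by (rule group_action_act)
  have s: "stabilizer G (\<lambda>s. restrict (act s) (carrier R)) x = stab x"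
    using x by (auto simp: stabilizer_def stab_def)
  have o: "orbit G (\<lambda>s. restrict (act s) (carrier R)) x = orb x"
    using x by (auto simp: orbit_def orb_def)
  show "subgroup (stab x) G" using A.stabilizer_subgroup[OF x] by (simp add: s)
  show "card (orb x) * card (stab x) = order G" using A.orbit_stabilizer_theorem[OF x] by (simp add: s o)
qed

lemma card_subgroup_pos: "subgroup H G \<Longrightarrow> card H > 0"
  by (metis G_fin card_gt_0_iff empty_iff finite_subset subgroup.one_closed subgroup.subset)

lemma card_rcosets_stab:
  assumes x: "x \<in> carrier R" shows "card (rcosets\<^bsub>G\<^esub> stab x) = card (orb x)"
  using stab_orb[OF x] G.lagrange[OF stab_orb(1)[OF x]] card_subgroup_pos[OF stab_orb(1)[OF x]]
  by (metis less_not_refl mult_right_cancel)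

lemma card_orb_pos: "x \<in> carrier R \<Longrightarrow> card (orb x) \<ge> 1"
  using G_fin by (simp add: Suc_le_eq card_gt_0_iff orb_def) (use G.one_closed in blast)

text \<open>\<open>H\<close> is contained in the stabilizer, whose index is the size of the
  orbit.\<close>

lemma card_orb_le_index:
  assumes x: "x \<in> carrier R" and H: "subgroup H G" and fx: "\<And>h. h \<in> H \<Longrightarrow> act h x = x"
  shows "card (orb x) \<le> card (rcosets\<^bsub>G\<^esub> H)"
proof -
  have sub: "H \<subseteq> stab x" using fx subgroup.subset[OF H] by (auto simp: stab_def)
  have "finite (stab x)" using G_fin by (simp add: stab_def)
  then have le: "card H \<le> card (stab x)" using sub by (rule card_mono)
  have "card (orb x) * card H \<le> card (orb x) * card (stab x)" using le by simp
  also have "\<dots> = card (rcosets\<^bsub>G\<^esub> H) * card H" using stab_orb(2)[OF x] G.lagrange[OF H] by simp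
  finally show ?thesis using card_subgroup_pos[OF H] by simp
qed

end

locale galois_sequence =
  fixes F :: "nat ring" and K :: "nat \<Rightarrow> nat ring" and \<Psi> :: "nat \<Rightarrow> nat \<Rightarrow> nat"
    and G :: "nat \<Rightarrow> nat monoid" and act :: "nat \<Rightarrow> nat \<Rightarrow> nat \<Rightarrow> nat" and C :: "nat set"
  assumes seq: "unif_computable_galois_sequence F K \<Psi> G act" and cohesive: "cohesive C"
begin

sublocale Gs: cp_groups C G
  using seq cohesive by (intro cp_groups.intro) (auto simp: unif_computable_galois_sequence_def)

sublocale Ks: cp_fields C K
  using seq cohesive by (intro cp_fields.intro) (auto simp: unif_computable_galois_sequence_def)

sublocale Fs: cp_fields C "\<lambda>_. F"
  using seq cohesive by (intro cp_fields.intro) (auto simp: unif_computable_galois_sequence_def)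

abbreviation "PG \<equiv> cp_group C G"
abbreviation "PK \<equiv> cp_ring C K"
abbreviation "PF \<equiv> cp_base C F K \<Psi>"
abbreviation "AlgK \<equiv> alg_part PK PF"
abbreviation "A \<equiv> cp_act C K act"

sublocale PG: group PG by (rule Gs.cp_group_group)
sublocale PK: field PK by (rule Ks.P_field)

lemma galois_ext: "finite_galois_extension (K i) (\<Psi> i ` carrier F)"
  using seq by (intro finite_galois_extension.intro finite_galois_extension_axioms.intro)
    (auto simp: unif_computable_galois_sequence_def)

lemma galois_act: "finite_galois_action (K i) (G i) (act i) (\<Psi> i ` carrier F)"
  using seq by (intro finite_galois_extension.finite_galois_actionI[OF galois_ext])
    (auto simp: unif_computable_galois_sequence_def)

lemma act_uop2: "uop2 (\<lambda>i. carrier (G i)) (\<lambda>i. carrier (K i)) (\<lambda>i. carrier (K i)) act"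
proof -
  obtain f where f: "partrec 3 f"
    "\<And>i s x. s \<in> carrier (G i) \<Longrightarrow> x \<in> carrier (K i) \<Longrightarrow> f [i, s, x] = Some (act i s x)"
    using seq unfolding unif_computable_galois_sequence_def unif_computable_action_def by metis
  show ?thesis unfolding uop2_def
    by (intro exI[of _ f] conjI pr_partrec f(1) allI ballI f(2) finite_galois_action.act_simps(1)[OF galois_act])
qed

lemma Psi_uop1: "uop1 (\<lambda>_. carrier F) (\<lambda>i. carrier (K i)) \<Psi>"
proof -
  obtain f where f: "partrec 2 f" "\<And>i x. x \<in> carrier F \<Longrightarrow> f [i, x] = Some (\<Psi> i x)"
    using seq unfolding unif_computable_galois_sequence_def unif_computable_map_def by metis
  have "\<Psi> i \<in> ring_hom F (K i)" for i using seq by (simp add: unif_computable_galois_sequence_def)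
  then show ?thesis unfolding uop1_def
    by (intro exI[of _ f] conjI pr_partrec f(1) allI ballI f(2)) (auto intro: ring_hom_closed)
qed

lemma Psi_hom: "\<Psi> i \<in> ring_hom F (K i)"
  using seq by (simp add: unif_computable_galois_sequence_def)

lemma A_val:
  assumes "S \<in> carrier PG" "U \<in> carrier PK"
  shows "A S U \<in> carrier PK" and "\<forall>\<^sub>F i in cofin C. val (A S U) i = act i (val S i) (val U i)"
  using cp_op[OF Ks.K_uset act_uop2] assms
  by (simp_all add: cp_act_def Gs.carrier_cp_group Ks.carrier_P)

lemma A_class:
  assumes "\<sigma> \<in> cp_dom C (\<lambda>i. carrier (G i))" "\<alpha> \<in> cp_dom C (\<lambda>i. carrier (K i))"
  shows "A (cp_class C (\<lambda>i. carrier (G i)) \<sigma>) (cp_class C (\<lambda>i. carrier (K i)) \<alpha>)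
    = cp_class C (\<lambda>i. carrier (K i)) (pointwise act \<sigma> \<alpha>)"
  unfolding cp_act_def by (rule cp_op_class[OF assms])

lemma A_hom:
  assumes S: "S \<in> carrier PG" shows "A S \<in> ring_hom PK PK"
proof (rule cp_ring_hom[where \<eta> = "\<lambda>i. act i (val S i)",
      OF Ks.cp_fields_axioms Ks.cp_fields_axioms A_val(1)[OF S] A_val(2)[OF S]])
  show "\<forall>\<^sub>F i in cofin C. act i (val S i) \<in> ring_hom (K i) (K i)"
    using Gs.cp_group_val_in[OF S] by eventually_elim (rule finite_galois_action.act_hom[OF galois_act])
qed

lemma A_mult:
  assumes S: "S \<in> carrier PG" and T: "T \<in> carrier PG" and U: "U \<in> carrier PK"
  shows "A (S \<otimes>\<^bsub>PG\<^esub> T) U = A S (A T U)"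
proof -
  note ST = Gs.cp_group_mult[OF S T] and TX = A_val[OF T U]
  note l = A_val[OF ST(1) U] and r = A_val[OF S TX(1)]
  show ?thesis
  proof (rule Ks.P_eqI[OF l(1) r(1)])
    show "\<forall>\<^sub>F i in cofin C. val (A (S \<otimes>\<^bsub>PG\<^esub> T) U) i = val (A S (A T U)) i"
      using Gs.cp_group_val_in[OF S] Gs.cp_group_val_in[OF T] Ks.P_val_in[OF U] ST(2) TX(2) l(2) r(2)
      by eventually_elim (simp add: finite_galois_action.act_mult[OF galois_act])
  qed
qed

lemma A_one:
  assumes U: "U \<in> carrier PK" shows "A \<one>\<^bsub>PG\<^esub> U = U"
proof -
  note l = A_val[OF Gs.cp_group_one(1) U]
  show ?thesis
  proof (rule Ks.P_eqI[OF l(1) U])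
    show "\<forall>\<^sub>F i in cofin C. val (A \<one>\<^bsub>PG\<^esub> U) i = val U i"
      using l(2) Gs.cp_group_one(2) Ks.P_val_in[OF U]
      by eventually_elim (simp add: finite_galois_action.act_one[OF galois_act])
  qed
qed

lemma not_eventually_False: "\<not> (\<forall>\<^sub>F i in cofin C. False)"
  using cofin_neq_bot cohesive unfolding cohesive_def trivial_limit_def by blast

text \<open>Different elements \<open>S\<close> and \<open>T\<close> differ at almost all indices,
  by cohesiveness. There, faithfulness of the factors provides points at which the two automorphisms
  differ, and a search assembles such points into an element of \<open>PK\<close>.\<close>

lemma A_faithful:
  assumes S: "S \<in> carrier PG" and T: "T \<in> carrier PG" and eq: "\<And>U. U \<in> carrier PK \<Longrightarrow> A S U = A T U"
  shows "S = T"
proof (rule ccontr)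
  assume "S \<noteq> T"
  have cS: "ucomp C (\<lambda>i. carrier (G i)) (\<lambda>i z. val S i)" and cT: "ucomp C (\<lambda>i. carrier (G i)) (\<lambda>i z. val T i)"
    using S T by (simp_all add: Gs.carrier_cp_group ucomp_val)
  have "udec C (\<lambda>i z. val S i = val T i)" by (rule udec_eq[OF cS cT])
  from search(1)[OF cohesive this] have ne: "\<forall>\<^sub>F i in cofin C. val S i \<noteq> val T i"
    using Gs.cp_group_eqI[OF S T] \<open>S \<noteq> T\<close> by auto
  obtain U where U: "U \<in> cp_carrier C (\<lambda>i. carrier (K i))"
    "\<forall>\<^sub>F i in cofin C. act i (val S i) (val U i) \<noteq> act i (val T i) (val U i)"
  proof (rule cp_search[OF cohesive Ks.K_uset Ks.K_zero_uconst])
    show "udec C (\<lambda>i z. act i (val S i) (cast (\<lambda>i. carrier (K i)) (\<lambda>i. \<zero>\<^bsub>K i\<^esub>) i z)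
      \<noteq> act i (val T i) (cast (\<lambda>i. carrier (K i)) (\<lambda>i. \<zero>\<^bsub>K i\<^esub>) i z))"
      by (intro udec_not udec_eq[OF ucomp_op2[OF act_uop2] ucomp_op2[OF act_uop2]] cS cT
          ucomp_cast[OF Ks.K_uset Ks.K_zero_uconst ucomp_var])
    show "\<forall>\<^sub>F i in cofin C. \<exists>x\<in>carrier (K i). act i (val S i) x \<noteq> act i (val T i) x"
      using ne Gs.cp_group_val_in[OF S] Gs.cp_group_val_in[OF T]
      by eventually_elim (metis finite_galois_action.act_faithful[OF galois_act])
  qed
  then have U': "U \<in> carrier PK" by (simp add: Ks.carrier_P)
  have "\<forall>\<^sub>F i in cofin C. False"
    using U(2) A_val(2)[OF S U'] A_val(2)[OF T U'] unfolding eq[OF U'] by eventually_elim simp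
  then show False using not_eventually_False by simp
qed

lemma embed_val:
  assumes "S \<in> carrier Fs.P"
  shows "cp_embed C K \<Psi> S \<in> carrier PK" and "\<forall>\<^sub>F i in cofin C. val (cp_embed C K \<Psi> S) i = \<Psi> i (val S i)"
  using cp_map[OF Ks.K_uset Psi_uop1] assms
  by (simp_all add: cp_embed_def Fs.carrier_P Ks.carrier_P)

lemma embed_hom: "cp_embed C K \<Psi> \<in> ring_hom Fs.P PK"
  by (rule cp_ring_hom[where \<eta> = \<Psi>, OF Fs.cp_fields_axioms Ks.cp_fields_axioms embed_val]) (simp_all add: Psi_hom)

lemma PF_subfield: "subfield PF PK"
proof -
  interpret Fs: field Fs.P by (rule Fs.P_field)
  interpret h: ring_hom_ring Fs.P PK "cp_embed C K \<Psi>"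
    using ring_hom_ringI2[OF Fs.is_ring PK.is_ring embed_hom] .
  show ?thesis unfolding cp_base_def
    by (rule h.img_is_subfield(2)[OF Fs.carrier_is_subfield PK.one_not_zero])
qed

lemma PF_val: "U \<in> PF \<Longrightarrow> \<forall>\<^sub>F i in cofin C. val U i \<in> \<Psi> i ` carrier F"
proof -
  assume "U \<in> PF"
  then obtain S where S: "S \<in> carrier Fs.P" "U = cp_embed C K \<Psi> S" by (auto simp: cp_base_def)
  show ?thesis unfolding S(2) using embed_val(2)[OF S(1)] Fs.P_val_in[OF S(1)] by eventually_elim simp
qed

lemma PF_carrier: "PF \<subseteq> carrier PK"
  by (rule subfieldE(3)[OF PF_subfield])

lemma A_PF:
  assumes S: "S \<in> carrier PG" and U: "U \<in> PF" shows "A S U = U"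
proof -
  have U': "U \<in> carrier PK" using U PF_carrier by blast
  note l = A_val[OF S U']
  show ?thesis
  proof (rule Ks.P_eqI[OF l(1) U'])
    show "\<forall>\<^sub>F i in cofin C. val (A S U) i = val U i"
      using l(2) Gs.cp_group_val_in[OF S] PF_val[OF U]
      by eventually_elim (simp add: finite_galois_action.act_k[OF galois_act])
  qed
qed

text \<open>Stated for an invariant \<open>D\<close>, to be applied to the whole product and to its
  algebraic part. Invariance under the inverse of \<open>S\<close> makes the restriction
  bijective.\<close>

lemma A_restrict_hom:
  assumes D: "PF \<subseteq> D" "D \<subseteq> carrier PK" and L: "L = PK\<lparr>carrier := D\<rparr>" and ring: "ring L"
    and closed: "\<And>S U. S \<in> carrier PG \<Longrightarrow> U \<in> D \<Longrightarrow> A S U \<in> D"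
  shows "(\<lambda>S. restrict (A S) D) \<in> hom PG (AutGroup_over L PF)"
proof -
  have Bij: "restrict (A S) D \<in> Bij D" if S: "S \<in> carrier PG" for S
  proof -
    have "bij_betw (A S) D D"
    proof (rule bij_betw_byWitness[where f' = "A (inv\<^bsub>PG\<^esub> S)"])
      show "\<forall>U\<in>D. A (inv\<^bsub>PG\<^esub> S) (A S U) = U" "\<forall>U\<in>D. A S (A (inv\<^bsub>PG\<^esub> S) U) = U"
        using A_mult[of "inv\<^bsub>PG\<^esub> S" S] A_mult[of S "inv\<^bsub>PG\<^esub> S"] A_one D(2) S by auto
    qed (use closed S in auto)
    then have "bij_betw (restrict (A S) D) D D"
      by (subst bij_betw_cong[of _ _ "A S"]) simp_all
    then show ?thesis by (simp add: Bij_def)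
  qed
  interpret L: ring L by (rule ring)
  have rh: "restrict (A S) D \<in> ring_hom L L" if S: "S \<in> carrier PG" for S
  proof (rule ring_hom_memI)
    fix U Y assume XY: "U \<in> carrier L" "Y \<in> carrier L"
    then have XD: "U \<in> D" "Y \<in> D" "U \<in> carrier PK" "Y \<in> carrier PK" using L D by auto
    show "restrict (A S) D U \<in> carrier L" using closed[OF S] XD L by simp
    have "U \<otimes>\<^bsub>L\<^esub> Y \<in> D" "U \<oplus>\<^bsub>L\<^esub> Y \<in> D" using L.m_closed[OF XY] L.a_closed[OF XY] L by auto
    then show "restrict (A S) D (U \<otimes>\<^bsub>L\<^esub> Y) = restrict (A S) D U \<otimes>\<^bsub>L\<^esub> restrict (A S) D Y"
      "restrict (A S) D (U \<oplus>\<^bsub>L\<^esub> Y) = restrict (A S) D U \<oplus>\<^bsub>L\<^esub> restrict (A S) D Y"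
      using XD L ring_hom_mult[OF A_hom[OF S]] ring_hom_add[OF A_hom[OF S]] by auto
  next
    have "\<one>\<^bsub>L\<^esub> \<in> D" using L.one_closed L by auto
    then show "restrict (A S) D \<one>\<^bsub>L\<^esub> = \<one>\<^bsub>L\<^esub>" using L ring_hom_one[OF A_hom[OF S]] by auto
  qed
  have cL: "carrier L = D" using L by simp
  have aut: "restrict (A S) D \<in> field_auts L PF" if S: "S \<in> carrier PG" for S
    using Bij[OF S] rh[OF S] A_PF[OF S] D(1) by (auto simp: field_auts_def cL)
  show ?thesis
  proof (rule homI)
    fix S assume S: "S \<in> carrier PG"
    show "restrict (A S) D \<in> carrier (AutGroup_over L PF)" using aut[OF S] by (simp add: AutGroup_over_def)
    fix T assume T: "T \<in> carrier PG"
    have "restrict (A (S \<otimes>\<^bsub>PG\<^esub> T)) D = compose D (restrict (A S) D) (restrict (A T) D)"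
      using A_mult[OF S T] closed[OF T] D(2) by (auto simp: compose_def fun_eq_iff)
    then show "restrict (A (S \<otimes>\<^bsub>PG\<^esub> T)) D
      = restrict (A S) D \<otimes>\<^bsub>AutGroup_over L PF\<^esub> restrict (A T) D"
      using Bij[OF S] Bij[OF T] by (simp add: AutGroup_over_def BijGroup_def cL)
  qed
qed

text \<open>A search for coefficients from \<open>F\<close> and a point of \<open>K i\<close> at
  once. It either fails at almost all indices or produces coefficients in \<open>PF\<close> and a
  point of \<open>PK\<close>. \<open>Q\<close> receives the coefficients as functions restricted to
  \<open>W\<close>, so that finitely many pointwise equalities give equality of its
  arguments.\<close>

lemma base_search:
  fixes W :: "'w set"
  assumes W: "finite W"
    and Q: "\<And>c x. (\<And>w. w \<in> W \<Longrightarrow> ucomp C (\<lambda>i. carrier (K i)) (\<lambda>i z. c w i z)) \<Longrightarrow>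
      ucomp C (\<lambda>i. carrier (K i)) x \<Longrightarrow> udec C (\<lambda>i z. Q i (\<lambda>w\<in>W. c w i z) (x i z))"
  shows "(\<forall>\<^sub>F i in cofin C. \<forall>\<kappa> x. (\<forall>w\<in>W. \<kappa> w \<in> \<Psi> i ` carrier F) \<longrightarrow> x \<in> carrier (K i) \<longrightarrow>
       \<not> Q i (\<lambda>w\<in>W. \<kappa> w) x) \<or>
    (\<exists>B U. (\<forall>w\<in>W. B w \<in> PF) \<and> U \<in> carrier PK \<and> (\<forall>\<^sub>F i in cofin C. Q i (\<lambda>w\<in>W. val (B w) i) (val U i)))"
proof -
  \<comment> \<open>One number \<open>z\<close> codes all unknowns: coordinate 0 is the point, and
    coordinate \<open>Suc (idx w)\<close> is an element of \<open>F\<close> whose image is the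
    coefficient at \<open>w\<close>.\<close>
  obtain idx :: "'w \<Rightarrow> nat" and n where idx: "idx ` W = {i. i < n}" "inj_on idx W"
    using finite_imp_inj_to_nat_seg[OF W] by metis
  define t where "t w i z = cast (\<lambda>_. carrier F) (\<lambda>_. \<zero>\<^bsub>F\<^esub>) i (dec (Suc (idx w)) z)" for w i z
  define c where "c w i z = \<Psi> i (t w i z)" for w i z
  define x where "x i z = cast (\<lambda>i. carrier (K i)) (\<lambda>i. \<zero>\<^bsub>K i\<^esub>) i (dec 0 z)" for i z
  have t: "ucomp C (\<lambda>_. carrier F) (\<lambda>i z. t w i z)" for w
    unfolding t_def by (rule ucomp_cast[OF Fs.K_uset Fs.K_zero_uconst ucomp_dec])
  have c: "ucomp C (\<lambda>i. carrier (K i)) (\<lambda>i z. c w i z)" for w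
    unfolding c_def by (rule ucomp_op1[OF Psi_uop1 t])
  have x: "ucomp C (\<lambda>i. carrier (K i)) x"
    unfolding x_def by (rule ucomp_cast[OF Ks.K_uset Ks.K_zero_uconst ucomp_dec])
  have dec: "udec C (\<lambda>i z. Q i (\<lambda>w\<in>W. c w i z) (x i z))" by (rule Q[OF c x])
  \<comment> \<open>\<open>dec\<close> is onto and \<open>cast\<close> is the identity on genuine
    elements, so no solution is missed; this justifies the negative alternative.\<close>
  have surj: "\<exists>z. (\<lambda>w\<in>W. c w i z) = (\<lambda>w\<in>W. \<kappa> w) \<and> x i z = y"
    if \<kappa>: "\<forall>w\<in>W. \<kappa> w \<in> \<Psi> i ` carrier F" and y: "y \<in> carrier (K i)" for i \<kappa> y
  proof -
    have "\<forall>w\<in>W. \<exists>u. u \<in> carrier F \<and> \<kappa> w = \<Psi> i u" using \<kappa> by blast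
    then obtain u where u: "\<And>w. w \<in> W \<Longrightarrow> u w \<in> carrier F \<and> \<kappa> w = \<Psi> i (u w)" by metis
    obtain z where z: "\<forall>j<Suc n. dec j z = (case j of 0 \<Rightarrow> y | Suc j \<Rightarrow> u (inv_into W idx j))"
      using dec_surj[of "Suc n" "\<lambda>j. case j of 0 \<Rightarrow> y | Suc j \<Rightarrow> u (inv_into W idx j)"] by blast
    have "dec (Suc (idx w)) z = u w" if w: "w \<in> W" for w
    proof -
      have "idx w < n" using idx(1) w by blast
      then have "dec (Suc (idx w)) z = u (inv_into W idx (idx w))" using z by (metis Suc_less_eq nat.case(2))
      then show ?thesis using inv_into_f_f[OF idx(2) w] by simp
    qed
    then have "c w i z = \<kappa> w" if "w \<in> W" for w
      unfolding c_def t_def using u[OF that] that by (simp add: cast_in del: dec.simps)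
    moreover have "dec 0 z = y" using z by (metis nat.case(1) zero_less_Suc)
    then have "x i z = y" unfolding x_def using y by (simp add: cast_in del: dec.simps)
    ultimately show ?thesis by (intro exI[of _ z] conjI restrict_ext) auto
  qed
  from search(1)[OF cohesive dec] show ?thesis
  proof
    assume "\<forall>\<^sub>F i in cofin C. \<forall>z. \<not> Q i (\<lambda>w\<in>W. c w i z) (x i z)"
    then show ?thesis
      by (intro disjI1) (erule eventually_mono, metis surj)
  next
    assume "\<forall>\<^sub>F i in cofin C. \<exists>z. Q i (\<lambda>w\<in>W. c w i z) (x i z)"
    from search(2)[OF cohesive dec this] obtain v where v: "ucomp C (\<lambda>_. UNIV) (\<lambda>i z. v i)"
      "\<forall>\<^sub>F i in cofin C. Q i (\<lambda>w\<in>W. c w i (v i)) (x i (v i))" by blast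
    obtain U where U: "U \<in> cp_carrier C (\<lambda>i. carrier (K i))" "\<forall>\<^sub>F i in cofin C. val U i = x i (v i)"
      using cp_element[OF Ks.K_uset ucomp_subst[OF x v(1)]] by blast
    have "\<exists>S. S \<in> cp_carrier C (\<lambda>_. carrier F) \<and> (\<forall>\<^sub>F i in cofin C. val S i = t w i (v i))" for w
      using cp_element[OF Fs.K_uset ucomp_subst[OF t v(1)]] by metis
    then obtain S where S: "\<And>w. S w \<in> carrier Fs.P" "\<And>w. \<forall>\<^sub>F i in cofin C. val (S w) i = t w i (v i)"
      unfolding Fs.carrier_P by metis
    define B where "B w = cp_embed C K \<Psi> (S w)" for w
    have Bc: "\<forall>\<^sub>F i in cofin C. val (B w) i = c w i (v i)" for w
      using embed_val(2)[OF S(1)[of w]] S(2)[of w] by eventually_elim (simp add: B_def c_def)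
    have "\<forall>\<^sub>F i in cofin C. \<forall>w\<in>W. val (B w) i = c w i (v i)"
      by (rule eventually_ball_finite[OF W]) (use Bc in blast)
    then have "\<forall>\<^sub>F i in cofin C. Q i (\<lambda>w\<in>W. val (B w) i) (val U i)"
      using v(2) U(2)
    proof eventually_elim
      fix i assume h: "\<forall>w\<in>W. val (B w) i = c w i (v i)" "Q i (\<lambda>w\<in>W. c w i (v i)) (x i (v i))" "val U i = x i (v i)"
      have "(\<lambda>w\<in>W. val (B w) i) = (\<lambda>w\<in>W. c w i (v i))" using h(1) by (intro restrict_ext) auto
      then show "Q i (\<lambda>w\<in>W. val (B w) i) (val U i)" using h by simp
    qed
    moreover have "B w \<in> PF" for w using S(1) by (simp add: B_def cp_base_def)
    ultimately show ?thesis using U(1) unfolding Ks.carrier_P[symmetric] by blast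
  qed
qed

end

section \<open>The algebraic part\<close>

context galois_sequence
begin

lemma AlgK_carrier: "carrier AlgK = {U \<in> carrier PK. PK.algebraic PF U}"
  by (simp add: alg_part_def)

lemma AlgK_eq: "AlgK = PK\<lparr>carrier := carrier AlgK\<rparr>"
  by (simp add: alg_part_def)

lemma AlgK_subfield: "subfield (carrier AlgK) PK"
  using PK.subfield_of_algebraics[OF PF_subfield] by (simp add: AlgK_carrier over_def)

lemma AlgK_field: "field AlgK"
  using PK.subfield_iff(2)[OF AlgK_subfield] AlgK_eq by simp

lemma AlgK_sub: "carrier AlgK \<subseteq> carrier PK"
  by (auto simp: AlgK_carrier)

lemma PF_AlgK: "PF \<subseteq> carrier AlgK"
  using PK.algebraic_self[OF subfieldE(1)[OF PF_subfield]] PF_carrier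
  by (auto simp: AlgK_carrier over_def)

lemma AlgK_simps:
  "x \<otimes>\<^bsub>AlgK\<^esub> y = x \<otimes>\<^bsub>PK\<^esub> y" "x \<oplus>\<^bsub>AlgK\<^esub> y = x \<oplus>\<^bsub>PK\<^esub> y"
  "\<one>\<^bsub>AlgK\<^esub> = \<one>\<^bsub>PK\<^esub>" "\<zero>\<^bsub>AlgK\<^esub> = \<zero>\<^bsub>PK\<^esub>"
  by (simp_all add: alg_part_def)

lemma PF_subfield_AlgK: "subfield PF AlgK"
proof -
  interpret AlgK: field AlgK by (rule AlgK_field)
  have "AlgK\<lparr>carrier := PF\<rparr> = PK\<lparr>carrier := PF\<rparr>" by (simp add: alg_part_def)
  then have "field (AlgK\<lparr>carrier := PF\<rparr>)" using PK.subfield_iff(2)[OF PF_subfield] by simp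
  then show ?thesis using AlgK.subfield_iff(1) PF_AlgK by blast
qed

lemma AlgK_iff:
  "U \<in> carrier AlgK \<longleftrightarrow> U \<in> carrier PK \<and> (\<exists>(n::nat) l. (\<forall>e\<le>n. l e \<in> PF) \<and> l n \<noteq> \<zero>\<^bsub>PK\<^esub> \<and>
     (\<Oplus>\<^bsub>PK\<^esub>e\<in>{..n}. l e \<otimes>\<^bsub>PK\<^esub> U [^]\<^bsub>PK\<^esub> e) = \<zero>\<^bsub>PK\<^esub>)"
  using PK.algebraic_iff_finsum[OF PF_subfield] by (auto simp: AlgK_carrier)

text \<open>\<open>A S\<close> fixes \<open>PF\<close>, so it carries a polynomial relation of
  \<open>U\<close> over \<open>PF\<close> to the same relation of \<open>A S U\<close>.\<close>

lemma A_AlgK: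
  assumes S: "S \<in> carrier PG" and U: "U \<in> carrier AlgK" shows "A S U \<in> carrier AlgK"
proof -
  have UK: "U \<in> carrier PK" using U AlgK_sub by blast
  interpret h: ring_hom_ring PK PK "A S"
    using ring_hom_ringI2[OF PK.is_ring PK.is_ring A_hom[OF S]] .
  interpret h: ring_hom_cring PK PK "A S"
    using PK.cring_axioms h.homh by (intro ring_hom_cring.intro) (auto simp: ring_hom_cring_axioms_def)
  obtain n :: nat and l where l: "\<forall>e\<le>n. l e \<in> PF" "l n \<noteq> \<zero>\<^bsub>PK\<^esub>"
    "(\<Oplus>\<^bsub>PK\<^esub>e\<in>{..n}. l e \<otimes>\<^bsub>PK\<^esub> U [^]\<^bsub>PK\<^esub> e) = \<zero>\<^bsub>PK\<^esub>"
    using U unfolding AlgK_iff by auto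
  have lK: "l e \<in> carrier PK" if "e \<le> n" for e using l(1) that PF_carrier by blast
  have "(\<Oplus>\<^bsub>PK\<^esub>e\<in>{..n}. l e \<otimes>\<^bsub>PK\<^esub> A S U [^]\<^bsub>PK\<^esub> e) = (\<Oplus>\<^bsub>PK\<^esub>e\<in>{..n}. A S (l e \<otimes>\<^bsub>PK\<^esub> U [^]\<^bsub>PK\<^esub> e))"
    using lK l(1) UK A_PF[OF S] by (intro PK.finsum_cong') (auto simp: h.hom_nat_pow)
  also have "\<dots> = A S (\<Oplus>\<^bsub>PK\<^esub>e\<in>{..n}. l e \<otimes>\<^bsub>PK\<^esub> U [^]\<^bsub>PK\<^esub> e)"
    using lK UK by (subst h.hom_finsum) (auto simp: comp_def)
  also have "\<dots> = \<zero>\<^bsub>PK\<^esub>" unfolding l(3) by simp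
  finally show ?thesis unfolding AlgK_iff using l(1,2) h.hom_closed[OF UK] by blast
qed

text \<open>\<open>V\<close> allows the value of \<open>v w\<close> to be given by its own formula
  in \<open>K i\<close>, a power or a word. The restricted coefficients on the right are in the
  shape in which \<open>base_search\<close> passes them.\<close>

lemma P_lincomb:
  assumes W: "finite W" and B: "\<And>w. w \<in> W \<Longrightarrow> B w \<in> carrier PK" and v: "\<And>w. w \<in> W \<Longrightarrow> v w \<in> carrier PK"
    and V: "\<And>w. w \<in> W \<Longrightarrow> \<forall>\<^sub>F i in cofin C. val (v w) i = V w i"
  shows "\<forall>\<^sub>F i in cofin C. val (\<Oplus>\<^bsub>PK\<^esub>w\<in>W. B w \<otimes>\<^bsub>PK\<^esub> v w) i
    = (\<Oplus>\<^bsub>K i\<^esub>w\<in>W. (\<lambda>w\<in>W. val (B w) i) w \<otimes>\<^bsub>K i\<^esub> V w i)"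
proof -
  have "\<forall>\<^sub>F i in cofin C. val (B w \<otimes>\<^bsub>PK\<^esub> v w) i = val (B w) i \<otimes>\<^bsub>K i\<^esub> V w i \<and>
    val (B w) i \<in> carrier (K i) \<and> V w i \<in> carrier (K i)" if w: "w \<in> W" for w
    using Ks.P_mult(2)[OF B[OF w] v[OF w]] V[OF w] Ks.P_val_in[OF B[OF w]] Ks.P_val_in[OF v[OF w]]
    by eventually_elim simp
  then have "\<forall>\<^sub>F i in cofin C. \<forall>w\<in>W. val (B w \<otimes>\<^bsub>PK\<^esub> v w) i = val (B w) i \<otimes>\<^bsub>K i\<^esub> V w i \<and>
    val (B w) i \<in> carrier (K i) \<and> V w i \<in> carrier (K i)"
    by (intro eventually_ball_finite[OF W]) blast
  moreover have "\<forall>\<^sub>F i in cofin C. val (\<Oplus>\<^bsub>PK\<^esub>w\<in>W. B w \<otimes>\<^bsub>PK\<^esub> v w) i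
    = (\<Oplus>\<^bsub>K i\<^esub>w\<in>W. val (B w \<otimes>\<^bsub>PK\<^esub> v w) i)"
    by (rule Ks.P_finsum[OF W]) (use B v in simp)
  ultimately show ?thesis
  proof eventually_elim
    fix i assume h: "\<forall>w\<in>W. val (B w \<otimes>\<^bsub>PK\<^esub> v w) i = val (B w) i \<otimes>\<^bsub>K i\<^esub> V w i \<and>
      val (B w) i \<in> carrier (K i) \<and> V w i \<in> carrier (K i)"
      "val (\<Oplus>\<^bsub>PK\<^esub>w\<in>W. B w \<otimes>\<^bsub>PK\<^esub> v w) i = (\<Oplus>\<^bsub>K i\<^esub>w\<in>W. val (B w \<otimes>\<^bsub>PK\<^esub> v w) i)"
    interpret K: field "K i" by (rule Ks.fields)
    show "val (\<Oplus>\<^bsub>PK\<^esub>w\<in>W. B w \<otimes>\<^bsub>PK\<^esub> v w) i = (\<Oplus>\<^bsub>K i\<^esub>w\<in>W. (\<lambda>w\<in>W. val (B w) i) w \<otimes>\<^bsub>K i\<^esub> V w i)"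
      unfolding h(2) using h(1) by (intro K.finsum_cong') auto
  qed
qed

abbreviation "orb_at i \<equiv> finite_galois_action.orb (G i) (act i)"

text \<open>At almost all indices, the relation of \<open>U\<close> over \<open>PF\<close> becomes a
  relation of \<open>val U i\<close> over the image of \<open>F\<close>, of the same degree and with
  nonzero leading coefficient. The degree bounds the number of conjugates.\<close>

lemma AlgK_orbits_bounded:
  assumes U: "U \<in> carrier AlgK"
  shows "\<exists>n. \<forall>\<^sub>F i in cofin C. card (orb_at i (val U i)) \<le> n"
proof -
  have UK: "U \<in> carrier PK" using U AlgK_sub by blast
  obtain n :: nat and l where l: "\<forall>e\<le>n. l e \<in> PF" "l n \<noteq> \<zero>\<^bsub>PK\<^esub>"
    "(\<Oplus>\<^bsub>PK\<^esub>e\<in>{..n}. l e \<otimes>\<^bsub>PK\<^esub> U [^]\<^bsub>PK\<^esub> e) = \<zero>\<^bsub>PK\<^esub>"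
    using U unfolding AlgK_iff by auto
  have lK: "l e \<in> carrier PK" if "e \<le> n" for e using l(1) that PF_carrier by blast
  have "\<forall>\<^sub>F i in cofin C. val (\<Oplus>\<^bsub>PK\<^esub>e\<in>{..n}. l e \<otimes>\<^bsub>PK\<^esub> U [^]\<^bsub>PK\<^esub> e) i
    = (\<Oplus>\<^bsub>K i\<^esub>e\<in>{..n}. (\<lambda>e\<in>{..n}. val (l e) i) e \<otimes>\<^bsub>K i\<^esub> val U i [^]\<^bsub>K i\<^esub> e)"
    by (rule P_lincomb) (use lK UK Ks.P_nat_pow[OF UK] in auto)
  moreover have "\<forall>\<^sub>F i in cofin C. \<forall>e\<in>{..n}. val (l e) i \<in> \<Psi> i ` carrier F"
    by (rule eventually_ball_finite) (use PF_val l(1) in auto)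
  moreover have "\<forall>\<^sub>F i in cofin C. val (l n) i \<noteq> \<zero>\<^bsub>K i\<^esub>"
    by (rule Ks.P_nonzero[OF lK l(2)]) simp
  ultimately have "\<forall>\<^sub>F i in cofin C. card (orb_at i (val U i)) \<le> n"
    unfolding l(3) using Ks.P_zero(2) Ks.P_val_in[OF UK]
  proof eventually_elim
    fix i assume h: "val \<zero>\<^bsub>PK\<^esub> i = (\<Oplus>\<^bsub>K i\<^esub>e\<in>{..n}. (\<lambda>e\<in>{..n}. val (l e) i) e \<otimes>\<^bsub>K i\<^esub> val U i [^]\<^bsub>K i\<^esub> e)"
      "\<forall>e\<in>{..n}. val (l e) i \<in> \<Psi> i ` carrier F" "val (l n) i \<noteq> \<zero>\<^bsub>K i\<^esub>" "val \<zero>\<^bsub>PK\<^esub> i = \<zero>\<^bsub>K i\<^esub>"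
      "val U i \<in> carrier (K i)"
    interpret Ki: finite_galois_action "K i" "G i" "act i" "\<Psi> i ` carrier F" by (rule galois_act)
    show "card (orb_at i (val U i)) \<le> n"
      by (rule Ki.card_orb_le[where l = "\<lambda>e\<in>{..n}. val (l e) i"]) (use h in auto)
  qed
  then show ?thesis by blast
qed

text \<open>The conjugation condition is decidable, so otherwise almost all indices admit no conjugating
  element. There, a relation over \<open>F\<close> of bounded length separates the two tuples; finding these
  relations computably gives one over \<open>PF\<close>, which \<open>\<tau>\<close> would have to respect.\<close>

lemma density_tuple:
  fixes m :: nat
  assumes \<tau>: "\<tau> \<in> field_auts AlgK PF" and a: "\<And>j. j < m \<Longrightarrow> a j \<in> carrier AlgK"
  shows "\<exists>S\<in>carrier PG. \<forall>j<m. A S (a j) = \<tau> (a j)"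
proof (rule ccontr)
  assume none: "\<not> ?thesis"
  have th: "\<tau> \<in> ring_hom AlgK AlgK" and \<tau>PF: "\<And>x. x \<in> PF \<Longrightarrow> \<tau> x = x"
    using \<tau> by (auto simp: field_auts_def)
  define b where "b j = \<tau> (a j)" for j
  have bA: "b j \<in> carrier AlgK" if "j < m" for j
    using ring_hom_closed[OF th a[OF that]] by (simp add: b_def)
  have aK: "a j \<in> carrier PK" and bK: "b j \<in> carrier PK" if "j < m" for j
    using a[OF that] bA[OF that] AlgK_sub by auto
  let ?va = "\<lambda>i j. val (a j) i" and ?vb = "\<lambda>i j. val (b j) i"
  let ?castG = "cast (\<lambda>i. carrier (G i)) (\<lambda>i. \<one>\<^bsub>G i\<^esub>)"
  have vals: "\<forall>\<^sub>F i in cofin C. \<forall>j\<in>{..<m}. ?va i j \<in> carrier (K i) \<and> ?vb i j \<in> carrier (K i)"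
  proof (rule eventually_ball_finite)
    show "\<forall>j\<in>{..<m}. \<forall>\<^sub>F i in cofin C. ?va i j \<in> carrier (K i) \<and> ?vb i j \<in> carrier (K i)"
      using Ks.P_val_in aK bK by (auto intro: eventually_conj)
  qed simp
  have dec: "udec C (\<lambda>i z. \<forall>j<m. act i (?castG i z) (?va i j) = ?vb i j)"
    by (rule udec_all_less, rule udec_eq[OF ucomp_op2[OF act_uop2
        ucomp_cast[OF Gs.G_uset Gs.G_one_uconst ucomp_var] Ks.P_ucomp[OF aK]] Ks.P_ucomp[OF bK]])
  have no_s: "\<not> (\<forall>\<^sub>F i in cofin C. \<exists>s\<in>carrier (G i). \<forall>j<m. act i s (?va i j) = ?vb i j)"
  proof
    assume "\<forall>\<^sub>F i in cofin C. \<exists>s\<in>carrier (G i). \<forall>j<m. act i s (?va i j) = ?vb i j"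
    from cp_search[OF cohesive Gs.G_uset Gs.G_one_uconst dec this]
    obtain S where S: "S \<in> cp_carrier C (\<lambda>i. carrier (G i))"
      "\<forall>\<^sub>F i in cofin C. \<forall>j<m. act i (val S i) (?va i j) = ?vb i j" by blast
    then have SG: "S \<in> carrier PG" by (simp add: Gs.carrier_cp_group)
    have "A S (a j) = b j" if j: "j < m" for j
    proof (rule Ks.P_eqI[OF A_val(1)[OF SG aK[OF j]] bK[OF j]])
      show "\<forall>\<^sub>F i in cofin C. val (A S (a j)) i = val (b j) i"
        using A_val(2)[OF SG aK[OF j]] S(2) by eventually_elim (simp add: j)
    qed
    then show False using none SG by (auto simp: b_def)
  qed
  \<comment> \<open>The default value of the cast is the unit of the group, so every successful
    number yields a genuine element of \<open>G i\<close>.\<close>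
  have z_s: "\<exists>s\<in>carrier (G i). \<forall>j<m. act i s (?va i j) = ?vb i j"
    if "\<forall>j<m. act i (?castG i z) (?va i j) = ?vb i j" for i z
    using that Gs.G_one_uconst by (intro bexI[of _ "?castG i z"]) (auto simp: cast_def uconst_def)
  have "\<not> (\<forall>\<^sub>F i in cofin C. \<exists>z. \<forall>j<m. act i (?castG i z) (?va i j) = ?vb i j)"
  proof
    assume "\<forall>\<^sub>F i in cofin C. \<exists>z. \<forall>j<m. act i (?castG i z) (?va i j) = ?vb i j"
    then have "\<forall>\<^sub>F i in cofin C. \<exists>s\<in>carrier (G i). \<forall>j<m. act i s (?va i j) = ?vb i j"
      by (rule eventually_mono) (elim exE, rule z_s)
    with no_s show False by (rule notE)
  qed
  with search(1)[OF cohesive dec]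
  have "\<forall>\<^sub>F i in cofin C. \<forall>z. \<not> (\<forall>j<m. act i (?castG i z) (?va i j) = ?vb i j)" by blast
  then have sep: "\<forall>\<^sub>F i in cofin C. \<forall>s\<in>carrier (G i). \<exists>j<m. act i s (?va i j) \<noteq> ?vb i j"
  proof eventually_elim
    fix i assume h: "\<forall>z. \<not> (\<forall>j<m. act i (?castG i z) (?va i j) = ?vb i j)"
    show "\<forall>s\<in>carrier (G i). \<exists>j<m. act i s (?va i j) \<noteq> ?vb i j"
    proof
      fix s assume "s \<in> carrier (G i)"
      then show "\<exists>j<m. act i s (?va i j) \<noteq> ?vb i j" using h[rule_format, of s] by (simp add: cast_in)
    qed
  qed
  have "\<forall>j<m. \<exists>n. \<forall>\<^sub>F i in cofin C. card (orb_at i (?va i j)) \<le> n"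
    using AlgK_orbits_bounded a by blast
  then obtain d where d: "\<forall>j<m. \<forall>\<^sub>F i in cofin C. card (orb_at i (?va i j)) \<le> d j" by metis
  then have deg: "\<forall>\<^sub>F i in cofin C. \<forall>j\<in>{..<m}. card (orb_at i (?va i j)) \<le> d j"
    by (intro eventually_ball_finite) auto
  \<comment> \<open>The degree of the separating product is bounded by the sum of the orbit sizes,
    hence by this number at almost all \<open>i\<close>. One index set of words thus serves all
    these factors.\<close>
  define N where "N = (\<Sum>j<m. d j)"
  let ?W = "words m N"
  \<comment> \<open>Both clauses are equality tests between computable elements and hence decidable.
    Only coefficients are sought here; zero serves as the point that \<open>base_search\<close> asks
    for.\<close>
  define Q where "Q i \<kappa> x \<longleftrightarrow>
    (\<Oplus>\<^bsub>K i\<^esub>w\<in>?W. \<kappa> w \<otimes>\<^bsub>K i\<^esub> ring.wval (K i) (?va i) w) = \<zero>\<^bsub>K i\<^esub> \<and>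
    (\<Oplus>\<^bsub>K i\<^esub>w\<in>?W. \<kappa> w \<otimes>\<^bsub>K i\<^esub> ring.wval (K i) (?vb i) w) \<noteq> \<zero>\<^bsub>K i\<^esub>" for i \<kappa> and x :: nat
  have set_W: "set w \<subseteq> {..<m}" if "w \<in> ?W" for w using that by (simp add: words_def)
  have Q: "udec C (\<lambda>i z. Q i (\<lambda>w\<in>?W. c w i z) (x i z))"
    if c: "\<And>w. w \<in> ?W \<Longrightarrow> ucomp C (\<lambda>i. carrier (K i)) (\<lambda>i z. c w i z)" for c x
    unfolding Q_def
    by (intro udec_conj udec_not udec_eq[OF Ks.K_finsum_ucomp ucomp_const[OF Ks.K_zero_uconst]] finite_words)
      (auto intro!: ucomp_op2[OF Ks.K_mult_uop2] c Ks.K_wval_ucomp[OF _ set_W] Ks.P_ucomp aK bK)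
  have exK: "\<forall>\<^sub>F i in cofin C. \<exists>\<kappa>. (\<forall>w\<in>?W. \<kappa> w \<in> \<Psi> i ` carrier F) \<and> Q i (\<lambda>w\<in>?W. \<kappa> w) \<zero>\<^bsub>K i\<^esub>"
    using sep deg vals
  proof eventually_elim
    fix i assume h: "\<forall>s\<in>carrier (G i). \<exists>j<m. act i s (?va i j) \<noteq> ?vb i j"
      "\<forall>j\<in>{..<m}. card (orb_at i (?va i j)) \<le> d j"
      "\<forall>j\<in>{..<m}. ?va i j \<in> carrier (K i) \<and> ?vb i j \<in> carrier (K i)"
    interpret Ki: finite_galois_action "K i" "G i" "act i" "\<Psi> i ` carrier F" by (rule galois_act)
    have "(\<Sum>j<m. card (Ki.orb (?va i j))) \<le> N" unfolding N_def using h(2) by (intro sum_mono) auto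
    then obtain \<kappa> where \<kappa>: "\<And>w. w \<in> ?W \<Longrightarrow> \<kappa> w \<in> \<Psi> i ` carrier F"
      "(\<Oplus>\<^bsub>K i\<^esub>w\<in>?W. \<kappa> w \<otimes>\<^bsub>K i\<^esub> Ki.wval (?va i) w) = \<zero>\<^bsub>K i\<^esub>"
      "(\<Oplus>\<^bsub>K i\<^esub>w\<in>?W. \<kappa> w \<otimes>\<^bsub>K i\<^esub> Ki.wval (?vb i) w) \<noteq> \<zero>\<^bsub>K i\<^esub>"
      using Ki.separate_orbits[of m "?va i" "?vb i" N] h(1,3) by auto
    have \<kappa>K: "\<kappa> w \<in> carrier (K i)" if "w \<in> ?W" for w
      using \<kappa>(1)[OF that] subfieldE(3)[OF Ki.k_subfield] by auto
    have wv: "Ki.wval (?va i) w \<in> carrier (K i)" "Ki.wval (?vb i) w \<in> carrier (K i)" if "w \<in> ?W" for w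
      using Ki.wval_closed[OF _ set_W[OF that]] h(3) by auto
    have "(\<Oplus>\<^bsub>K i\<^esub>w\<in>?W. (\<lambda>w\<in>?W. \<kappa> w) w \<otimes>\<^bsub>K i\<^esub> Ki.wval (?va i) w)
      = (\<Oplus>\<^bsub>K i\<^esub>w\<in>?W. \<kappa> w \<otimes>\<^bsub>K i\<^esub> Ki.wval (?va i) w)"
      "(\<Oplus>\<^bsub>K i\<^esub>w\<in>?W. (\<lambda>w\<in>?W. \<kappa> w) w \<otimes>\<^bsub>K i\<^esub> Ki.wval (?vb i) w)
      = (\<Oplus>\<^bsub>K i\<^esub>w\<in>?W. \<kappa> w \<otimes>\<^bsub>K i\<^esub> Ki.wval (?vb i) w)"
      using \<kappa>K wv by (auto intro!: Ki.finsum_cong')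
    then show "\<exists>\<kappa>. (\<forall>w\<in>?W. \<kappa> w \<in> \<Psi> i ` carrier F) \<and> Q i (\<lambda>w\<in>?W. \<kappa> w) \<zero>\<^bsub>K i\<^esub>"
      using \<kappa> unfolding Q_def by (intro exI[of _ \<kappa>]) simp
  qed
  have zeroK: "\<zero>\<^bsub>K i\<^esub> \<in> carrier (K i)" for i using Ks.K_zero_uconst by (simp add: uconst_def)
  have "\<not> (\<forall>\<^sub>F i in cofin C. \<forall>\<kappa> x. (\<forall>w\<in>?W. \<kappa> w \<in> \<Psi> i ` carrier F) \<longrightarrow> x \<in> carrier (K i) \<longrightarrow>
       \<not> Q i (\<lambda>w\<in>?W. \<kappa> w) x)"
  proof
    assume "\<forall>\<^sub>F i in cofin C. \<forall>\<kappa> x. (\<forall>w\<in>?W. \<kappa> w \<in> \<Psi> i ` carrier F) \<longrightarrow> x \<in> carrier (K i) \<longrightarrow>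
       \<not> Q i (\<lambda>w\<in>?W. \<kappa> w) x"
    with exK have "\<forall>\<^sub>F i in cofin C. False"
      by eventually_elim (use zeroK in blast)
    then show False using not_eventually_False by simp
  qed
  then obtain B U where B: "\<forall>w\<in>?W. B w \<in> PF" and "\<forall>\<^sub>F i in cofin C. Q i (\<lambda>w\<in>?W. val (B w) i) (val U i)"
    using base_search[of ?W Q, OF finite_words Q] by blast
  then have Qa: "\<forall>\<^sub>F i in cofin C. (\<Oplus>\<^bsub>K i\<^esub>w\<in>?W. (\<lambda>w\<in>?W. val (B w) i) w \<otimes>\<^bsub>K i\<^esub> ring.wval (K i) (?va i) w) = \<zero>\<^bsub>K i\<^esub>"
    and Qb: "\<forall>\<^sub>F i in cofin C. (\<Oplus>\<^bsub>K i\<^esub>w\<in>?W. (\<lambda>w\<in>?W. val (B w) i) w \<otimes>\<^bsub>K i\<^esub> ring.wval (K i) (?vb i) w) \<noteq> \<zero>\<^bsub>K i\<^esub>"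
    unfolding Q_def by (auto elim: eventually_mono)
  have BK: "B w \<in> carrier PK" if "w \<in> ?W" for w using B that PF_carrier by blast
  have wvK: "PK.wval a w \<in> carrier PK" "PK.wval b w \<in> carrier PK" if "w \<in> ?W" for w
    using PK.wval_closed[OF _ set_W[OF that]] aK bK by auto
  let ?fa = "\<lambda>w. B w \<otimes>\<^bsub>PK\<^esub> PK.wval a w" and ?fb = "\<lambda>w. B w \<otimes>\<^bsub>PK\<^esub> PK.wval b w"
  have sa: "\<forall>\<^sub>F i in cofin C. val (finsum PK ?fa ?W) i = \<zero>\<^bsub>K i\<^esub>"
  proof -
    have "\<forall>\<^sub>F i in cofin C. val (finsum PK ?fa ?W) i
      = (\<Oplus>\<^bsub>K i\<^esub>w\<in>?W. (\<lambda>w\<in>?W. val (B w) i) w \<otimes>\<^bsub>K i\<^esub> ring.wval (K i) (?va i) w)"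
      by (rule P_lincomb) (use BK wvK Ks.P_wval[OF aK set_W] in auto)
    with Qa show ?thesis by eventually_elim simp
  qed
  have sb: "\<forall>\<^sub>F i in cofin C. val (finsum PK ?fb ?W) i \<noteq> \<zero>\<^bsub>K i\<^esub>"
  proof -
    have "\<forall>\<^sub>F i in cofin C. val (finsum PK ?fb ?W) i
      = (\<Oplus>\<^bsub>K i\<^esub>w\<in>?W. (\<lambda>w\<in>?W. val (B w) i) w \<otimes>\<^bsub>K i\<^esub> ring.wval (K i) (?vb i) w)"
      by (rule P_lincomb) (use BK wvK Ks.P_wval[OF bK set_W] in auto)
    with Qb show ?thesis by eventually_elim simp
  qed
  have fK: "?fa w \<in> carrier PK" "?fb w \<in> carrier PK" if "w \<in> ?W" for w using BK wvK that by auto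
  have "finsum PK ?fa ?W = \<zero>\<^bsub>PK\<^esub>"
    using Ks.P_eq_zero_iff[of "finsum PK ?fa ?W"] sa fK by auto
  interpret Alg: field AlgK by (rule AlgK_field)
  \<comment> \<open>\<open>\<tau>\<close> is defined on the algebraic part only, so the words in
    \<open>a\<close> have to be shown to stay inside it.\<close>
  have wva: "PK.wval a w \<in> carrier AlgK \<and> \<tau> (PK.wval a w) = PK.wval b w" if "set w \<subseteq> {..<m}" for w
    using that
  proof (induction w)
    case Nil
    show ?case using Alg.one_closed ring_hom_one[OF th] by (simp add: AlgK_simps)
  next
    case (Cons j w)
    have j: "a j \<in> carrier AlgK" using a Cons.prems by simp
    have IH: "PK.wval a w \<in> carrier AlgK" "\<tau> (PK.wval a w) = PK.wval b w" using Cons by auto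
    show ?case using Alg.m_closed[OF j IH(1)] ring_hom_mult[OF th j IH(1)] IH(2)
      by (simp add: AlgK_simps b_def[symmetric])
  qed
  have incl: "id \<in> ring_hom AlgK PK"
    using AlgK_sub by (intro ring_hom_memI) (auto simp: AlgK_simps)
  have th': "\<tau> \<in> ring_hom AlgK PK"
    using ring_hom_trans[OF th incl] by simp
  interpret i: ring_hom_cring AlgK PK id
    using Alg.cring_axioms PK.cring_axioms incl by (intro ring_hom_cring.intro) (auto simp: ring_hom_cring_axioms_def)
  interpret t: ring_hom_cring AlgK PK \<tau>
    using Alg.cring_axioms PK.cring_axioms th' by (intro ring_hom_cring.intro) (auto simp: ring_hom_cring_axioms_def)
  have fA: "?fa w \<in> carrier AlgK" "\<tau> (?fa w) = ?fb w" if "w \<in> ?W" for w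
  proof -
    have Bw: "B w \<in> carrier AlgK" "\<tau> (B w) = B w" using B that PF_AlgK \<tau>PF by auto
    note w = wva[OF set_W[OF that]]
    show "?fa w \<in> carrier AlgK" using Alg.m_closed[OF Bw(1)] w by (simp add: AlgK_simps)
    show "\<tau> (?fa w) = ?fb w" using ring_hom_mult[OF th Bw(1)] w Bw(2) by (simp add: AlgK_simps)
  qed
  \<comment> \<open>Sums in \<open>AlgK\<close> and in \<open>PK\<close> are identified through the
    inclusion homomorphism, since \<open>\<tau>\<close> respects the former while the relation was
    obtained in the latter.\<close>
  have "finsum AlgK ?fa ?W = finsum PK ?fa ?W"
    using i.hom_finsum[of ?fa ?W] fA by (simp add: comp_def Pi_def)
  moreover have "\<tau> (finsum AlgK ?fa ?W) = finsum PK (\<lambda>w. \<tau> (?fa w)) ?W"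
    using t.hom_finsum[of ?fa ?W] fA by (simp add: comp_def Pi_def)
  moreover have "finsum PK (\<lambda>w. \<tau> (?fa w)) ?W = finsum PK ?fb ?W"
    using fA fK by (intro PK.finsum_cong') auto
  ultimately have "finsum PK ?fb ?W = \<tau> \<zero>\<^bsub>PK\<^esub>" using \<open>finsum PK ?fa ?W = \<zero>\<^bsub>PK\<^esub>\<close> by simp
  also have "\<dots> = \<zero>\<^bsub>PK\<^esub>" using t.hom_zero by (simp add: AlgK_simps)
  finally have "finsum PK ?fb ?W = \<zero>\<^bsub>PK\<^esub>" .
  have "\<forall>\<^sub>F i in cofin C. False"
    using sb[unfolded \<open>finsum PK ?fb ?W = \<zero>\<^bsub>PK\<^esub>\<close>] Ks.P_zero(2) by eventually_elim simp
  then show False using not_eventually_False by simp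
qed

text \<open>The set on which \<open>val S\<close> moves a point of degree at most \<open>n\<close> is searchable, unlike membership
  in a subgroup of index \<open>n\<close>; the two are linked by the fixed field of the subgroup.\<close>

lemma trivial_on_AlgK_iff:
  assumes S: "S \<in> carrier PG"
  shows "(\<forall>U\<in>carrier AlgK. A S U = U) \<longleftrightarrow> (\<forall>n\<ge>1. \<forall>\<^sub>F i in cofin C.
    val S i \<in> carrier (G i) \<inter> \<Inter>{H. subgroup H (G i) \<and> card (rcosets\<^bsub>G i\<^esub> H) = n})"
proof (intro iffI allI impI ballI)
  fix U assume cond: "\<forall>n\<ge>1. \<forall>\<^sub>F i in cofin C.
    val S i \<in> carrier (G i) \<inter> \<Inter>{H. subgroup H (G i) \<and> card (rcosets\<^bsub>G i\<^esub> H) = n}"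
    and U: "U \<in> carrier AlgK"
  have UK: "U \<in> carrier PK" using U AlgK_sub by blast
  obtain n where n: "\<forall>\<^sub>F i in cofin C. card (orb_at i (val U i)) \<le> n"
    using AlgK_orbits_bounded[OF U] by blast
  \<comment> \<open>The stabilizer of \<open>val U i\<close> has an index that may vary with
    \<open>i\<close> but is at most \<open>n\<close>, so the hypothesis is needed for all indices
    from 1 to \<open>n\<close> simultaneously.\<close>
  have "\<forall>\<^sub>F i in cofin C. \<forall>r\<in>{1..n}.
    val S i \<in> carrier (G i) \<inter> \<Inter>{H. subgroup H (G i) \<and> card (rcosets\<^bsub>G i\<^esub> H) = r}"
    by (rule eventually_ball_finite) (use cond in auto)
  then have "\<forall>\<^sub>F i in cofin C. val (A S U) i = val U i"
    using n Ks.P_val_in[OF UK] A_val(2)[OF S UK]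
  proof eventually_elim
    fix i assume h: "\<forall>r\<in>{1..n}. val S i \<in> carrier (G i) \<inter> \<Inter>{H. subgroup H (G i) \<and> card (rcosets\<^bsub>G i\<^esub> H) = r}"
      "card (orb_at i (val U i)) \<le> n" "val U i \<in> carrier (K i)" "val (A S U) i = act i (val S i) (val U i)"
    interpret Ki: finite_galois_action "K i" "G i" "act i" "\<Psi> i ` carrier F" by (rule galois_act)
    have "val S i \<in> Ki.stab (val U i)"
      using h(1)[rule_format, of "card (Ki.orb (val U i))"] h(2) Ki.card_orb_pos[OF h(3)]
        Ki.stab_orb(1)[OF h(3)] Ki.card_rcosets_stab[OF h(3)] by auto
    then show "val (A S U) i = val U i" using h(4) by (simp add: Ki.stab_def)
  qed
  then show "A S U = U" by (rule Ks.P_eqI[OF A_val(1)[OF S UK] UK])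
next
  fix n :: nat assume triv: "\<forall>U\<in>carrier AlgK. A S U = U" and n: "1 \<le> n"
  \<comment> \<open>Says that \<open>x\<close> is moved by \<open>val S i\<close> and is a root of a
    polynomial of degree exactly \<open>n\<close>; the polynomial is the searchable witness for
    \<open>x\<close> having at most \<open>n\<close> conjugates.\<close>
  define Q where "Q i \<kappa> x \<longleftrightarrow> (\<Oplus>\<^bsub>K i\<^esub>e\<in>{..n}. \<kappa> e \<otimes>\<^bsub>K i\<^esub> x [^]\<^bsub>K i\<^esub> e) = \<zero>\<^bsub>K i\<^esub> \<and>
    \<kappa> n \<noteq> \<zero>\<^bsub>K i\<^esub> \<and> act i (val S i) x \<noteq> x" for i and \<kappa> :: "nat \<Rightarrow> nat" and x
  have Q: "udec C (\<lambda>i z. Q i (\<lambda>e\<in>{..n}. c e i z) (x i z))"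
    if c: "\<And>e. e \<in> {..n} \<Longrightarrow> ucomp C (\<lambda>i. carrier (K i)) (\<lambda>i z. c e i z)"
      and x: "ucomp C (\<lambda>i. carrier (K i)) x" for c x
  proof -
    have cS: "ucomp C (\<lambda>i. carrier (G i)) (\<lambda>i z. val S i)"
      using S by (simp add: Gs.carrier_cp_group ucomp_val)
    have sum: "ucomp C (\<lambda>i. carrier (K i))
      (\<lambda>i z. \<Oplus>\<^bsub>K i\<^esub>e\<in>{..n}. (\<lambda>e\<in>{..n}. c e i z) e \<otimes>\<^bsub>K i\<^esub> x i z [^]\<^bsub>K i\<^esub> e)"
      by (rule Ks.K_finsum_ucomp) (auto intro!: ucomp_op2[OF Ks.K_mult_uop2] c Ks.K_nat_pow_ucomp x)
    have top: "ucomp C (\<lambda>i. carrier (K i)) (\<lambda>i z. (\<lambda>e\<in>{..n}. c e i z) n)" using c[of n] by simp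
    show ?thesis unfolding Q_def
      by (intro udec_conj udec_not udec_eq[OF sum ucomp_const[OF Ks.K_zero_uconst]]
          udec_eq[OF top ucomp_const[OF Ks.K_zero_uconst]] udec_eq[OF ucomp_op2[OF act_uop2 cS x] x])
  qed
  \<comment> \<open>A solution in the product would be an element algebraic over \<open>PF\<close>
    and moved by \<open>S\<close>. By \<open>base_search\<close>, solutions are then missing at
    almost all indices.\<close>
  have "\<not> (\<exists>B U. (\<forall>e\<in>{..n}. B e \<in> PF) \<and> U \<in> carrier PK \<and>
    (\<forall>\<^sub>F i in cofin C. Q i (\<lambda>e\<in>{..n}. val (B e) i) (val U i)))"
  proof (intro notI, elim exE conjE)
    fix B U assume B: "\<forall>e\<in>{..n}. B e \<in> PF" and U: "U \<in> carrier PK"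
      and ev: "\<forall>\<^sub>F i in cofin C. Q i (\<lambda>e\<in>{..n}. val (B e) i) (val U i)"
    have BK: "B e \<in> carrier PK" if "e \<le> n" for e using B that PF_carrier by auto
    let ?s = "\<Oplus>\<^bsub>PK\<^esub>e\<in>{..n}. B e \<otimes>\<^bsub>PK\<^esub> U [^]\<^bsub>PK\<^esub> e"
    have "\<forall>\<^sub>F i in cofin C. val ?s i
      = (\<Oplus>\<^bsub>K i\<^esub>e\<in>{..n}. (\<lambda>e\<in>{..n}. val (B e) i) e \<otimes>\<^bsub>K i\<^esub> val U i [^]\<^bsub>K i\<^esub> e)"
      by (rule P_lincomb) (use BK U Ks.P_nat_pow[OF U] in auto)
    then have "\<forall>\<^sub>F i in cofin C. val ?s i = \<zero>\<^bsub>K i\<^esub>" using ev by eventually_elim (simp add: Q_def)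
    moreover have "?s \<in> carrier PK" using BK U by auto
    ultimately have s0: "?s = \<zero>\<^bsub>PK\<^esub>" using Ks.P_eq_zero_iff by blast
    have "B n \<noteq> \<zero>\<^bsub>PK\<^esub>"
    proof
      assume Bn: "B n = \<zero>\<^bsub>PK\<^esub>"
      have "\<forall>\<^sub>F i in cofin C. False" using ev Ks.P_zero(2) by eventually_elim (simp add: Q_def Bn)
      then show False using not_eventually_False by simp
    qed
    then have "U \<in> carrier AlgK" unfolding AlgK_iff using U B s0 by blast
    then have AU: "A S U = U" using triv by blast
    have "\<forall>\<^sub>F i in cofin C. False"
      using ev A_val(2)[OF S U] unfolding AU by eventually_elim (auto simp: Q_def)
    then show False using not_eventually_False by simp
  qed
  with base_search[of "{..n}" Q, OF finite_atMost Q]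
  have "\<forall>\<^sub>F i in cofin C. \<forall>\<kappa> x. (\<forall>e\<in>{..n}. \<kappa> e \<in> \<Psi> i ` carrier F) \<longrightarrow> x \<in> carrier (K i) \<longrightarrow>
       \<not> Q i (\<lambda>e\<in>{..n}. \<kappa> e) x" by blast
  then show "\<forall>\<^sub>F i in cofin C. val S i \<in> carrier (G i) \<inter> \<Inter>{H. subgroup H (G i) \<and> card (rcosets\<^bsub>G i\<^esub> H) = n}"
    using Gs.cp_group_val_in[OF S]
  proof eventually_elim
    fix i assume h: "\<forall>\<kappa> x. (\<forall>e\<in>{..n}. \<kappa> e \<in> \<Psi> i ` carrier F) \<longrightarrow> x \<in> carrier (K i) \<longrightarrow>
       \<not> Q i (\<lambda>e\<in>{..n}. \<kappa> e) x" and Si: "val S i \<in> carrier (G i)"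
    interpret Ki: finite_galois_action "K i" "G i" "act i" "\<Psi> i ` carrier F" by (rule galois_act)
    \<comment> \<open>Otherwise some fixed point of \<open>H\<close> is moved by
      \<open>val S i\<close>. Its orbit has at most \<open>n\<close> elements, so it has a
      polynomial of degree \<open>n\<close> and solves \<open>Q\<close>.\<close>
    have "val S i \<in> H" if H: "subgroup H (G i)" "card (rcosets\<^bsub>G i\<^esub> H) = n" for H
    proof (rule ccontr)
      assume "val S i \<notin> H"
      then obtain x where x: "x \<in> carrier (K i)" "\<And>h. h \<in> H \<Longrightarrow> act i h x = x" "act i (val S i) x \<noteq> x"
        using Ki.artin[OF H(1) Si] by blast
      have "card (Ki.orb x) \<le> n" using Ki.card_orb_le_index[OF x(1) H(1) x(2)] H(2) by simp
      then obtain l where l: "\<And>e. e \<le> n \<Longrightarrow> l e \<in> \<Psi> i ` carrier F" "l n \<noteq> \<zero>\<^bsub>K i\<^esub>"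
        "(\<Oplus>\<^bsub>K i\<^esub>e\<in>{..n}. l e \<otimes>\<^bsub>K i\<^esub> x [^]\<^bsub>K i\<^esub> e) = \<zero>\<^bsub>K i\<^esub>"
        using Ki.bounded_degree[OF x(1)] by blast
      have lK: "l e \<in> carrier (K i)" if "e \<le> n" for e
        using l(1)[OF that] subfieldE(3)[OF Ki.k_subfield] by auto
      have "(\<Oplus>\<^bsub>K i\<^esub>e\<in>{..n}. (\<lambda>e\<in>{..n}. l e) e \<otimes>\<^bsub>K i\<^esub> x [^]\<^bsub>K i\<^esub> e)
        = (\<Oplus>\<^bsub>K i\<^esub>e\<in>{..n}. l e \<otimes>\<^bsub>K i\<^esub> x [^]\<^bsub>K i\<^esub> e)"
        using lK x(1) by (intro Ki.finsum_cong') auto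
      then have "Q i (\<lambda>e\<in>{..n}. l e) x" using l x by (simp add: Q_def)
      then show False using h l(1) x(1) by auto
    qed
    then show "val S i \<in> carrier (G i) \<inter> \<Inter>{H. subgroup H (G i) \<and> card (rcosets\<^bsub>G i\<^esub> H) = n}"
      using Si by blast
  qed
qed

end

section \<open>The restriction maps: faithfulness, density and kernel\<close>

context galois_sequence
begin

lemma A_restrict_PK: "(\<lambda>S. restrict (A S) (carrier PK)) \<in> hom PG (AutGroup_over PK PF)"
  by (rule A_restrict_hom[OF PF_carrier]) (use PK.ring_axioms A_val(1) in auto)

lemma A_restrict_AlgK: "(\<lambda>S. restrict (A S) (carrier AlgK)) \<in> hom PG (AutGroup_over AlgK PF)"
  by (rule A_restrict_hom[OF PF_AlgK AlgK_sub AlgK_eq])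
    (use field.is_ring[OF AlgK_field] A_AlgK in auto)

lemma A_restrict_inj: "inj_on (\<lambda>S. restrict (A S) (carrier PK)) (carrier PG)"
proof (rule inj_onI)
  fix S T assume S: "S \<in> carrier PG" and T: "T \<in> carrier PG"
    and eq: "restrict (A S) (carrier PK) = restrict (A T) (carrier PK)"
  show "S = T"
  proof (rule A_faithful[OF S T])
    show "A S U = A T U" if "U \<in> carrier PK" for U using fun_cong[OF eq, of U] that by simp
  qed
qed

lemma faithful_action_PK: "faithful_action PG (carrier PK) (\<lambda>S. restrict (A S) (carrier PK))"
proof (intro faithful_action.intro group_action.intro faithful_action_axioms.intro A_restrict_inj
    group_hom.intro group_hom_axioms.intro PG.group_axioms group_BijGroup)
  show "(\<lambda>S. restrict (A S) (carrier PK)) \<in> hom PG (BijGroup (carrier PK))"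
    using A_restrict_PK unfolding AutGroup_over_def hom_def
    by (auto simp: BijGroup_def field_auts_def)
qed

text \<open>A subbasic open set containing \<open>\<tau>\<close> consists of the automorphisms that
  agree with \<open>\<tau>\<close> on some \<open>E\<close> of finite dimension, and for this,
  agreement on a finite spanning list suffices. Intersections are handled by uniting the finite
  sets.\<close>

lemma krull_nhd_finite:
  assumes "generate_topology_on {{\<tau> \<in> field_auts AlgK PF. \<forall>x\<in>E. \<tau> x = \<sigma> x} | \<sigma> E.
        \<sigma> \<in> field_auts AlgK PF \<and> subfield E AlgK \<and> PF \<subseteq> E \<and>
        ring.finite_dimension AlgK PF E \<and> galois_extension (AlgK\<lparr>carrier := E\<rparr>) PF} T"
    and "\<tau> \<in> T" "\<tau> \<in> field_auts AlgK PF"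
  shows "\<exists>D. finite D \<and> D \<subseteq> carrier AlgK \<and> (\<forall>g\<in>field_auts AlgK PF. (\<forall>x\<in>D. g x = \<tau> x) \<longrightarrow> g \<in> T)"
  using assms(1,2)
proof (induction rule: generate_topology_on.induct)
  case (Int S T)
  then obtain D D' where "finite D" "D \<subseteq> carrier AlgK" "\<forall>g\<in>field_auts AlgK PF. (\<forall>x\<in>D. g x = \<tau> x) \<longrightarrow> g \<in> S"
    "finite D'" "D' \<subseteq> carrier AlgK" "\<forall>g\<in>field_auts AlgK PF. (\<forall>x\<in>D'. g x = \<tau> x) \<longrightarrow> g \<in> T" by auto
  then show ?case by (intro exI[of _ "D \<union> D'"]) auto
next
  case (UN \<T>)
  obtain T where T: "T \<in> \<T>" "\<tau> \<in> T" using UN.prems by (elim UnionE)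
  from UN.IH[OF T] obtain D where "finite D" "D \<subseteq> carrier AlgK"
    "\<forall>g\<in>field_auts AlgK PF. (\<forall>x\<in>D. g x = \<tau> x) \<longrightarrow> g \<in> T" by (elim exE conjE)
  then show ?case using T(1) by (intro exI[of _ D]) auto
next
  case (Basis T)
  interpret Alg: field AlgK by (rule AlgK_field)
  obtain \<sigma> E where T: "T = {\<tau> \<in> field_auts AlgK PF. \<forall>x\<in>E. \<tau> x = \<sigma> x}"
    and fin: "Alg.finite_dimension PF E" using Basis.hyps by blast
  obtain Us where Us: "set Us \<subseteq> carrier AlgK" "Alg.Span PF Us = E"
    using Alg.finite_dimension_imp_Span[OF PF_subfield_AlgK fin] .
  have "g \<in> T" if g: "g \<in> field_auts AlgK PF" and eq: "\<forall>x\<in>set Us. g x = \<tau> x" for g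
  proof -
    have h: "g \<in> ring_hom AlgK AlgK" "\<tau> \<in> ring_hom AlgK AlgK" "\<And>x. x \<in> PF \<Longrightarrow> g x = \<tau> x"
      using g assms(3) by (auto simp: field_auts_def)
    have "g x = \<tau> x" if "x \<in> E" for x
      by (rule Alg.hom_eq_on_Span[OF Alg.is_ring h(1,2) PF_AlgK h(3) Us(1)])
        (use eq that Us(2) in auto)
    then show ?thesis using g Basis.prems unfolding T by auto
  qed
  then show ?case using Us(1) by (intro exI[of _ "set Us"]) auto
qed simp

text \<open>A neighbourhood of \<open>\<tau>\<close> contains all automorphisms that agree with
  \<open>\<tau>\<close> on a finite set, and \<open>density_tuple\<close>, applied to an enumeration
  of this set, supplies one from the image.\<close>

lemma A_restrict_dense:
  "krull_topology AlgK PF closure_of ((\<lambda>S. restrict (A S) (carrier AlgK)) ` carrier PG)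
    = carrier (AutGroup_over AlgK PF)"
proof -
  interpret Alg: field AlgK by (rule AlgK_field)
  let ?\<S> = "{{\<tau> \<in> field_auts AlgK PF. \<forall>x\<in>E. \<tau> x = \<sigma> x} | \<sigma> E.
        \<sigma> \<in> field_auts AlgK PF \<and> subfield E AlgK \<and> PF \<subseteq> E \<and>
        ring.finite_dimension AlgK PF E \<and> galois_extension (AlgK\<lparr>carrier := E\<rparr>) PF}"
  have fin: "Alg.finite_dimension PF PF"
    by (rule Alg.finite_dimensionI[OF Alg.dimension_one[OF PF_subfield_AlgK]])
  have top: "topspace (krull_topology AlgK PF) = field_auts AlgK PF"
  proof -
    have "\<tau> \<in> \<Union>?\<S>" if "\<tau> \<in> field_auts AlgK PF" for \<tau>
    proof (rule UnionI)
      show "{\<tau>' \<in> field_auts AlgK PF. \<forall>x\<in>PF. \<tau>' x = \<tau> x} \<in> ?\<S>"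
        using that fin PF_subfield_AlgK galois_extension_refl[OF AlgK_field PF_subfield_AlgK] by blast
    qed (use that in simp)
    then show ?thesis unfolding krull_topology_def topology_generated_by_topspace by blast
  qed
  have "\<exists>y\<in>(\<lambda>S. restrict (A S) (carrier AlgK)) ` carrier PG. y \<in> T"
    if \<tau>: "\<tau> \<in> field_auts AlgK PF" and T: "\<tau> \<in> T" "openin (krull_topology AlgK PF) T" for \<tau> T
  proof -
    have "generate_topology_on ?\<S> T"
      using T(2) unfolding krull_topology_def openin_topology_generated_by_iff .
    from krull_nhd_finite[OF this T(1) \<tau>] obtain D where D: "finite D" "D \<subseteq> carrier AlgK"
      "\<forall>g\<in>field_auts AlgK PF. (\<forall>x\<in>D. g x = \<tau> x) \<longrightarrow> g \<in> T" by blast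
    obtain xs where xs: "set xs = D" using finite_list[OF D(1)] by blast
    have "xs ! j \<in> carrier AlgK" if "j < length xs" for j using xs D(2) nth_mem[OF that] by blast
    from density_tuple[OF \<tau>, of "length xs" "\<lambda>j. xs ! j", OF this]
    obtain S where S: "S \<in> carrier PG" "\<forall>j<length xs. A S (xs ! j) = \<tau> (xs ! j)" by blast
    have "A S x = \<tau> x" if "x \<in> D" for x using that S(2) xs by (auto simp: in_set_conv_nth)
    moreover have "restrict (A S) (carrier AlgK) \<in> field_auts AlgK PF"
      using hom_in_carrier[OF A_restrict_AlgK S(1)] by (simp add: AutGroup_over_def)
    ultimately have "restrict (A S) (carrier AlgK) \<in> T" using D(2,3) by (auto simp: subset_iff)
    then show ?thesis using S(1) by blast
  qed
  then show ?thesis unfolding closure_of_def top by (auto simp: AutGroup_over_def)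
qed

lemma A_restrict_kernel:
  "kernel PG (AutGroup_over AlgK PF) (\<lambda>S. restrict (A S) (carrier AlgK)) =
    {cp_class C (\<lambda>i. carrier (G i)) \<sigma> | \<sigma>. \<sigma> \<in> cp_dom C (\<lambda>i. carrier (G i)) \<and>
      (\<forall>n\<ge>1. C \<subseteq>\<^sup>* {i. \<exists>s. \<sigma> i = Some s \<and>
        s \<in> carrier (G i) \<inter> \<Inter>{H. subgroup H (G i) \<and> card (rcosets\<^bsub>G i\<^esub> H) = n}})}"
    (is "_ = ?R")
proof -
  let ?I = "\<lambda>n i. carrier (G i) \<inter> \<Inter>{H. subgroup H (G i) \<and> card (rcosets\<^bsub>G i\<^esub> H) = n}"
  have one: "\<one>\<^bsub>AutGroup_over AlgK PF\<^esub> = (\<lambda>x\<in>carrier AlgK. x)"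
    by (simp add: AutGroup_over_def BijGroup_def)
  have ker: "S \<in> kernel PG (AutGroup_over AlgK PF) (\<lambda>S. restrict (A S) (carrier AlgK)) \<longleftrightarrow>
    S \<in> carrier PG \<and> (\<forall>n\<ge>1. \<forall>\<^sub>F i in cofin C. val S i \<in> ?I n i)" for S
    using trivial_on_AlgK_iff[of S] unfolding kernel_def one
    by (auto simp: fun_eq_iff restrict_def)
  \<comment> \<open>The kernel was computed with the chosen values \<open>val S i\<close>; any
    representative agrees with them at almost all indices of \<open>C\<close>, so the condition may
    be read off from an arbitrary one.\<close>
  have rep: "(\<forall>\<^sub>F i in cofin C. val S i \<in> ?I n i) \<longleftrightarrow> C \<subseteq>\<^sup>* {i. \<exists>s. \<sigma> i = Some s \<and> s \<in> ?I n i}"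
    if "\<forall>\<^sub>F i in cofin C. \<sigma> i = Some (val S i)" for S \<sigma> n
    unfolding almost_subset_iff by (rule eventually_cong[OF that]) simp
  show ?thesis
  proof (intro subset_antisym subsetI)
    fix S assume "S \<in> kernel PG (AutGroup_over AlgK PF) (\<lambda>S. restrict (A S) (carrier AlgK))"
    then have S: "S \<in> carrier PG" "\<forall>n\<ge>1. \<forall>\<^sub>F i in cofin C. val S i \<in> ?I n i" using ker by auto
    obtain \<sigma> where \<sigma>: "\<sigma> \<in> cp_dom C (\<lambda>i. carrier (G i))" "S = cp_class C (\<lambda>i. carrier (G i)) \<sigma>"
      "\<forall>\<^sub>F i in cofin C. \<sigma> i = Some (val S i)"
      using cp_carrierE[OF S(1)[unfolded Gs.carrier_cp_group]] by metis
    have "\<forall>n\<ge>1. C \<subseteq>\<^sup>* {i. \<exists>s. \<sigma> i = Some s \<and> s \<in> ?I n i}" using S(2) rep[OF \<sigma>(3)] by blast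
    with \<sigma>(1,2) show "S \<in> ?R" by blast
  next
    fix S assume "S \<in> ?R"
    then obtain \<sigma> where \<sigma>: "\<sigma> \<in> cp_dom C (\<lambda>i. carrier (G i))" "S = cp_class C (\<lambda>i. carrier (G i)) \<sigma>"
      "\<forall>n\<ge>1. C \<subseteq>\<^sup>* {i. \<exists>s. \<sigma> i = Some s \<and> s \<in> ?I n i}" by blast
    have "\<forall>\<^sub>F i in cofin C. \<sigma> i = Some (val S i)" unfolding \<sigma>(2) by (rule val_cp_class[OF \<sigma>(1)])
    from rep[OF this] \<sigma>(3) have "\<forall>n\<ge>1. \<forall>\<^sub>F i in cofin C. val S i \<in> ?I n i" by blast
    moreover have "S \<in> carrier PG" using cp_class_in[OF \<sigma>(1)] \<sigma>(2) by (simp add: Gs.carrier_cp_group)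
    ultimately show "S \<in> kernel PG (AutGroup_over AlgK PF) (\<lambda>S. restrict (A S) (carrier AlgK))"
      using ker by blast
  qed
qed

lemma A_restrict_image: "subgroup ((\<lambda>S. restrict (A S) (carrier PK)) ` carrier PG) (AutGroup_over PK PF)"
  using group_hom.img_is_subgroup[OF group_hom.intro[OF PG.group_axioms
      group_AutGroup_over[OF PK.is_ring PF_carrier] group_hom_axioms.intro[OF A_restrict_PK]]] .

lemma A_restrict_iso: "(\<lambda>S. restrict (A S) (carrier PK)) \<in> iso PG
    (AutGroup_over PK PF\<lparr>carrier := (\<lambda>S. restrict (A S) (carrier PK)) ` carrier PG\<rparr>)"
  using A_restrict_PK A_restrict_inj by (auto simp: iso_def hom_def bij_betw_def)

end

theorem theorem4p14:
  fixes F :: "nat ring" and K :: "nat \<Rightarrow> nat ring" and \<Psi> :: "nat \<Rightarrow> nat \<Rightarrow> nat"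
    and G :: "nat \<Rightarrow> nat monoid" and act :: "nat \<Rightarrow> nat \<Rightarrow> nat \<Rightarrow> nat" and C :: "nat set"
  defines "PG \<equiv> cp_group C G"
    and "PK \<equiv> cp_ring C K"
    and "PF \<equiv> cp_base C F K \<Psi>"
  defines "AlgK \<equiv> alg_part PK PF"
  defines "\<Phi> \<equiv> \<lambda>S. restrict (cp_act C K act S) (carrier PK)"
    and "\<rho> \<equiv> \<lambda>S. restrict (cp_act C K act S) (carrier AlgK)"
  assumes "unif_computable_galois_sequence F K \<Psi> G act"
    and "cohesive C"
  shows "(\<forall>\<sigma> \<in> cp_dom C (\<lambda>i. carrier (G i)). \<forall>\<alpha> \<in> cp_dom C (\<lambda>i. carrier (K i)).
           cp_act C K act (cp_class C (\<lambda>i. carrier (G i)) \<sigma>) (cp_class C (\<lambda>i. carrier (K i)) \<alpha>)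
             = cp_class C (\<lambda>i. carrier (K i)) (pointwise act \<sigma> \<alpha>))
      \<and> faithful_action PG (carrier PK) \<Phi>
      \<and> subgroup (\<Phi> ` carrier PG) (AutGroup_over PK PF)
      \<and> \<Phi> \<in> iso PG (AutGroup_over PK PF\<lparr>carrier := \<Phi> ` carrier PG\<rparr>)
      \<and> \<rho> \<in> hom PG (AutGroup_over AlgK PF)
      \<and> (krull_topology AlgK PF) closure_of (\<rho> ` carrier PG) = carrier (AutGroup_over AlgK PF)
      \<and> kernel PG (AutGroup_over AlgK PF) \<rho> =
           {cp_class C (\<lambda>i. carrier (G i)) \<sigma> | \<sigma>.
              \<sigma> \<in> cp_dom C (\<lambda>i. carrier (G i)) \<and>
              (\<forall>n\<ge>1. C \<subseteq>\<^sup>* {i. \<exists>s. \<sigma> i = Some s \<and>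
                 s \<in> carrier (G i) \<inter> \<Inter>{H. subgroup H (G i) \<and> card (rcosets\<^bsub>G i\<^esub> H) = n}})}"
proof -
  interpret galois_sequence F K \<Psi> G act C using assms by (intro galois_sequence.intro)
  show ?thesis
    unfolding PG_def PK_def PF_def AlgK_def \<Phi>_def \<rho>_def
    by (intro conjI ballI) (rule A_class faithful_action_PK A_restrict_image A_restrict_iso A_restrict_AlgK
        A_restrict_dense A_restrict_kernel; assumption?)+
qed

end
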